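(* Let $\lambda=(\lambda_L,\lambda_R)\in\mathbb{R}_+^2$, $\theta>0$, let $\eta$ be a finite point configuration on $(0,1)$ and let $\{\eta_t,\ t\ge0\}$ be the boundary driven Brownian gas on $(0,1)$ with parameters $\lambda_L,\lambda_R$ started from $\eta$. Let $m$ be the Lebesgue measure on $(0,1)$ and $E=[0,1]$, $\partial E=\{0,1\}$. For $n\in\mathbb{N}$ let $$\eta_t^{(n),\theta}(\mathrm{d}\boldsymbol z)=\sum_{I\subset[n]}(-\theta)^{n-|I|}\,\eta_t^{(|I|)}(\mathrm{d}\boldsymbol z_I)\,m^{\otimes(n-|I|)}(\mathrm{d}\boldsymbol z_{[n]\setminus I}),$$ viewed as a (signed) measure on $(0,1)^n$. Then for every $t>0$ the expectation $\mathbb{E}^\lambda_\eta[\eta_t^{(n),\theta}]$ is absolutely continuous with respect to $m^{\otimes n}$ with density $$\frac{\mathrm{d}\mathbb{E}^{\lambda}_\eta[\eta_t^{(n),\theta}]}{\mathrm{d}m^{\otimes n}}(\boldsymbol z)=\sum_{J\subset[n]}\mathbb{E}^{\mathrm{abs}}_{\boldsymbol z_J}\left[\lambda_L^{\xi_t(\{0\})}\lambda_R^{\xi_t(\{1\})}\mathbf 1_{\{\xi_t(\partial E)=|J|\}}\right]\int_{E^{n-|J|}}\mathfrak p_t^{(n-|J|)}(\boldsymbol z_{[n]\setminus J},\boldsymbol y)\,\eta^{[n-|J|],\theta}(\mathrm{d}\boldsymbol y).$$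
   Context: **Absorbed Brownian motion.** $\{W_t\}$ is standard Brownian motion on $[0,1]$ absorbed upon hitting $0$ or $1$; $\mathbb{P}^{\mathrm{abs}}_x$ is its law from $x$ and $\tau_0,\tau_1$ its hitting times of $0,1$. For $t>0$ and $x,y\in(0,1)$, $\mathfrak p_t(x,y)=\mathfrak p_t(y,x)$ is its transition density on $(0,1)$ with respect to Lebesgue measure. For $x\in(0,1)$, $\mathfrak p_t(x,0)$ and $\mathfrak p_t(x,1)$ denote the probabilities, starting from $x$, of being absorbed at $0$, respectively $1$, by time $t$. $\mathfrak p_t^{(n)}(\boldsymbol x,\boldsymbol y)=\prod_{i=1}^n\mathfrak p_t(x_i,y_i)$. **Absorbed particle system.** For $\boldsymbol x\in(0,1)^k$, $\mathbb{E}^{\mathrm{abs}}_{\boldsymbol x}$ is the expectation for $\xi_t=\sum_{i=1}^k\delta_{W_t(i)}$ on $[0,1]$, with $W(i)$ independent copies of $W$, $W_0(i)=x_i$. **Boundary driven Brownian gas.** Started from $\eta=\sum_{i=1}^{\mathbf N}\delta_{x_i}$, $x_i\in(0,1)$, it is, for $t>0$, $\eta_t=\xi_t|_{(0,1)}+\Theta_t$. Here $\xi_t$ is the absorbed particle system with $\xi_0=\eta$, restricted to $(0,1)$, and $\Theta_t$, independent of $\xi_t$, is a Poisson point process on $(0,1)$ with intensity $\left(\lambda_L\mathbb{P}^{\mathrm{abs}}_x(\tau_0\le t)+\lambda_R\mathbb{P}^{\mathrm{abs}}_x(\tau_1\le t)\right)\mathrm{d}x$. $\mathbb{E}^\lambda_\eta$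 denotes expectation for this process. **Factorial measures.** For a finite configuration $\eta=\sum_{i=1}^{\mathbf N}\delta_{x_i}$, $\eta^{(n)}=\sum^{\neq}_{1\le i_1,\dots,i_n\le\mathbf N}\delta_{(x_{i_1},\dots,x_{i_n})}$ (sum over mutually distinct indices), and $\eta_t^{(n)}$ is that of $\eta_t$. **Extended measure.** With $\bar m=m+\delta_0+\delta_1$ on $[0,1]$, $$\eta^{[n],\theta}(\mathrm{d}\boldsymbol z)=\sum_{I\subset[n]}(-\theta)^{n-|I|}\,\eta^{(|I|)}(\mathrm{d}\boldsymbol z_I)\,\bar m^{\otimes(n-|I|)}(\mathrm{d}\boldsymbol z_{[n]\setminus I}),$$ a signed measure on $[0,1]^n$. **Notation.** $[n]=\{1,\dots,n\}$; for $I=\{i_1<\dots<i_k\}\subset[n]$, $\boldsymbol z_I=(z_{i_1},\dots,z_{i_k})$. Terms with no variables have the corresponding factor (expectation or integral) equal to $1$; $0^0=1$. *)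

theory Defs
  imports "HOL-Probability.Probability"
begin

definition standard_brownian_motion :: "'a measure \<Rightarrow> (real \<Rightarrow> 'a \<Rightarrow> real) \<Rightarrow> bool" where
  "standard_brownian_motion M B \<longleftrightarrow>
     prob_space M \<and>
     (\<forall>t\<ge>0. B t \<in> borel_measurable M) \<and>
     (\<forall>\<omega>\<in>space M. B 0 \<omega> = 0) \<and>
     (\<forall>\<omega>\<in>space M. continuous_on {0..} (\<lambda>t. B t \<omega>)) \<and>
     (\<forall>s t. 0 \<le> s \<and> s < t \<longrightarrow>
        distributed M lborel (\<lambda>\<omega>. B t \<omega> - B s \<omega>) (normal_density 0 (sqrt (t - s)))) \<and>
     (\<forall>(k::nat) s. 0 \<le> s 0 \<and> (\<forall>i<k. s i < s (Suc i)) \<longrightarrow>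
        prob_space.indep_vars M (\<lambda>_. borel) (\<lambda>i \<omega>. B (s (Suc i)) \<omega> - B (s i) \<omega>) {..<k})"

text \<open>The infimum of the empty set is \<open>\<infinity>\<close>, so a path that never visits \<open>a\<close> has infinite hitting time.\<close>

definition hitting_time :: "real \<Rightarrow> (real \<Rightarrow> real) \<Rightarrow> ereal" where
  "hitting_time a w = (INF s\<in>{s. 0 \<le> s \<and> w s = a}. ereal s)"

definition absorbed_path :: "(real \<Rightarrow> real) \<Rightarrow> real \<Rightarrow> real" where
  "absorbed_path w t =
     w (real_of_ereal (min (ereal t) (min (hitting_time 0 w) (hitting_time 1 w))))"

definition absorbed_bm :: "(real \<Rightarrow> 'a \<Rightarrow> real) \<Rightarrow> real \<Rightarrow> 'a \<Rightarrow> real \<Rightarrow> real" where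
  "absorbed_bm B x \<omega> = absorbed_path (\<lambda>s. x + B s \<omega>)"

definition path_space :: "(real \<Rightarrow> real) measure" where
  "path_space = PiM {0..} (\<lambda>_. borel)"

definition abs_law :: "'a measure \<Rightarrow> (real \<Rightarrow> 'a \<Rightarrow> real) \<Rightarrow> real \<Rightarrow> (real \<Rightarrow> real) measure" where
  "abs_law M B x = distr M path_space (\<lambda>\<omega>. \<lambda>s\<in>{0..}. absorbed_bm B x \<omega> s)"

text \<open>
  \<open>abs_hit_prob M B a t x\<close> is the probability that absorbed Brownian motion from \<open>x\<close> hits \<open>a\<close> by
  time \<open>t\<close>. It is evaluated on the underlying probability space because an event about a
  hitting time need not lie in the product sigma-algebra of \<open>path_space\<close>.
\<close>

definition abs_hit_prob ::
    "'a measure \<Rightarrow> (real \<Rightarrow> 'a \<Rightarrow> real) \<Rightarrow> real \<Rightarrow> real \<Rightarrow> real \<Rightarrow> real" where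
  "abs_hit_prob M B a t x =
     measure M {\<omega>\<in>space M. hitting_time a (absorbed_bm B x \<omega>) \<le> ereal t}"

definition leb01 :: "real measure" where
  "leb01 = restrict_space lborel {0<..<1}"

text \<open>
  The law of the position at time \<open>t\<close> determines \<open>p t x\<close> only up to null sets, while the formula
  of the theorem evaluates \<open>p t x\<close> at individual points. The requirement of symmetry in the two
  space variables is what makes these values meaningful for almost every \<open>x\<close>.
\<close>

definition abs_transition_density ::
    "'a measure \<Rightarrow> (real \<Rightarrow> 'a \<Rightarrow> real) \<Rightarrow> (real \<Rightarrow> real \<Rightarrow> real \<Rightarrow> real) \<Rightarrow> bool" where
  "abs_transition_density M B p \<longleftrightarrow>
     (\<forall>t>0. \<forall>x\<in>{0<..<1}.
        (\<forall>y\<in>{0<..<1}. 0 \<le> p t x y \<and> p t x y = p t y x) \<and>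
        p t x \<in> borel_measurable leb01 \<and>
        (\<forall>A\<in>sets leb01. emeasure (abs_law M B x) {w\<in>space (abs_law M B x). w t \<in> A} =
           (\<integral>\<^sup>+y\<in>A. ennreal (p t x y) \<partial>leb01)))"

definition ext_density ::
    "'a measure \<Rightarrow> (real \<Rightarrow> 'a \<Rightarrow> real) \<Rightarrow> (real \<Rightarrow> real \<Rightarrow> real \<Rightarrow> real) \<Rightarrow>
      real \<Rightarrow> real \<Rightarrow> real \<Rightarrow> real" where
  "ext_density M B p t x y = (if y = 0 \<or> y = 1 then abs_hit_prob M B y t x else p t x y)"

text \<open>A finite configuration is a multiset of points; \<open>npoints A \<eta>\<close> is the mass \<open>\<eta>(A)\<close>.\<close>

definition npoints :: "real set \<Rightarrow> real multiset \<Rightarrow> nat" where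
  "npoints A \<eta> = size (filter_mset (\<lambda>x. x \<in> A) \<eta>)"

definition config_space :: "real multiset measure" where
  "config_space = sigma UNIV {{\<eta>. npoints A \<eta> = k} | A k. A \<in> sets borel}"

text \<open>
  \<open>atom \<eta> i\<close>, for \<open>i < size \<eta>\<close>, labels the points of \<open>\<eta>\<close>. Listing them in increasing order is a
  mere choice of labels: everything below is invariant under relabelling.
\<close>

definition atom :: "real multiset \<Rightarrow> nat \<Rightarrow> real" where
  "atom \<eta> i = sorted_list_of_multiset \<eta> ! i"

definition abs_system ::
    "'a measure \<Rightarrow> (real \<Rightarrow> 'a \<Rightarrow> real) \<Rightarrow> nat set \<Rightarrow> (nat \<Rightarrow> real) \<Rightarrow> (nat \<Rightarrow> real \<Rightarrow> real) measure" where
  "abs_system M B I x = PiM I (\<lambda>i. abs_law M B (x i))"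

definition particles :: "nat set \<Rightarrow> real \<Rightarrow> (nat \<Rightarrow> real \<Rightarrow> real) \<Rightarrow> real multiset" where
  "particles I t w = image_mset (\<lambda>i. w i t) (mset_set I)"

definition abs_expectation ::
    "'a measure \<Rightarrow> (real \<Rightarrow> 'a \<Rightarrow> real) \<Rightarrow> nat set \<Rightarrow> (nat \<Rightarrow> real) \<Rightarrow> real \<Rightarrow>
      (real multiset \<Rightarrow> real) \<Rightarrow> real" where
  "abs_expectation M B I x t F = (\<integral>w. F (particles I t w) \<partial>abs_system M B I x)"

text \<open>
  The Poisson probabilities are written out because \<open>poisson_pmf\<close> requires a strictly positive
  rate, whereas \<open>\<mu>\<close> may vanish on a set.
\<close>

definition poisson_point_process :: "'b measure \<Rightarrow> real measure \<Rightarrow> ('b \<Rightarrow> real multiset) \<Rightarrow> bool" where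
  "poisson_point_process N \<mu> \<Theta> \<longleftrightarrow>
     \<Theta> \<in> measurable N config_space \<and>
     (\<forall>\<omega>\<in>space N. set_mset (\<Theta> \<omega>) \<subseteq> space \<mu>) \<and>
     (\<forall>A\<in>sets \<mu>. \<forall>k. measure N {\<omega>\<in>space N. npoints A (\<Theta> \<omega>) = k} =
        exp (- measure \<mu> A) * measure \<mu> A ^ k / fact k) \<and>
     (\<forall>(k::nat) A. A ` {..<k} \<subseteq> sets \<mu> \<and> disjoint_family_on A {..<k} \<longrightarrow>
        prob_space.indep_vars N (\<lambda>_. count_space UNIV) (\<lambda>i \<omega>. npoints (A i) (\<Theta> \<omega>)) {..<k})"

definition gas_intensity ::
    "'a measure \<Rightarrow> (real \<Rightarrow> 'a \<Rightarrow> real) \<Rightarrow> real \<Rightarrow> real \<Rightarrow> real \<Rightarrow> real measure" where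
  "gas_intensity M B lamL lamR t =
     density leb01 (\<lambda>x. ennreal (lamL * abs_hit_prob M B 0 t x + lamR * abs_hit_prob M B 1 t x))"

text \<open>
  The gas \<open>\<eta>\<^sub>t\<close> lives on an arbitrary probability space \<open>N\<close>; the standard Brownian motion \<open>B\<close> on \<open>M\<close>
  only serves to specify the law of absorbed Brownian motion.
\<close>

definition boundary_driven_gas ::
    "'a measure \<Rightarrow> (real \<Rightarrow> 'a \<Rightarrow> real) \<Rightarrow> real \<Rightarrow> real \<Rightarrow> real multiset \<Rightarrow>
      'b measure \<Rightarrow> (real \<Rightarrow> 'b \<Rightarrow> real multiset) \<Rightarrow> bool" where
  "boundary_driven_gas M B lamL lamR \<eta> N \<eta>\<^sub>t \<longleftrightarrow>
     prob_space N \<and>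
     (\<forall>\<omega>\<in>space N. \<eta>\<^sub>t 0 \<omega> = \<eta>) \<and>
     (\<forall>t>0. \<exists>W \<Theta>.
        W \<in> measurable N (PiM {..<size \<eta>} (\<lambda>_. path_space)) \<and>
        distr N (PiM {..<size \<eta>} (\<lambda>_. path_space)) W = abs_system M B {..<size \<eta>} (atom \<eta>) \<and>
        poisson_point_process N (gas_intensity M B lamL lamR t) \<Theta> \<and>
        prob_space.indep_var N
          config_space (\<lambda>\<omega>. particles {..<size \<eta>} t (W \<omega>)) config_space \<Theta> \<and>
        (\<forall>\<omega>\<in>space N. \<eta>\<^sub>t t \<omega> =
           filter_mset (\<lambda>x. x \<in> {0<..<1}) (particles {..<size \<eta>} t (W \<omega>)) + \<Theta> \<omega>))"

text \<open>
  Coordinates of tuples are indexed by a finite set \<open>I\<close> of naturals, so that \<open>z\<^sub>I\<close> is the restriction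
  of \<open>z\<close> to \<open>I\<close> and no relabelling by \<open>{1..card I}\<close> is needed. \<open>factorial_measure \<nu> I \<eta>\<close> is the sum
  of the Dirac masses at the tuples formed from \<open>\<eta>\<close> with pairwise distinct labels; only the
  sigma-algebra of \<open>\<nu>\<close> plays a role.
\<close>

definition factorial_measure :: "real measure \<Rightarrow> nat set \<Rightarrow> real multiset \<Rightarrow> (nat \<Rightarrow> real) measure" where
  "factorial_measure \<nu> I \<eta> =
     distr (count_space {f \<in> I \<rightarrow>\<^sub>E {..<size \<eta>}. inj_on f I}) (PiM I (\<lambda>_. \<nu>))
       (\<lambda>f. \<lambda>i\<in>I. atom \<eta> (f i))"

definition mixed_measure ::
    "real measure \<Rightarrow> nat set \<Rightarrow> nat set \<Rightarrow> real multiset \<Rightarrow> (nat \<Rightarrow> real) measure" where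
  "mixed_measure \<nu> K I \<eta> =
     distr (factorial_measure \<nu> I \<eta> \<Otimes>\<^sub>M PiM (K - I) (\<lambda>_. \<nu>)) (PiM K (\<lambda>_. \<nu>)) (merge I (K - I))"

text \<open>
  The signed measure \<open>\<Sum>\<^sub>I (-\<theta>)^(|K|-|I|) \<eta>\<^bsup>(|I|)\<^esup>(dz\<^sub>I) \<nu>(dz\<^bsub>K-I\<^esub>)\<close>, as a set function and as an
  integral. With \<open>\<nu> = leb01\<close> it is \<open>\<eta>\<^bsup>(n),\<theta>\<^esup>\<close>, with \<open>\<nu> = leb01_ext\<close> it is \<open>\<eta>\<^bsup>[n],\<theta>\<^esup>\<close>.
\<close>

definition signed_factorial ::
    "real measure \<Rightarrow> real \<Rightarrow> nat set \<Rightarrow> real multiset \<Rightarrow> (nat \<Rightarrow> real) set \<Rightarrow> real" where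
  "signed_factorial \<nu> \<theta> K \<eta> A =
     (\<Sum>I\<in>Pow K. (- \<theta>) ^ (card K - card I) * measure (mixed_measure \<nu> K I \<eta>) A)"

definition signed_factorial_integral ::
    "real measure \<Rightarrow> real \<Rightarrow> nat set \<Rightarrow> real multiset \<Rightarrow> ((nat \<Rightarrow> real) \<Rightarrow> real) \<Rightarrow> real" where
  "signed_factorial_integral \<nu> \<theta> K \<eta> F =
     (\<Sum>I\<in>Pow K. (- \<theta>) ^ (card K - card I) * (\<integral>y. F y \<partial>mixed_measure \<nu> K I \<eta>))"

definition leb01_ext :: "real measure" where
  "leb01_ext = measure_of {0..1} (sets (restrict_space borel {0..1}))
     (\<lambda>A. emeasure lborel (A \<inter> {0<..<1}) + indicator A 0 + indicator A 1)"

definition has_signed_density :: "('c set \<Rightarrow> real) \<Rightarrow> 'c measure \<Rightarrow> ('c \<Rightarrow> real) \<Rightarrow> bool" where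
  "has_signed_density \<kappa> \<mu> g \<longleftrightarrow>
     (\<forall>A\<in>null_sets \<mu>. \<kappa> A = 0) \<and>
     integrable \<mu> g \<and>
     (\<forall>A\<in>sets \<mu>. \<kappa> A = (LINT z:A|\<mu>. g z))"

end

theory Submission
  imports Defs "HOL-Combinatorics.Permutations"
begin

text \<open>
  The factorial measure of a sum of configurations splits over the coordinates that come from each
  summand. Hence the expected factorial measure of the gas is a sum over subsets \<open>L\<close> of the
  coordinates, with transition densities in the coordinates in \<open>L\<close> (independence of the particles)
  and the Poisson intensity, say \<open>\<rho>\<close>, in the others (independence of the Poisson process and its
  factorial moments). It suffices to check this on rectangles, and there, cutting the line into the
  cells of a finite partition, on products of falling factorials of independent Poisson counts.
  On the other side, the probability-generating term for \<open>J\<close> is the product of \<open>\<rho>(z\<^sub>j)\<close> over \<open>J\<close>,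
  and the extended transition density has mass one, so that both densities equal the sum over \<open>L\<close> of
  the transition densities on \<open>L\<close> times the product of \<open>\<rho>(z\<^sub>i) - \<theta>\<close> over the other coordinates.
\<close>

section \<open>Sums over injections\<close>

text \<open>The obstacle is measurability. \<open>config_space\<close> knows a configuration only
  through its point counts, whereas the factorial measure is built from the labels of
  \<open>atom\<close>. Factorial sums are therefore shown to be invariant under relabelling, and the
  cell expansion, which serves the Poisson moments, also makes them measurable as functions of
  finitely many counts. For sets other than rectangles neither measurability in \<omega> nor the
  mean of the random measure is known beforehand, so both are carried through one \<pi>-\<lambda>
  induction. The family \<open>p\<close> comes with measurability in its second space variable only,
  while the formula has z in the first. Symmetry moves it, after which just the finitely many
  functions \<open>p t (atom \<eta> k)\<close> are integrated over z. The point masses at 0 and 1 in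
  the extended measure collect the absorbed paths; without them the extended density would not have
  mass one. Each index set is handled with nonnegative integrals, and the signs enter only in a last
  finite sum of integrable terms.\<close>

definition inj_sum :: "('i \<Rightarrow> 'x \<Rightarrow> 'r::comm_semiring_1) \<Rightarrow> 'i set \<Rightarrow> 'x set \<Rightarrow> 'r" where
  "inj_sum b I X = (\<Sum>f\<in>{f \<in> I \<rightarrow>\<^sub>E X. inj_on f I}. \<Prod>i\<in>I. b i (f i))"

lemma inj_sum_empty [simp]: "inj_sum b {} X = 1"
proof -
  have "{f \<in> {} \<rightarrow>\<^sub>E X. inj_on f {}} = {\<lambda>_. undefined}"
    by auto
  then show ?thesis
    by (simp add: inj_sum_def)
qed

lemma inj_sum_cong:
  assumes "\<And>i x. i \<in> I \<Longrightarrow> x \<in> X \<Longrightarrow> b i x = c i x"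
  shows "inj_sum b I X = inj_sum c I X"
  unfolding inj_sum_def using assms by (intro sum.cong prod.cong refl) auto

text \<open>The value \<open>x\<close> taken at the new coordinate is barred from the others, which
  leaves an injection into \<open>X - {x}\<close>; this recursion drives the inductions below. In
  the reindexing the value at \<open>i\<close> is reset to \<open>undefined\<close>, as
  extensionality of the smaller function demands.\<close>

lemma inj_sum_insert:
  assumes "finite I" "i \<notin> I" "finite X"
  shows "inj_sum b (insert i I) X = (\<Sum>x\<in>X. b i x * inj_sum b I (X - {x}))"
proof -
  let ?S = "SIGMA x:X. {f \<in> I \<rightarrow>\<^sub>E (X - {x}). inj_on f I}"
  let ?T = "{f \<in> insert i I \<rightarrow>\<^sub>E X. inj_on f (insert i I)}"
  have fin: "finite {f \<in> I \<rightarrow>\<^sub>E (X - {x}). inj_on f I}" for x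
    using assms finite_PiE[of I "\<lambda>_. X - {x}"] by simp
  have "inj_sum b (insert i I) X = (\<Sum>(x, f)\<in>?S. b i x * (\<Prod>j\<in>I. b j (f j)))"
    unfolding inj_sum_def
  proof (rule sum.reindex_bij_witness[where j = "\<lambda>f. (f i, f(i := undefined))" and i = "\<lambda>(x, f). f(i := x)"])
    fix f assume f: "f \<in> ?T"
    show "(case (f i, f(i := undefined)) of (x, f) \<Rightarrow> f(i := x)) = f"
      by auto
    show "(f i, f(i := undefined)) \<in> ?S"
      using f assms(2) by (auto simp: PiE_iff extensional_def inj_on_def)
    have "(\<Prod>j\<in>I. b j ((f(i := undefined)) j)) = (\<Prod>j\<in>I. b j (f j))"
      using assms(2) by (intro prod.cong) auto
    then show "(case (f i, f(i := undefined)) of (x, f) \<Rightarrow> b i x * (\<Prod>j\<in>I. b j (f j))) =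
        (\<Prod>j\<in>insert i I. b j (f j))"
      using assms by simp
  next
    fix xf assume xf: "xf \<in> ?S"
    obtain x f where [simp]: "xf = (x, f)"
      by (cases xf)
    show "(\<lambda>f. (f i, f(i := undefined))) (case xf of (x, f) \<Rightarrow> f(i := x)) = xf"
      using xf assms(2) by (auto simp: PiE_iff extensional_def)
    have "inj_on (f(i := x)) (insert i I)"
      using xf assms(2) by (auto simp: inj_on_def PiE_iff)
    then show "(case xf of (x, f) \<Rightarrow> f(i := x)) \<in> ?T"
      using xf assms(2) by (auto simp: PiE_iff extensional_def)
  qed
  also have "\<dots> = (\<Sum>x\<in>X. b i x * inj_sum b I (X - {x}))"
    unfolding inj_sum_def sum_distrib_left
    using assms fin by (subst sum.Sigma) auto
  finally show ?thesis .
qed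

lemma sum_Pow_insert:
  assumes "finite I" "i \<notin> I"
  shows "(\<Sum>L\<in>Pow (insert i I). f L) = (\<Sum>L\<in>Pow I. f L) + (\<Sum>L\<in>Pow I. f (insert i L))"
proof -
  have inj: "inj_on (insert i) (Pow I)"
    using assms(2) by (auto simp: inj_on_def)
  have "(\<Sum>L\<in>Pow (insert i I). f L) = (\<Sum>L\<in>Pow I. f L) + (\<Sum>L\<in>insert i ` Pow I. f L)"
    unfolding Pow_insert using assms by (intro sum.union_disjoint) auto
  then show ?thesis
    using inj by (simp add: sum.reindex)
qed

text \<open>\<open>L\<close> collects the coordinates that land in \<open>X\<close>; as
  \<open>X\<close> and \<open>Y\<close> are disjoint, injectivity couples only coordinates landing
  in the same part. The induction splits on whether the new coordinate lands in \<open>X\<close>,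
  and so joins \<open>L\<close>, or in \<open>Y\<close>.\<close>

lemma inj_sum_Un:
  assumes "finite I" "finite X" "finite Y" "X \<inter> Y = {}"
  shows "inj_sum b I (X \<union> Y) = (\<Sum>L\<in>Pow I. inj_sum b L X * inj_sum b (I - L) Y)"
  using assms
proof (induction I arbitrary: X Y rule: finite_induct)
  case (insert i I)
  have IH1: "inj_sum b I (X \<union> Y - {x}) = (\<Sum>L\<in>Pow I. inj_sum b L (X - {x}) * inj_sum b (I - L) Y)"
    if "x \<in> X" for x
  proof -
    have "X \<union> Y - {x} = (X - {x}) \<union> Y"
      using that insert.prems by auto
    then show ?thesis
      using insert.IH[of "X - {x}" Y] insert.prems by auto
  qed
  have IH2: "inj_sum b I (X \<union> Y - {y}) = (\<Sum>L\<in>Pow I. inj_sum b L X * inj_sum b (I - L) (Y - {y}))"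
    if "y \<in> Y" for y
  proof -
    have "X \<union> Y - {y} = X \<union> (Y - {y})"
      using that insert.prems by auto
    then show ?thesis
      using insert.IH[of X "Y - {y}"] insert.prems by auto
  qed
  have "inj_sum b (insert i I) (X \<union> Y) =
      (\<Sum>x\<in>X. b i x * inj_sum b I (X \<union> Y - {x})) + (\<Sum>y\<in>Y. b i y * inj_sum b I (X \<union> Y - {y}))"
    using insert by (simp add: inj_sum_insert sum.union_disjoint)
  also have "(\<Sum>x\<in>X. b i x * inj_sum b I (X \<union> Y - {x})) =
      (\<Sum>L\<in>Pow I. (\<Sum>x\<in>X. b i x * inj_sum b L (X - {x})) * inj_sum b (I - L) Y)"
    by (simp add: IH1 sum_distrib_left sum_distrib_right mult.assoc) (rule sum.swap)
  also have "\<dots> = (\<Sum>L\<in>Pow I. inj_sum b (insert i L) X * inj_sum b (insert i I - insert i L) Y)"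
  proof (rule sum.cong[OF refl])
    fix L assume L: "L \<in> Pow I"
    then have "insert i I - insert i L = I - L" "finite L" "i \<notin> L"
      using insert.hyps by (auto intro: finite_subset)
    then show "(\<Sum>x\<in>X. b i x * inj_sum b L (X - {x})) * inj_sum b (I - L) Y =
        inj_sum b (insert i L) X * inj_sum b (insert i I - insert i L) Y"
      using insert.prems by (simp add: inj_sum_insert)
  qed
  also have "(\<Sum>y\<in>Y. b i y * inj_sum b I (X \<union> Y - {y})) =
      (\<Sum>L\<in>Pow I. inj_sum b L X * (\<Sum>y\<in>Y. b i y * inj_sum b (I - L) (Y - {y})))"
    by (simp add: IH2 sum_distrib_left mult.left_commute) (rule sum.swap)
  also have "\<dots> = (\<Sum>L\<in>Pow I. inj_sum b L X * inj_sum b (insert i I - L) Y)"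
  proof (rule sum.cong[OF refl])
    fix L assume L: "L \<in> Pow I"
    then have "insert i I - L = insert i (I - L)" "finite (I - L)" "i \<notin> I - L"
      using insert.hyps by auto
    then show "inj_sum b L X * (\<Sum>y\<in>Y. b i y * inj_sum b (I - L) (Y - {y})) =
        inj_sum b L X * inj_sum b (insert i I - L) Y"
      using insert.prems by (simp add: inj_sum_insert)
  qed
  finally show ?case
    using insert.hyps by (simp add: sum_Pow_insert add.commute)
qed simp

lemma inj_sum_bij:
  assumes h: "bij_betw h X Y" and eq: "\<And>i x. i \<in> I \<Longrightarrow> x \<in> X \<Longrightarrow> b i x = c i (h x)"
  shows "inj_sum b I X = inj_sum c I Y"
proof -
  let ?k = "the_inv_into X h"
  have k: "bij_betw ?k Y X"
    using h by (rule bij_betw_the_inv_into)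
  have hk: "?k (h x) = x" if "x \<in> X" for x
    using h that by (auto simp: bij_betw_def the_inv_into_f_f)
  have kh: "h (?k y) = y" if "y \<in> Y" for y
    using h that by (auto simp: bij_betw_def f_the_inv_into_f)
  have hX: "h x \<in> Y" if "x \<in> X" for x
    using h that by (auto simp: bij_betw_def)
  have kY: "?k y \<in> X" if "y \<in> Y" for y
    using k that by (auto simp: bij_betw_def)
  have ih: "inj_on h X" "inj_on ?k Y"
    using h k by (auto simp: bij_betw_def)
  show ?thesis
    unfolding inj_sum_def
  proof (rule sum.reindex_bij_witness[where j = "\<lambda>f. \<lambda>i\<in>I. h (f i)" and i = "\<lambda>f. \<lambda>i\<in>I. ?k (f i)"])
    fix f assume f: "f \<in> {f \<in> I \<rightarrow>\<^sub>E X. inj_on f I}"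
    show "(\<lambda>i\<in>I. ?k ((\<lambda>i\<in>I. h (f i)) i)) = f"
      using f hk by (auto simp: PiE_iff extensional_def fun_eq_iff)
    have "inj_on (\<lambda>i. h (f i)) I"
      using f ih(1) by (auto simp: inj_on_def PiE_iff)
    then show "(\<lambda>i\<in>I. h (f i)) \<in> {f \<in> I \<rightarrow>\<^sub>E Y. inj_on f I}"
      using f hX by (auto simp: PiE_iff)
    show "(\<Prod>i\<in>I. c i ((\<lambda>i\<in>I. h (f i)) i)) = (\<Prod>i\<in>I. b i (f i))"
      using f eq by (intro prod.cong) (auto simp: PiE_iff)
  next
    fix f assume f: "f \<in> {f \<in> I \<rightarrow>\<^sub>E Y. inj_on f I}"
    show "(\<lambda>i\<in>I. h ((\<lambda>i\<in>I. ?k (f i)) i)) = f"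
      using f kh by (auto simp: PiE_iff extensional_def fun_eq_iff)
    have "inj_on (\<lambda>i. ?k (f i)) I"
      using f ih(2) by (auto simp: inj_on_def PiE_iff)
    then show "(\<lambda>i\<in>I. ?k (f i)) \<in> {f \<in> I \<rightarrow>\<^sub>E X. inj_on f I}"
      using f kY by (auto simp: PiE_iff)
  qed
qed

lemma inj_sum_mono_neutral:
  assumes "finite I" "finite X" "Y \<subseteq> X" "\<And>i x. i \<in> I \<Longrightarrow> x \<in> X - Y \<Longrightarrow> b i x = 0"
  shows "inj_sum b I Y = inj_sum b I X"
  unfolding inj_sum_def
proof (rule sum.mono_neutral_left)
  show "finite {f \<in> I \<rightarrow>\<^sub>E X. inj_on f I}"
    using assms by (auto intro!: finite_subset[OF _ finite_PiE[of I "\<lambda>_. X"]])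
  show "{f \<in> I \<rightarrow>\<^sub>E Y. inj_on f I} \<subseteq> {f \<in> I \<rightarrow>\<^sub>E X. inj_on f I}"
    using assms(3) by (auto simp: PiE_iff)
  show "\<forall>f\<in>{f \<in> I \<rightarrow>\<^sub>E X. inj_on f I} - {f \<in> I \<rightarrow>\<^sub>E Y. inj_on f I}. (\<Prod>i\<in>I. b i (f i)) = 0"
  proof
    fix f assume f: "f \<in> {f \<in> I \<rightarrow>\<^sub>E X. inj_on f I} - {f \<in> I \<rightarrow>\<^sub>E Y. inj_on f I}"
    then obtain i where i: "i \<in> I" "f i \<notin> Y"
      by (auto simp: PiE_iff)
    then have "b i (f i) = 0"
      using f assms(4)[of i "f i"] by (auto simp: PiE_iff)
    with i show "(\<Prod>i\<in>I. b i (f i)) = 0"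
      using prod_zero[OF assms(1), of "\<lambda>i. b i (f i)"] by blast
  qed
qed

text \<open>With \<open>fact c * (n choose c)\<close> read as the falling factorial (n)_c, this is
  the recursion n (n-1)_c = (n)_(c+1).\<close>

lemma mult_fact_binomial: "n * (fact c * (n - 1 choose c)) = fact (Suc c) * (n choose Suc c)"
  for n c :: nat
proof -
  have "n * (n - 1 choose c) = Suc c * (n choose Suc c)"
    using times_binomial_minus1_eq[of "Suc c" n] by simp
  then show ?thesis
    by (metis fact_Suc mult.assoc mult.commute of_nat_id)
qed

text \<open>Coordinates bound to different sets never compete for the same point, so injectivity
  acts separately on each fibre of \<sigma>. A fibre of c coordinates can be filled from the n
  points in its set in n (n-1) ... (n-c+1) ways, and this falling factorial is
  \<open>fact c * (n choose c)\<close>.\<close>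

lemma inj_sum_disjoint:
  assumes "finite I" "finite T" "\<sigma> ` I \<subseteq> T" "finite X" "disjoint_family_on D T"
  shows "inj_sum (\<lambda>i x. indicator (D (\<sigma> i)) x) I X =
    (\<Prod>S\<in>T. of_nat (fact (card {i \<in> I. \<sigma> i = S}) * (card (X \<inter> D S) choose card {i \<in> I. \<sigma> i = S})))"
  using assms
proof (induction I arbitrary: X rule: finite_induct)
  case empty
  then show ?case by simp
next
  case (insert i I)
  let ?c = "\<lambda>S. card {i \<in> I. \<sigma> i = S}"
  let ?g = "\<lambda>X S. of_nat (fact (?c S) * (card (X \<inter> D S) choose ?c S)) :: 'd"
  let ?s = "\<sigma> i"
  have sT: "?s \<in> T" and IT: "\<sigma> ` I \<subseteq> T"
    using insert.prems by auto
  have c1: "card {k \<in> insert i I. \<sigma> k = ?s} = Suc (?c ?s)"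
  proof -
    have "{k \<in> insert i I. \<sigma> k = ?s} = insert i {k \<in> I. \<sigma> k = ?s}" by auto
    then show ?thesis using insert.hyps by simp
  qed
  have c2: "{k \<in> insert i I. \<sigma> k = S} = {k \<in> I. \<sigma> k = S}" if "S \<noteq> ?s" for S
    using that by auto
  \<comment> \<open>Occupying \<open>x\<close> lowers the count of its own set by one and, by
    disjointness, leaves every other count alone.\<close>
  have step: "inj_sum (\<lambda>i x. indicator (D (\<sigma> i)) x) I (X - {x}) =
      of_nat (fact (?c ?s) * (card (X \<inter> D ?s) - 1 choose ?c ?s)) * (\<Prod>S\<in>T - {?s}. ?g X S)"
    if x: "x \<in> X \<inter> D ?s" for x
  proof -
    have "inj_sum (\<lambda>i x. indicator (D (\<sigma> i)) x) I (X - {x}) = (\<Prod>S\<in>T. ?g (X - {x}) S)"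
      using insert.IH[OF insert.prems(1) IT] insert.prems by simp
    also have "\<dots> = ?g (X - {x}) ?s * (\<Prod>S\<in>T - {?s}. ?g (X - {x}) S)"
      using insert.prems sT by (simp add: prod.remove)
    also have "(\<Prod>S\<in>T - {?s}. ?g (X - {x}) S) = (\<Prod>S\<in>T - {?s}. ?g X S)"
    proof (rule prod.cong[OF refl])
      fix S assume S: "S \<in> T - {?s}"
      then have "D S \<inter> D ?s = {}"
        using insert.prems(4) sT by (auto simp: disjoint_family_on_def)
      then have "(X - {x}) \<inter> D S = X \<inter> D S"
        using x by auto
      then show "?g (X - {x}) S = ?g X S" by simp
    qed
    also have "(X - {x}) \<inter> D ?s = X \<inter> D ?s - {x}"
      by auto
    also have "card (X \<inter> D ?s - {x}) = card (X \<inter> D ?s) - 1"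
      using x insert.prems by simp
    finally show ?thesis .
  qed
  have "inj_sum (\<lambda>i x. indicator (D (\<sigma> i)) x) (insert i I) X =
      (\<Sum>x\<in>X \<inter> D ?s. inj_sum (\<lambda>i x. indicator (D (\<sigma> i)) x) I (X - {x}) :: 'd)"
    using insert by (simp add: inj_sum_insert sum.inter_restrict indicator_def if_distrib cong: if_cong)
  also have "\<dots> = of_nat (card (X \<inter> D ?s)) *
      (of_nat (fact (?c ?s) * (card (X \<inter> D ?s) - 1 choose ?c ?s)) * (\<Prod>S\<in>T - {?s}. ?g X S))"
    by (simp add: step)
  also have "\<dots> = of_nat (card (X \<inter> D ?s) * (fact (?c ?s) * (card (X \<inter> D ?s) - 1 choose ?c ?s))) *
      (\<Prod>S\<in>T - {?s}. ?g X S)"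
    by (simp add: mult.assoc)
  also have "card (X \<inter> D ?s) * (fact (?c ?s) * (card (X \<inter> D ?s) - 1 choose ?c ?s)) =
      fact (Suc (?c ?s)) * (card (X \<inter> D ?s) choose Suc (?c ?s))"
    by (rule mult_fact_binomial)
  also have "(\<Prod>S\<in>T - {?s}. ?g X S) = (\<Prod>S\<in>T - {?s}. of_nat (fact (card {k \<in> insert i I. \<sigma> k = S}) *
      (card (X \<inter> D S) choose card {k \<in> insert i I. \<sigma> k = S})))"
  proof (rule prod.cong[OF refl])
    fix S assume "S \<in> T - {?s}"
    then have "S \<noteq> ?s" by simp
    then show "?g X S = of_nat (fact (card {k \<in> insert i I. \<sigma> k = S}) *
        (card (X \<inter> D S) choose card {k \<in> insert i I. \<sigma> k = S}))"
      by (simp only: c2[OF \<open>S \<noteq> ?s\<close>])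
  qed
  finally show ?case
    by (simp only: prod.remove[OF insert.prems(1) sT] c1)
qed

section \<open>Factorial sums over a configuration: relabelling, restriction, superposition\<close>

definition factorial_sum :: "('i \<Rightarrow> real \<Rightarrow> 'r::comm_semiring_1) \<Rightarrow> 'i set \<Rightarrow> real multiset \<Rightarrow> 'r" where
  "factorial_sum g I \<zeta> = inj_sum (\<lambda>i k. g i (atom \<zeta> k)) I {..<size \<zeta>}"

lemma image_mset_atom: "image_mset (atom \<zeta>) (mset_set {..<size \<zeta>}) = \<zeta>"
proof -
  let ?xs = "sorted_list_of_multiset \<zeta>"
  have l: "length ?xs = size \<zeta>"
    by (metis mset_sorted_list_of_multiset size_mset)
  have "map (atom \<zeta>) [0..<length ?xs] = ?xs"
    by (rule nth_equalityI) (auto simp: atom_def)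
  then have "mset (map (atom \<zeta>) [0..<length ?xs]) = \<zeta>"
    by simp
  then show ?thesis
    by (simp add: l lessThan_atLeast0 del: mset_sorted_list_of_multiset)
qed

lemma atom_in_set: "k < size \<zeta> \<Longrightarrow> atom \<zeta> k \<in> set_mset \<zeta>"
proof -
  assume "k < size \<zeta>"
  then have "atom \<zeta> k \<in> set_mset (image_mset (atom \<zeta>) (mset_set {..<size \<zeta>}))"
    by simp
  then show ?thesis unfolding image_mset_atom .
qed

text \<open>Two finite labellings of the same multiset differ by a permutation of the labels, and
  \<open>inj_sum\<close> does not see such a permutation. The sorted labelling behind
  \<open>atom\<close> can thus be exchanged for any convenient one.\<close>

lemma factorial_sum_image:
  assumes "finite X"
  shows "factorial_sum g I (image_mset l (mset_set X)) = inj_sum (\<lambda>i x. g i (l x)) I X"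
proof -
  let ?\<zeta> = "image_mset l (mset_set X)"
  have "card X = size ?\<zeta>"
    by simp
  moreover obtain h where "bij_betw h {0..<card X} X"
    using ex_bij_betw_nat_finite[OF assms] by auto
  ultimately have h: "bij_betw h {..<size ?\<zeta>} X"
    unfolding lessThan_atLeast0 by simp
  then have hX: "image_mset h (mset_set {..<size ?\<zeta>}) = mset_set X"
    unfolding bij_betw_def by (metis image_mset_mset_set)
  have "image_mset (\<lambda>k. l (h k)) (mset_set {..<size ?\<zeta>}) = ?\<zeta>"
    by (subst hX[symmetric]) (simp add: multiset.map_comp o_def)
  also have "\<dots> = image_mset (atom ?\<zeta>) (mset_set {..<size ?\<zeta>})"
    by (simp only: image_mset_atom)
  finally obtain \<pi> where \<pi>: "\<pi> permutes {..<size ?\<zeta>}"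
      "\<forall>k\<in>{..<size ?\<zeta>}. l (h k) = atom ?\<zeta> (\<pi> k)"
    using image_mset_eq_implies_permutes[OF finite_lessThan] by blast
  have "factorial_sum g I ?\<zeta> = inj_sum (\<lambda>i k. g i (l (h k))) I {..<size ?\<zeta>}"
    unfolding factorial_sum_def using \<pi> permutes_imp_bij by (intro inj_sum_bij[symmetric]) auto
  also have "\<dots> = inj_sum (\<lambda>i x. g i (l x)) I X"
    using h by (intro inj_sum_bij) auto
  finally show ?thesis .
qed

lemma factorial_sum_cong:
  assumes "\<And>i x. i \<in> I \<Longrightarrow> x \<in># \<zeta> \<Longrightarrow> g i x = h i x"
  shows "factorial_sum g I \<zeta> = factorial_sum h I \<zeta>"
  unfolding factorial_sum_def using assms atom_in_set by (intro inj_sum_cong) auto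

text \<open>Absorbed particles sit at the endpoints, outside every set that will be tested; this
  lemma then removes the restriction to the open interval from the gas.\<close>

lemma factorial_sum_filter:
  assumes "finite I" "\<And>i x. i \<in> I \<Longrightarrow> \<not> P x \<Longrightarrow> g i x = 0"
  shows "factorial_sum g I (filter_mset P \<zeta>) = factorial_sum g I \<zeta>"
proof -
  let ?Y = "{k \<in> {..<size \<zeta>}. P (atom \<zeta> k)}"
  have "filter_mset P \<zeta> = filter_mset P (image_mset (atom \<zeta>) (mset_set {..<size \<zeta>}))"
    by (simp only: image_mset_atom)
  also have "\<dots> = image_mset (atom \<zeta>) (mset_set ?Y)"
    by (simp add: filter_mset_image_mset filter_mset_mset_set o_def)
  finally have "factorial_sum g I (filter_mset P \<zeta>) = inj_sum (\<lambda>i k. g i (atom \<zeta> k)) I ?Y"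
    by (simp add: factorial_sum_image)
  also have "\<dots> = factorial_sum g I \<zeta>"
    unfolding factorial_sum_def using assms by (intro inj_sum_mono_neutral) auto
  finally show ?thesis .
qed

text \<open>Sorting \<alpha> + \<beta> interleaves the two lists, so the sum is relabelled by a
  disjoint union of labels, tagged \<open>Inl\<close> and \<open>Inr\<close>. The labels then split
  cleanly even where \<alpha> and \<beta> share points.\<close>

lemma factorial_sum_plus:
  assumes "finite I"
  shows "factorial_sum g I (\<alpha> + \<beta>) = (\<Sum>L\<in>Pow I. factorial_sum g L \<alpha> * factorial_sum g (I - L) \<beta>)"
proof -
  let ?X = "Inl ` {..<size \<alpha>} :: (nat + nat) set" and ?Y = "Inr ` {..<size \<beta>} :: (nat + nat) set"
  let ?l = "case_sum (atom \<alpha>) (atom \<beta>)"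
  have X: "image_mset ?l (mset_set ?X) = \<alpha>"
    by (simp flip: image_mset_mset_set add: multiset.map_comp o_def image_mset_atom)
  have Y: "image_mset ?l (mset_set ?Y) = \<beta>"
    by (simp flip: image_mset_mset_set add: multiset.map_comp o_def image_mset_atom)
  have "image_mset ?l (mset_set (?X \<union> ?Y)) = \<alpha> + \<beta>"
    using X Y by (subst mset_set_Union) auto
  then have "factorial_sum g I (\<alpha> + \<beta>) = inj_sum (\<lambda>i x. g i (?l x)) I (?X \<union> ?Y)"
    by (metis factorial_sum_image finite_UnI finite_imageI finite_lessThan)
  also have "\<dots> = (\<Sum>L\<in>Pow I. inj_sum (\<lambda>i x. g i (?l x)) L ?X * inj_sum (\<lambda>i x. g i (?l x)) (I - L) ?Y)"
    using assms by (intro inj_sum_Un) auto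
  also have "\<dots> = (\<Sum>L\<in>Pow I. factorial_sum g L \<alpha> * factorial_sum g (I - L) \<beta>)"
  proof (rule sum.cong[OF refl])
    fix L
    have "inj_sum (\<lambda>i x. g i (?l x)) L ?X = factorial_sum g L \<alpha>"
      using factorial_sum_image[of ?X g L ?l] unfolding X by simp
    moreover have "inj_sum (\<lambda>i x. g i (?l x)) (I - L) ?Y = factorial_sum g (I - L) \<beta>"
      using factorial_sum_image[of ?Y g "I - L" ?l] unfolding Y by simp
    ultimately show "inj_sum (\<lambda>i x. g i (?l x)) L ?X * inj_sum (\<lambda>i x. g i (?l x)) (I - L) ?Y =
        factorial_sum g L \<alpha> * factorial_sum g (I - L) \<beta>"
      by (simp only:)
  qed
  finally show ?thesis .
qed

section \<open>Cells of a finite family of sets, and factorial sums of indicators\<close>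

definition cell :: "'i set \<Rightarrow> ('i \<Rightarrow> 'x set) \<Rightarrow> 'i set \<Rightarrow> 'x set" where
  "cell I A S = {x. {i \<in> I. x \<in> A i} = S}"

text \<open>Nonemptiness of \<open>S\<close> gives an intersection to subtract from, so no
  complement in the whole line occurs. This matters because the sets \<open>A i\<close> will come
  from the sigma-algebra of \<open>leb01\<close>, whose members lie in the open interval.\<close>

lemma cell_eq: "S \<subseteq> I \<Longrightarrow> S \<noteq> {} \<Longrightarrow> cell I A S = (\<Inter>i\<in>S. A i) - (\<Union>i\<in>I - S. A i)"
  by (auto simp: cell_def)

lemma indicator_eq_sum_cell:
  assumes "finite I" "i \<in> I"
  shows "(indicator (A i) x :: 'r::comm_semiring_1) = (\<Sum>S\<in>{S \<in> Pow I. i \<in> S}. indicator (cell I A S) x)"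
proof -
  have "(\<Sum>S\<in>{S \<in> Pow I. i \<in> S}. indicator (cell I A S) x :: 'r) =
      (\<Sum>S\<in>{S \<in> Pow I. i \<in> S}. if S = {i \<in> I. x \<in> A i} then 1 else 0)"
    by (intro sum.cong) (auto simp: cell_def indicator_def)
  also have "\<dots> = indicator (A i) x"
    using assms by (subst sum.delta) (auto simp: indicator_def)
  finally show ?thesis by simp
qed

text \<open>Each \<open>A i\<close> is the disjoint union of the cells whose index contains
  \<open>i\<close>. Expanding the product of these sums assigns a cell \<open>\<sigma> i\<close> to
  every coordinate, and disjointness of the cells turns each term into falling factorials of counts.
  The index \<open>{}\<close> never occurs, as \<open>i \<in> \<sigma> i\<close>.\<close>

lemma factorial_sum_indicator:
  assumes I: "finite I"
  shows "(factorial_sum (\<lambda>i. indicator (A i)) I \<zeta> :: 'r::comm_semiring_1) =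
    (\<Sum>\<sigma>\<in>PiE I (\<lambda>i. {S \<in> Pow I. i \<in> S}). \<Prod>S\<in>Pow I - {{}}.
      of_nat (fact (card {i \<in> I. \<sigma> i = S}) * (npoints (cell I A S) \<zeta> choose card {i \<in> I. \<sigma> i = S})))"
proof -
  let ?B = "\<lambda>i. {S \<in> Pow I. i \<in> S}"
  let ?D = "\<lambda>S. {k. atom \<zeta> k \<in> cell I A S}"
  have card: "card ({..<size \<zeta>} \<inter> ?D S) = npoints (cell I A S) \<zeta>" for S
  proof -
    have "npoints (cell I A S) \<zeta> =
        npoints (cell I A S) (image_mset (atom \<zeta>) (mset_set {..<size \<zeta>}))"
      by (simp only: image_mset_atom)
    also have "\<dots> = card ({..<size \<zeta>} \<inter> ?D S)"
      by (simp add: npoints_def filter_mset_image_mset filter_mset_mset_set o_def Int_def)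
    finally show ?thesis by simp
  qed
  have "(factorial_sum (\<lambda>i. indicator (A i)) I \<zeta> :: 'r) =
      inj_sum (\<lambda>i k. \<Sum>S\<in>?B i. indicator (?D S) k) I {..<size \<zeta>}"
    unfolding factorial_sum_def
  proof (rule inj_sum_cong)
    fix i k assume "i \<in> I"
    then show "(indicator (A i) (atom \<zeta> k) :: 'r) = (\<Sum>S\<in>?B i. indicator (?D S) k)"
      unfolding indicator_eq_sum_cell[OF I \<open>i \<in> I\<close>] by (simp add: indicator_def)
  qed
  also have "\<dots> = (\<Sum>\<sigma>\<in>PiE I ?B. inj_sum (\<lambda>i k. indicator (?D (\<sigma> i)) k) I {..<size \<zeta>})"
    unfolding inj_sum_def using I by (subst prod_sum_PiE) (auto intro: sum.swap)
  also have "\<dots> = (\<Sum>\<sigma>\<in>PiE I ?B. \<Prod>S\<in>Pow I - {{}}. of_nat (fact (card {i \<in> I. \<sigma> i = S}) *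
      (card ({..<size \<zeta>} \<inter> ?D S) choose card {i \<in> I. \<sigma> i = S})))"
    using I by (intro sum.cong refl inj_sum_disjoint)
      (auto simp: PiE_iff disjoint_family_on_def cell_def)
  finally show ?thesis
    by (simp only: card)
qed

section \<open>Absorbed Brownian motion\<close>

definition exit_time :: "(real \<Rightarrow> real) \<Rightarrow> real \<Rightarrow> real" where
  "exit_time w t = real_of_ereal (min (ereal t) (min (hitting_time 0 w) (hitting_time 1 w)))"

lemma absorbed_path_eq: "absorbed_path w t = w (exit_time w t)"
  by (simp add: absorbed_path_def exit_time_def)

lemma hitting_time_le: "0 \<le> s \<Longrightarrow> w s = a \<Longrightarrow> hitting_time a w \<le> ereal s"
  unfolding hitting_time_def by (rule INF_lower) auto

lemma hitting_time_ge: "(\<And>s. 0 \<le> s \<Longrightarrow> s < r \<Longrightarrow> w s \<noteq> a) \<Longrightarrow> ereal r \<le> hitting_time a w"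
  unfolding hitting_time_def by (rule INF_greatest) (auto simp: not_le[symmetric])

lemma exit_time_no_exit:
  fixes w :: "real \<Rightarrow> real"
  assumes "\<And>s. 0 \<le> s \<Longrightarrow> s < t \<Longrightarrow> w s \<in> {0<..<1}"
  shows "exit_time w t = t"
proof -
  have "ereal t \<le> hitting_time 0 w" "ereal t \<le> hitting_time 1 w"
    using assms by (force intro!: hitting_time_ge)+
  then show ?thesis
    by (simp add: exit_time_def)
qed

lemma exit_time_exit:
  assumes "0 \<le> r" "w r \<in> {0, 1}" "\<And>s. 0 \<le> s \<Longrightarrow> s < r \<Longrightarrow> w s \<in> {0<..<1}" "r \<le> t"
  shows "exit_time w t = r"
proof -
  have "ereal r \<le> hitting_time 0 w" "ereal r \<le> hitting_time 1 w"
    using assms(3) by (force intro!: hitting_time_ge)+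
  moreover have "hitting_time 0 w \<le> ereal r \<or> hitting_time 1 w \<le> ereal r"
    using assms(1,2) hitting_time_le by auto
  ultimately have "min (hitting_time 0 w) (hitting_time 1 w) = ereal r"
    by (auto simp: min_def)
  then show ?thesis
    using assms(4) by (simp add: exit_time_def min_def)
qed

lemma path_stays_inside:
  fixes w :: "real \<Rightarrow> real"
  assumes w: "continuous_on {0..} w" "w 0 \<in> {0<..<1}"
    and no: "\<And>s. 0 \<le> s \<Longrightarrow> s \<le> r \<Longrightarrow> w s \<notin> {0, 1}" and r: "0 \<le> r"
  shows "w r \<in> {0<..<1}"
proof (rule ccontr)
  assume "w r \<notin> {0<..<1}"
  then have "w r \<le> 0 \<or> 1 \<le> w r"
    by (auto simp: not_less)
  then consider "w r \<le> 0" | "1 \<le> w r"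
    by blast
  then show False
  proof cases
    case 1
    then obtain s where "0 \<le> s" "s \<le> r" "w s = 0"
      using IVT2'[of w r 0 0] w r continuous_on_subset[OF w(1), of "{0..r}"] by auto
    then show False using no by auto
  next
    case 2
    then obtain s where "0 \<le> s" "s \<le> r" "w s = 1"
      using IVT'[of w 0 1 r] w r continuous_on_subset[OF w(1), of "{0..r}"] by auto
    then show False using no by auto
  qed
qed

text \<open>The times in [0,t] at which the path is at 0 or 1 form a compact set, so there is a
  first one unless the set is empty. With this dichotomy the later path arguments work with an
  actual exit time instead of an infimum of hitting times.\<close>

lemma exit_cases:
  fixes w :: "real \<Rightarrow> real"
  assumes w: "continuous_on {0..} w" "w 0 \<in> {0<..<1}" and t: "0 \<le> t"
  obtains (inside) "\<And>s. 0 \<le> s \<Longrightarrow> s \<le> t \<Longrightarrow> w s \<in> {0<..<1}"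
  | (exit) r where "0 \<le> r" "r \<le> t" "w r \<in> {0, 1}" "\<And>s. 0 \<le> s \<Longrightarrow> s < r \<Longrightarrow> w s \<in> {0<..<1}"
proof (cases "\<exists>s. 0 \<le> s \<and> s \<le> t \<and> w s \<in> {0, 1}")
  case False
  have "w s \<in> {0<..<1}" if "0 \<le> s" "s \<le> t" for s
    using path_stays_inside[OF w _ that(1)] False that by (metis order_trans)
  then show ?thesis using inside by blast
next
  case True
  let ?H = "{0..t} \<inter> w -` {0, 1}"
  have "closed ?H"
    using continuous_on_subset[OF w(1), of "{0..t}"] by (intro continuous_closed_preimage) auto
  then have "compact ?H"
    using closed_Int_compact[OF _ compact_Icc[of 0 t]] by (metis inf.left_idem inf.commute)
  moreover have "?H \<noteq> {}"
    using True by auto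
  ultimately have "\<exists>r\<in>?H. \<forall>s\<in>?H. r \<le> s"
    by (rule compact_attains_inf)
  then obtain r where r: "r \<in> ?H" "\<And>s. s \<in> ?H \<Longrightarrow> r \<le> s"
    by blast
  have "w s \<in> {0<..<1}" if "0 \<le> s" "s < r" for s
  proof (rule path_stays_inside[OF w _ that(1)])
    fix u assume "0 \<le> u" "u \<le> s"
    then show "w u \<notin> {0, 1}"
      using r(1) r(2)[of u] that by force
  qed
  then show ?thesis
    using r exit[of r] by auto
qed

lemma exit_time_bounds:
  fixes w :: "real \<Rightarrow> real"
  assumes "continuous_on {0..} w" "w 0 \<in> {0<..<1}" "0 \<le> t"
  shows "0 \<le> exit_time w t" "exit_time w t \<le> t"
  using assms by (cases rule: exit_cases; force simp: exit_time_no_exit exit_time_exit)+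

lemma absorbed_path_in_unit:
  fixes w :: "real \<Rightarrow> real"
  assumes "continuous_on {0..} w" "w 0 \<in> {0<..<1}" "0 \<le> t"
  shows "absorbed_path w t \<in> {0..1}"
  using assms
proof (cases rule: exit_cases)
  case inside
  then show ?thesis
    using assms(3) by (force simp: absorbed_path_eq exit_time_no_exit)
next
  case (exit r)
  then have "exit_time w t = r"
    by (intro exit_time_exit) auto
  then show ?thesis
    using exit by (auto simp: absorbed_path_eq)
qed

text \<open>At the exit time itself the path is already on the boundary, hence the closed interval
  of times on the right. The superlevel sets of the exit time become conditions on the path up to
  \<open>s\<close>, which is how its measurability is obtained.\<close>

lemma less_exit_time_iff:
  assumes "continuous_on {0..} w" "w 0 \<in> {0<..<1}" "0 \<le> s" "s < t"
  shows "s < exit_time w t \<longleftrightarrow> (\<forall>u. 0 \<le> u \<and> u \<le> s \<longrightarrow> w u \<in> {0<..<1})"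
proof -
  have "0 \<le> t" using assms by simp
  with assms(1,2) show ?thesis
  proof (cases rule: exit_cases)
    case inside
    then have "exit_time w t = t"
      by (intro exit_time_no_exit) auto
    then show ?thesis
      using assms inside by auto
  next
    case (exit r)
    then have eq: "exit_time w t = r"
      by (intro exit_time_exit) auto
    have "w r \<notin> {0<..<1}"
      using exit(3) by auto
    then show ?thesis
      unfolding eq using exit(1,4) by (metis le_less_trans not_less)
  qed
qed

lemma hitting_time_absorbed_path_iff:
  assumes w: "continuous_on {0..} w" "w 0 \<in> {0<..<1}" and t: "0 \<le> t" and a: "a \<in> {0, 1}"
  shows "hitting_time a (absorbed_path w) \<le> ereal t \<longleftrightarrow> absorbed_path w t = a"
proof
  assume "absorbed_path w t = a"
  then show "hitting_time a (absorbed_path w) \<le> ereal t"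
    using t by (intro hitting_time_le)
next
  assume le: "hitting_time a (absorbed_path w) \<le> ereal t"
  \<comment> \<open>A bound on an infimum yields by itself no visit at or before \<open>t\<close>.
    The slack 1 produces a visiting time \<open>s\<close>, and the path is then shown to have been
    absorbed at \<open>a\<close> by time \<open>t\<close>.\<close>
  have "hitting_time a (absorbed_path w) < ereal (t + 1)"
    using le by (rule le_less_trans) simp
  then obtain s where s: "0 \<le> s" "s < t + 1" "absorbed_path w s = a"
    unfolding hitting_time_def by (auto simp: INF_less_iff)
  from w s(1) show "absorbed_path w t = a"
  proof (cases rule: exit_cases)
    case inside
    then have "absorbed_path w s = w s"
      by (simp add: absorbed_path_eq exit_time_no_exit)
    then show ?thesis
      using inside[of s] s a by auto
  next
    case (exit r)
    have abs: "absorbed_path w u = w r" if "r \<le> u" for u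
      using exit that by (simp add: absorbed_path_eq exit_time_exit)
    then have wr: "w r = a"
      using exit(2) s(3) by simp
    have "ereal r \<le> hitting_time a (absorbed_path w)"
    proof (rule hitting_time_ge)
      fix u assume u: "0 \<le> u" "u < r"
      then have "absorbed_path w u = w u"
        using exit(4) by (simp add: absorbed_path_eq exit_time_no_exit)
      then show "absorbed_path w u \<noteq> a"
        using exit(4)[OF u] a by auto
    qed
    then have "r \<le> t"
      using le by (metis ereal_less_eq(3) order_trans)
    then show ?thesis
      using abs wr by simp
  qed
qed

text \<open>When \<open>w\<close> reaches 0, the lower path has left the open interval. It cannot
  have left through 1 first, since \<open>w\<close> would then be at least 1 although it stays
  inside until it reaches 0. The second claim is the mirror image.\<close>

lemma absorbed_path_mono:
  assumes w: "continuous_on {0..} w" "w 0 \<in> {0<..<1}" and v: "continuous_on {0..} v" "v 0 \<in> {0<..<1}"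
    and le: "\<And>s. 0 \<le> s \<Longrightarrow> v s \<le> w s" and t: "0 \<le> t"
  shows "absorbed_path w t = 0 \<Longrightarrow> absorbed_path v t = 0"
    and "absorbed_path v t = 1 \<Longrightarrow> absorbed_path w t = 1"
proof -
  have ex: "\<exists>r\<ge>0. r \<le> t \<and> x r = a \<and> (\<forall>s. 0 \<le> s \<and> s < r \<longrightarrow> x s \<in> {0<..<1})"
    if x: "continuous_on {0..} x" "x 0 \<in> {0<..<1}" "absorbed_path x t = a" "a \<in> {0, 1}" for x a
    using x(1,2) t
  proof (cases rule: exit_cases)
    case inside
    then have "absorbed_path x t = x t"
      by (simp add: absorbed_path_eq exit_time_no_exit)
    then show ?thesis
      using inside[of t] x t by auto
  next
    case (exit r)
    then have "absorbed_path x t = x r"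
      by (simp add: absorbed_path_eq exit_time_exit)
    then show ?thesis
      using exit x by auto
  qed
  have eq: "absorbed_path x t = x r"
    if "0 \<le> r" "r \<le> t" "x r \<in> {0, 1}" "\<And>s. 0 \<le> s \<Longrightarrow> s < r \<Longrightarrow> x s \<in> {0<..<1}" for x r
    using that by (simp add: absorbed_path_eq exit_time_exit)
  {
    assume "absorbed_path w t = 0"
    then obtain r where r: "0 \<le> r" "r \<le> t" "w r = 0" "\<forall>s. 0 \<le> s \<and> s < r \<longrightarrow> w s \<in> {0<..<1}"
      using ex[OF w] by auto
    from v r(1) show "absorbed_path v t = 0"
    proof (cases rule: exit_cases)
      case inside
      have "v r \<in> {0<..<1}"
        using inside r by simp
      then show ?thesis
        using le[of r] r by auto
    next
      case (exit q)
      have "v q \<noteq> 1"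
      proof
        assume "v q = 1"
        with le[of q] exit r have "w q \<ge> 1" "q \<le> r" by auto
        then show False
          using r exit by (cases "q = r") force+
      qed
      then have "v q = 0"
        using exit by auto
      then show ?thesis
        using eq[of q v] exit r by auto
    qed
  }
  {
    assume "absorbed_path v t = 1"
    then obtain r where r: "0 \<le> r" "r \<le> t" "v r = 1" "\<forall>s. 0 \<le> s \<and> s < r \<longrightarrow> v s \<in> {0<..<1}"
      using ex[OF v] by auto
    from w r(1) show "absorbed_path w t = 1"
    proof (cases rule: exit_cases)
      case inside
      have "w r \<in> {0<..<1}"
        using inside r by simp
      then show ?thesis
        using le[of r] r by auto
    next
      case (exit q)
      have "w q \<noteq> 0"
      proof
        assume "w q = 0"
        with le[of q] exit r have "v q \<le> 0" "q \<le> r" by auto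
        then show False
          using r exit by (cases "q = r") force+
      qed
      then have "w q = 1"
        using exit by auto
      then show ?thesis
        using eq[of q w] exit r by auto
    qed
  }
qed

text \<open>Continuity reduces the condition to countably many times, but open intervals do not
  survive limits: a path inside at all rational times could touch 0 at an irrational one.
  Compactness of [0,s] supplies a uniform margin \<open>1 / real (Suc k)\<close>, and closed
  intervals do survive. The times \<open>min \<bar>of_rat q\<bar> s\<close> are dense in [0,s] and
  never leave it.\<close>

lemma inside_iff_rational:
  fixes w :: "real \<Rightarrow> real"
  assumes w: "continuous_on {0..} w" and s: "0 \<le> s"
  shows "(\<forall>u. 0 \<le> u \<and> u \<le> s \<longrightarrow> w u \<in> {0<..<1}) \<longleftrightarrow>
    (\<exists>k. \<forall>q::rat. w (min \<bar>of_rat q\<bar> s) \<in> {1 / real (Suc k)..1 - 1 / real (Suc k)})"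
    (is "?L \<longleftrightarrow> ?R")
proof
  assume L: ?L
  have c: "continuous_on {0..s} (\<lambda>u. min (w u) (1 - w u))"
    by (intro continuous_intros continuous_on_subset[OF w]) auto
  obtain u where u: "u \<in> {0..s}" "\<And>v. v \<in> {0..s} \<Longrightarrow> min (w u) (1 - w u) \<le> min (w v) (1 - w v)"
    using continuous_attains_inf[OF compact_Icc _ c] s by auto
  have "0 < min (w u) (1 - w u)"
    using L u(1) by auto
  then obtain k where k: "1 / real (Suc k) < min (w u) (1 - w u)"
    using nat_approx_posE by blast
  have "w (min \<bar>of_rat q\<bar> s) \<in> {1 / real (Suc k)..1 - 1 / real (Suc k)}" for q
    using u(2)[of "min \<bar>of_rat q\<bar> s"] k s by auto
  then show ?R by blast
next
  assume ?R
  then obtain k where k: "\<And>q::rat. w (min \<bar>of_rat q\<bar> s) \<in> {1 / real (Suc k)..1 - 1 / real (Suc k)}"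
    by blast
  have c: "continuous_on UNIV (\<lambda>r. w (min \<bar>r\<bar> s))"
    by (rule continuous_on_compose2[OF w]) (use s in \<open>auto intro!: continuous_intros\<close>)
  show ?L
  proof (intro allI impI)
    fix u assume u: "0 \<le> u \<and> u \<le> s"
    have "(\<lambda>r. w (min \<bar>r\<bar> s)) ` closure \<rat> \<subseteq> closure ((\<lambda>r. w (min \<bar>r\<bar> s)) ` \<rat>)"
      using c by (intro image_closure_subset[OF _ closed_closure closure_subset])
        (auto intro: continuous_on_subset)
    also have "\<dots> \<subseteq> {1 / real (Suc k)..1 - 1 / real (Suc k)}"
      using k by (intro closure_minimal) (auto simp: Rats_def)
    finally have "(\<lambda>r. w (min \<bar>r\<bar> s)) u \<in> {1 / real (Suc k)..1 - 1 / real (Suc k)}"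
      unfolding Rats_closure_real by blast
    moreover have "0 < 1 / real (Suc k)"
      by simp
    moreover have "min \<bar>u\<bar> s = u"
      using u by simp
    ultimately have "1 / real (Suc k) \<le> w u" "w u \<le> 1 - 1 / real (Suc k)" "0 < 1 / real (Suc k)"
      by (simp_all only: atLeastAtMost_iff)
    then show "w u \<in> {0<..<1}"
      unfolding greaterThanLessThan_iff by linarith
  qed
qed

section \<open>Measurability of absorbed Brownian motion and of its hitting probabilities\<close>

locale brownian_motion =
  fixes M :: "'a measure" and B :: "real \<Rightarrow> 'a \<Rightarrow> real"
  assumes bm: "standard_brownian_motion M B"
begin

sublocale prob_space M
  using bm by (simp add: standard_brownian_motion_def)

lemma measurable_B [measurable]: "0 \<le> t \<Longrightarrow> B t \<in> borel_measurable M"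
  using bm by (simp add: standard_brownian_motion_def)

lemma path_continuous: "\<omega> \<in> space M \<Longrightarrow> continuous_on {0..} (\<lambda>s. x + B s \<omega>)"
  using bm by (intro continuous_intros) (simp add: standard_brownian_motion_def)

lemma path_start: "\<omega> \<in> space M \<Longrightarrow> x + B 0 \<omega> = x"
  using bm by (simp add: standard_brownian_motion_def)

lemma measurable_exit_time:
  assumes x: "x \<in> {0<..<1}" and t: "0 \<le> t"
  shows "(\<lambda>\<omega>. exit_time (\<lambda>s. x + B s \<omega>) t) \<in> borel_measurable M"
proof (rule borel_measurableI_greater)
  fix s :: real
  have start: "x + B 0 \<omega> \<in> {0<..<1}" if "\<omega> \<in> space M" for \<omega>
    using path_start[OF that, of x] x by simp
  consider "s < 0" | "t \<le> s" | "0 \<le> s" "s < t" by linarith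
  then show "{\<omega> \<in> space M. s < exit_time (\<lambda>s. x + B s \<omega>) t} \<in> sets M"
  proof cases
    case 1
    then have "{\<omega> \<in> space M. s < exit_time (\<lambda>s. x + B s \<omega>) t} = space M"
      using exit_time_bounds(1)[OF path_continuous start t] by force
    then show ?thesis by simp
  next
    case 2
    then have "{\<omega> \<in> space M. s < exit_time (\<lambda>s. x + B s \<omega>) t} = {}"
      using exit_time_bounds(2)[OF path_continuous start t] by force
    then show ?thesis by (metis sets.empty_sets)
  next
    case 3
    have "{\<omega> \<in> space M. s < exit_time (\<lambda>s. x + B s \<omega>) t} =
        {\<omega> \<in> space M. \<exists>k. \<forall>q::rat. x + B (min \<bar>of_rat q\<bar> s) \<omega> \<in> {1 / real (Suc k)..1 - 1 / real (Suc k)}}"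
      using less_exit_time_iff[OF path_continuous start 3] inside_iff_rational[OF path_continuous 3(1)]
      by auto
    also have "\<dots> \<in> sets M"
    proof -
      have [measurable]: "B (min \<bar>of_rat q\<bar> s) \<in> borel_measurable M" for q
        using 3 by (intro measurable_B) auto
      show ?thesis by measurable
    qed
    finally show ?thesis .
  qed
qed

text \<open>The path is evaluated at a random time. Rounding the exit time down to multiples of
  \<open>1 / real (Suc m)\<close> leaves countably many values, at each of which \<open>B\<close> is
  measurable; path continuity then yields the limit.\<close>

lemma measurable_absorbed_bm:
  assumes x: "x \<in> {0<..<1}" and t: "0 \<le> t"
  shows "(\<lambda>\<omega>. absorbed_bm B x \<omega> t) \<in> borel_measurable M"
proof -
  define T where "T \<omega> = exit_time (\<lambda>s. x + B s \<omega>) t" for \<omega>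
  have [measurable]: "T \<in> borel_measurable M"
    unfolding T_def using measurable_exit_time[OF x t] .
  have T0: "0 \<le> T \<omega>" if "\<omega> \<in> space M" for \<omega>
    unfolding T_def using exit_time_bounds(1)[OF path_continuous[OF that] _ t] path_start[OF that, of x] x
    by simp
  define D where "D m \<omega> = real (nat \<lfloor>real (Suc m) * T \<omega>\<rfloor>) / real (Suc m)" for m \<omega>
  have "(\<lambda>\<omega>. x + B (D m \<omega>) \<omega>) \<in> borel_measurable M" for m
    unfolding D_def by (rule measurable_compose_countable[where f = "\<lambda>i \<omega>. x + B (real i / real (Suc m)) \<omega>"]) measurable
  moreover have "(\<lambda>m. x + B (D m \<omega>) \<omega>) \<longlonglongrightarrow> absorbed_bm B x \<omega> t" if \<omega>: "\<omega> \<in> space M" for \<omega>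
  proof -
    have "(\<lambda>m. D m \<omega>) \<longlonglongrightarrow> T \<omega>"
    proof (rule tendsto_sandwich[OF _ _ _ tendsto_const])
      have "(\<lambda>m. T \<omega> - 1 / real (Suc m)) \<longlonglongrightarrow> T \<omega> - 0"
        by (intro tendsto_intros LIMSEQ_Suc lim_1_over_n)
      then show "(\<lambda>m. T \<omega> - 1 / real (Suc m)) \<longlonglongrightarrow> T \<omega>" by simp
      have fl: "real (nat \<lfloor>real (Suc m) * T \<omega>\<rfloor>) = of_int \<lfloor>real (Suc m) * T \<omega>\<rfloor>" for m
        using T0[OF \<omega>] by (simp del: of_nat_Suc)
      show "\<forall>\<^sub>F m in sequentially. T \<omega> - 1 / real (Suc m) \<le> D m \<omega>"
      proof (intro always_eventually allI)
        fix m
        have "real (Suc m) * T \<omega> - 1 \<le> of_int \<lfloor>real (Suc m) * T \<omega>\<rfloor>" by linarith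
        then have "(real (Suc m) * T \<omega> - 1) / real (Suc m) \<le> D m \<omega>"
          unfolding D_def fl by (intro divide_right_mono) auto
        then show "T \<omega> - 1 / real (Suc m) \<le> D m \<omega>"
          by (simp add: diff_divide_distrib del: of_nat_Suc)
      qed
      show "\<forall>\<^sub>F m in sequentially. D m \<omega> \<le> T \<omega>"
      proof (intro always_eventually allI)
        fix m
        have "D m \<omega> \<le> (real (Suc m) * T \<omega>) / real (Suc m)"
          unfolding D_def fl by (intro divide_right_mono) auto
        then show "D m \<omega> \<le> T \<omega>"
          by (simp del: of_nat_Suc)
      qed
    qed
    then have "(\<lambda>m. x + B (D m \<omega>) \<omega>) \<longlonglongrightarrow> x + B (T \<omega>) \<omega>"
      by (rule continuous_on_tendsto_compose[OF path_continuous[OF \<omega>]])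
        (use T0[OF \<omega>] in \<open>auto simp: D_def\<close>)
    then show ?thesis
      by (simp add: absorbed_bm_def absorbed_path_eq T_def)
  qed
  ultimately show ?thesis
    by (rule borel_measurable_LIMSEQ_real[rotated])
qed

lemma absorbed_bm_in_unit:
  "\<omega> \<in> space M \<Longrightarrow> x \<in> {0<..<1} \<Longrightarrow> 0 \<le> t \<Longrightarrow> absorbed_bm B x \<omega> t \<in> {0..1}"
  unfolding absorbed_bm_def using path_continuous path_start[of \<omega> x]
  by (intro absorbed_path_in_unit) auto

text \<open>The absorbed path stays where it was absorbed, so a hitting event becomes an event about
  the position at the single time \<open>t\<close>.\<close>

lemma abs_hit_prob_eq:
  assumes "x \<in> {0<..<1}" "0 \<le> t" "a \<in> {0, 1}"
  shows "abs_hit_prob M B a t x = prob {\<omega> \<in> space M. absorbed_bm B x \<omega> t = a}"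
proof -
  have "hitting_time a (absorbed_bm B x \<omega>) \<le> ereal t \<longleftrightarrow> absorbed_bm B x \<omega> t = a"
    if "\<omega> \<in> space M" for \<omega>
    unfolding absorbed_bm_def using path_continuous[OF that] path_start[OF that, of x] assms
    by (intro hitting_time_absorbed_path_iff) auto
  then show ?thesis
    unfolding abs_hit_prob_def by (intro arg_cong[where f = prob]) auto
qed

lemma abs_hit_prob_bounds: "0 \<le> abs_hit_prob M B a t x" "abs_hit_prob M B a t x \<le> 1"
  by (simp_all add: abs_hit_prob_def)

text \<open>Coupling all starting points by the same noise makes the hitting probabilities monotone in
  the starting point, hence Borel.\<close>

lemma measurable_abs_hit_prob:
  assumes t: "0 \<le> t" and a: "a \<in> {0, 1}"
  shows "abs_hit_prob M B a t \<in> borel_measurable leb01"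
proof -
  have meas: "{\<omega> \<in> space M. absorbed_bm B x \<omega> t = a} \<in> sets M" if "x \<in> {0<..<1}" for x
    using measurable_absorbed_bm[OF that t] by measurable
  have mono: "absorbed_bm B y \<omega> t = 0 \<Longrightarrow> absorbed_bm B x \<omega> t = 0"
      "absorbed_bm B x \<omega> t = 1 \<Longrightarrow> absorbed_bm B y \<omega> t = 1"
    if "\<omega> \<in> space M" "x \<in> {0<..<1}" "y \<in> {0<..<1}" "x \<le> y" for \<omega> x y
    using absorbed_path_mono[OF path_continuous[OF that(1)] _ path_continuous[OF that(1)] _ _ t, of y x]
      path_start[OF that(1), of x] path_start[OF that(1), of y] that
    by (auto simp: absorbed_bm_def)
  have sets: "borel_measurable leb01 = borel_measurable (restrict_space borel {0<..<1::real})"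
    unfolding leb01_def by (intro measurable_cong_sets sets_restrict_space_cong) auto
  show ?thesis
  proof (cases "a = 0")
    case True
    have "mono_on {0<..<1} (\<lambda>x. - abs_hit_prob M B a t x)"
    proof (rule mono_onI)
      fix x y :: real assume xy: "x \<in> {0<..<1}" "y \<in> {0<..<1}" "x \<le> y"
      have "abs_hit_prob M B a t y \<le> abs_hit_prob M B a t x"
        unfolding abs_hit_prob_eq[OF xy(1) t a] abs_hit_prob_eq[OF xy(2) t a]
        using mono(1) xy meas True by (intro finite_measure_mono) auto
      then show "- abs_hit_prob M B a t x \<le> - abs_hit_prob M B a t y" by simp
    qed
    then have "(\<lambda>x. - abs_hit_prob M B a t x) \<in> borel_measurable leb01"
      unfolding sets by (rule borel_measurable_mono_on_fnc)
    then show ?thesis by simp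
  next
    case False
    have "mono_on {0<..<1} (abs_hit_prob M B a t)"
    proof (rule mono_onI)
      fix x y :: real assume xy: "x \<in> {0<..<1}" "y \<in> {0<..<1}" "x \<le> y"
      show "abs_hit_prob M B a t x \<le> abs_hit_prob M B a t y"
        unfolding abs_hit_prob_eq[OF xy(1) t a] abs_hit_prob_eq[OF xy(2) t a]
        using mono(2) xy meas False a by (intro finite_measure_mono) auto
    qed
    then show ?thesis
      unfolding sets by (rule borel_measurable_mono_on_fnc)
  qed
qed

lemma measurable_path:
  assumes "x \<in> {0<..<1}"
  shows "(\<lambda>\<omega>. \<lambda>s\<in>{0..}. absorbed_bm B x \<omega> s) \<in> measurable M path_space"
  unfolding path_space_def using measurable_absorbed_bm[OF assms]
  by (intro measurable_restrict) auto

lemma prob_space_abs_law: "x \<in> {0<..<1} \<Longrightarrow> prob_space (abs_law M B x)"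
  unfolding abs_law_def by (intro prob_space_distr measurable_path)

lemma sets_abs_law [simp, measurable_cong]: "sets (abs_law M B x) = sets path_space"
  by (simp add: abs_law_def)

lemma space_abs_law [simp]: "space (abs_law M B x) = space path_space"
  by (simp add: abs_law_def)

lemma measurable_eval [measurable]: "0 \<le> t \<Longrightarrow> (\<lambda>w. w t) \<in> borel_measurable path_space"
  unfolding path_space_def by (intro measurable_component_singleton) auto

lemma emeasure_abs_law:
  assumes "x \<in> {0<..<1}" "0 \<le> t" "A \<in> sets borel"
  shows "emeasure (abs_law M B x) {w \<in> space path_space. w t \<in> A} =
    emeasure M {\<omega> \<in> space M. absorbed_bm B x \<omega> t \<in> A}"
proof -
  have "{w \<in> space path_space. w t \<in> A} \<in> sets path_space"
    using assms by measurable
  then show ?thesis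
    unfolding abs_law_def using assms measurable_space[OF measurable_path[OF assms(1)]]
    by (subst emeasure_distr[OF measurable_path]) (auto intro!: arg_cong[where f = "emeasure M"])
qed

lemma nn_integral_abs_law:
  assumes "x \<in> {0<..<1}" "0 \<le> t" "f \<in> borel_measurable borel"
  shows "(\<integral>\<^sup>+w. f (w t) \<partial>abs_law M B x) = (\<integral>\<^sup>+\<omega>. f (absorbed_bm B x \<omega> t) \<partial>M)"
  unfolding abs_law_def using assms
  by (subst nn_integral_distr[OF measurable_path]) auto

end

section \<open>Factorial moments of Poisson processes\<close>

text \<open>The terms with k < r vanish. After a shift by \<open>r\<close> the factorials cancel,
  and what remains is exp(-m) m^r times the exponential series at m. The degenerate case m = 0 is
  included, with 0^0 = 1.\<close>

lemma nn_integral_poisson_factorial: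
  assumes N: "prob_space N" and X: "X \<in> measurable N (count_space UNIV)" and m: "0 \<le> m"
    and P: "\<And>k. measure N {\<omega> \<in> space N. X \<omega> = k} = exp (- m) * m ^ k / fact k"
  shows "(\<integral>\<^sup>+\<omega>. of_nat (fact r * (X \<omega> choose r)) \<partial>N) = ennreal (m ^ r)"
proof -
  interpret prob_space N by fact
  let ?S = "\<lambda>k. {\<omega> \<in> space N. X \<omega> = k}"
  let ?g = "\<lambda>k. fact r * (k choose r) :: nat"
  have S [measurable]: "?S k \<in> sets N" for k
    using X by measurable
  have "(\<integral>\<^sup>+\<omega>. of_nat (?g (X \<omega>)) \<partial>N) = (\<integral>\<^sup>+\<omega>. (\<Sum>k. of_nat (?g k) * indicator (?S k) \<omega>) \<partial>N)"
  proof (rule nn_integral_cong)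
    fix \<omega> assume "\<omega> \<in> space N"
    then show "(of_nat (?g (X \<omega>)) :: ennreal) = (\<Sum>k. of_nat (?g k) * indicator (?S k) \<omega>)"
      by (intro suminf_cmult_indicator[symmetric]) (auto simp: disjoint_family_on_def)
  qed
  also have "\<dots> = (\<Sum>k. of_nat (?g k) * emeasure N (?S k))"
    by (simp add: nn_integral_suminf nn_integral_cmult_indicator)
  also have "\<dots> = (\<Sum>k. ennreal (real (?g k) * (exp (- m) * m ^ k / fact k)))"
    using m by (simp only: emeasure_eq_measure P ennreal_of_nat_eq_real_of_nat)
      (simp add: ennreal_mult' del: of_nat_mult times_divide_eq_right)
  also have "\<dots> = ennreal (m ^ r)"
  proof (rule suminf_ennreal_eq)
    show "0 \<le> real (?g k) * (exp (- m) * m ^ k / fact k)" for k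
      using m by simp
    have "(\<lambda>k. real (?g (k + r)) * (exp (- m) * m ^ (k + r) / fact (k + r))) =
        (\<lambda>k. (exp (- m) * m ^ r) * (m ^ k /\<^sub>R fact k))"
      by (simp add: binomial_fact power_add field_simps fun_eq_iff)
    moreover have "\<dots> sums ((exp (- m) * m ^ r) * exp m)"
      by (intro sums_mult exp_converges)
    ultimately have "(\<lambda>k. real (?g (k + r)) * (exp (- m) * m ^ (k + r) / fact (k + r))) sums (m ^ r)"
      by (simp add: exp_minus field_simps)
    then show "(\<lambda>k. real (?g k) * (exp (- m) * m ^ k / fact k)) sums (m ^ r)"
      by (subst (asm) sums_zero_iff_shift) auto
  qed
  finally show ?thesis .
qed

lemma measurable_npoints [measurable]:
  assumes "A \<in> sets borel"
  shows "npoints A \<in> measurable config_space (count_space UNIV)"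
proof (subst measurable_count_space_eq2_countable, intro conjI ballI)
  show "npoints A \<in> space config_space \<rightarrow> UNIV" by simp
  fix k
  have "npoints A -` {k} \<inter> space config_space = {\<eta>. npoints A \<eta> = k}"
    by (auto simp: config_space_def)
  also have "\<dots> \<in> sets config_space"
    using assms unfolding config_space_def by (auto intro!: sigma_sets.Basic)
  finally show "npoints A -` {k} \<inter> space config_space \<in> sets config_space" .
qed

lemma sets_cell:
  assumes "finite I" "\<And>i. i \<in> I \<Longrightarrow> A i \<in> sets M" "S \<in> Pow I - {{}}"
  shows "cell I A S \<in> sets M"
proof -
  have "finite S" using assms finite_subset by auto
  then show ?thesis
    using assms by (subst cell_eq) (auto intro!: sets.Diff sets.finite_INT sets.finite_UN)
qed

text \<open>The sigma-algebra is generated by counts, and \<open>atom\<close> is not a count; the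
  cell expansion expresses the sum through finitely many counts of Borel cells.\<close>

lemma measurable_factorial_sum:
  assumes "finite I" "\<And>i. i \<in> I \<Longrightarrow> A i \<in> sets borel"
  shows "factorial_sum (\<lambda>i. indicator (A i) :: real \<Rightarrow> ennreal) I \<in> borel_measurable config_space"
proof -
  have [measurable]: "npoints (cell I A S) \<in> measurable config_space (count_space UNIV)"
    if "S \<in> Pow I - {{}}" for S
    using that sets_cell[OF assms that] by measurable
  have "(\<lambda>\<zeta>. factorial_sum (\<lambda>i. indicator (A i) :: real \<Rightarrow> ennreal) I \<zeta>) \<in> borel_measurable config_space"
    unfolding factorial_sum_indicator[OF assms(1)]
    by (intro borel_measurable_sum borel_measurable_prod_ennreal) measurable
  then show ?thesis .
qed

text \<open>This undoes the cell expansion at the level of means: each mass is additive over the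
  cells that make up \<open>A i\<close>, and distributing the product over these sums gives the sum
  over all assignments \<sigma>.\<close>

lemma sum_prod_cell:
  assumes "finite I" "\<And>i. i \<in> I \<Longrightarrow> A i \<in> sets \<mu>"
  shows "(\<Sum>\<sigma>\<in>PiE I (\<lambda>i. {S \<in> Pow I. i \<in> S}). \<Prod>i\<in>I. emeasure \<mu> (cell I A (\<sigma> i))) =
    (\<Prod>i\<in>I. emeasure \<mu> (A i))"
proof -
  let ?B = "\<lambda>i. {S \<in> Pow I. i \<in> S}"
  have "emeasure \<mu> (A i) = (\<Sum>S\<in>?B i. emeasure \<mu> (cell I A S))" if i: "i \<in> I" for i
  proof -
    have [measurable]: "cell I A S \<in> sets \<mu>" if "S \<in> ?B i" for S
      using that by (intro sets_cell assms) auto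
    have "emeasure \<mu> (A i) = (\<integral>\<^sup>+x. indicator (A i) x \<partial>\<mu>)"
      using assms i by simp
    also have "\<dots> = (\<integral>\<^sup>+x. (\<Sum>S\<in>?B i. indicator (cell I A S) x) \<partial>\<mu>)"
      by (simp only: indicator_eq_sum_cell[OF assms(1) i, of A])
    also have "\<dots> = (\<Sum>S\<in>?B i. emeasure \<mu> (cell I A S))"
      by (subst nn_integral_sum) auto
    finally show ?thesis .
  qed
  then show ?thesis
    using assms(1) by (simp add: prod_sum_PiE)
qed

lemma nn_integral_factorial_sum_poisson:
  assumes N: "prob_space N" and \<mu>: "finite_measure \<mu>" and sets: "sets \<mu> \<subseteq> sets borel"
    and P: "poisson_point_process N \<mu> \<Theta>"
    and I: "finite I" and A: "\<And>i. i \<in> I \<Longrightarrow> A i \<in> sets \<mu>"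
  shows "(\<integral>\<^sup>+\<omega>. factorial_sum (\<lambda>i. indicator (A i)) I (\<Theta> \<omega>) \<partial>N) = (\<Prod>i\<in>I. emeasure \<mu> (A i))"
proof -
  interpret N: prob_space N by fact
  interpret \<mu>: finite_measure \<mu> by fact
  let ?B = "\<lambda>i. {S \<in> Pow I. i \<in> S}"
  define T where "T = Pow I - {{}}"
  let ?C = "cell I A" and ?c = "\<lambda>\<sigma> S. card {i \<in> I. \<sigma> i = S}"
  let ?F = "\<lambda>\<sigma> S \<omega>. of_nat (fact (?c \<sigma> S) * (npoints (?C S) (\<Theta> \<omega>) choose ?c \<sigma> S)) :: ennreal"
  have \<Theta> [measurable]: "\<Theta> \<in> measurable N config_space"
    and Pk: "\<And>A k. A \<in> sets \<mu> \<Longrightarrow> measure N {\<omega>\<in>space N. npoints A (\<Theta> \<omega>) = k} =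
        exp (- measure \<mu> A) * measure \<mu> A ^ k / fact k"
    and Pi: "\<And>k A. A ` {..<k::nat} \<subseteq> sets \<mu> \<Longrightarrow> disjoint_family_on A {..<k} \<Longrightarrow>
        N.indep_vars (\<lambda>_. count_space UNIV) (\<lambda>i \<omega>. npoints (A i) (\<Theta> \<omega>)) {..<k}"
    using P by (auto simp: poisson_point_process_def)
  have C: "?C S \<in> sets \<mu>" if "S \<in> T" for S
    using sets_cell[OF I A] that by (simp add: T_def)
  have np [measurable]: "(\<lambda>\<omega>. npoints (?C S) (\<Theta> \<omega>)) \<in> measurable N (count_space UNIV)" if "S \<in> T" for S
    using C[OF that] sets by (intro measurable_compose[OF \<Theta>] measurable_npoints) auto
  have "finite T"
    using I by (simp add: T_def)
  \<comment> \<open>Independence of the counts is granted for families indexed by an initial segment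
    of the naturals, so the cells are enumerated by \<open>e\<close>.\<close>
  from ex_bij_betw_nat_finite[OF this] obtain e where "bij_betw e {0..<card T} T"
    by blast
  then have e: "bij_betw e {..<card T} T"
    by (simp only: lessThan_atLeast0)
  have ind: "N.indep_vars (\<lambda>_. count_space UNIV) (\<lambda>j \<omega>. npoints (?C (e j)) (\<Theta> \<omega>)) {..<card T}"
  proof (rule Pi)
    show "(\<lambda>j. ?C (e j)) ` {..<card T} \<subseteq> sets \<mu>"
      using bij_betwE[OF e] C by auto
    show "disjoint_family_on (\<lambda>j. ?C (e j)) {..<card T}"
      unfolding disjoint_family_on_def
    proof (intro ballI impI)
      fix i j assume ij: "i \<in> {..<card T}" "j \<in> {..<card T}" "i \<noteq> j"
      then have "e i \<noteq> e j"
        using bij_betw_imp_inj_on[OF e] by (simp add: inj_on_eq_iff)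
      then show "?C (e i) \<inter> ?C (e j) = {}"
        by (auto simp: cell_def)
    qed
  qed
  have prod: "(\<integral>\<^sup>+\<omega>. (\<Prod>S\<in>T. ?F \<sigma> S \<omega>) \<partial>N) = (\<Prod>i\<in>I. emeasure \<mu> (?C (\<sigma> i)))"
    if \<sigma>: "\<sigma> \<in> PiE I ?B" for \<sigma>
  proof -
    have \<sigma>T: "\<sigma> ` I \<subseteq> T"
      using \<sigma> by (auto simp: PiE_iff T_def)
    have "(\<integral>\<^sup>+\<omega>. (\<Prod>S\<in>T. ?F \<sigma> S \<omega>) \<partial>N) = (\<integral>\<^sup>+\<omega>. (\<Prod>j<card T. ?F \<sigma> (e j) \<omega>) \<partial>N)"
      using prod.reindex_bij_betw[OF e, of "\<lambda>S. ?F \<sigma> S _"] by simp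
    also have "\<dots> = (\<Prod>j<card T. \<integral>\<^sup>+\<omega>. ?F \<sigma> (e j) \<omega> \<partial>N)"
    proof (rule N.indep_vars_nn_integral[OF finite_lessThan])
      show "N.indep_vars (\<lambda>_. borel) (\<lambda>j \<omega>. ?F \<sigma> (e j) \<omega>) {..<card T}"
        by (rule N.indep_vars_compose2[OF ind]) simp
    qed simp
    also have "\<dots> = (\<Prod>S\<in>T. \<integral>\<^sup>+\<omega>. ?F \<sigma> S \<omega> \<partial>N)"
      using prod.reindex_bij_betw[OF e, of "\<lambda>S. \<integral>\<^sup>+\<omega>. ?F \<sigma> S \<omega> \<partial>N"] by simp
    also have "\<dots> = (\<Prod>S\<in>T. emeasure \<mu> (?C S) ^ ?c \<sigma> S)"
    proof (rule prod.cong[OF refl])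
      fix S assume S: "S \<in> T"
      have "(\<integral>\<^sup>+\<omega>. ?F \<sigma> S \<omega> \<partial>N) = ennreal (measure \<mu> (?C S) ^ ?c \<sigma> S)"
        by (rule nn_integral_poisson_factorial[OF N np[OF S] measure_nonneg Pk[OF C[OF S]]])
      then show "(\<integral>\<^sup>+\<omega>. ?F \<sigma> S \<omega> \<partial>N) = emeasure \<mu> (?C S) ^ ?c \<sigma> S"
        by (simp add: \<mu>.emeasure_eq_measure ennreal_power)
    qed
    \<comment> \<open>The exponent is the number of coordinates assigned to \<open>S\<close>, so the
      power spreads over them and the fibres of \<sigma> reassemble the product over
      \<open>I\<close>.\<close>
    also have "\<dots> = (\<Prod>S\<in>T. \<Prod>i\<in>{i \<in> I. \<sigma> i = S}. emeasure \<mu> (?C (\<sigma> i)))"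
      by (intro prod.cong refl) simp
    also have "\<dots> = (\<Prod>i\<in>I. emeasure \<mu> (?C (\<sigma> i)))"
      using I \<sigma>T \<open>finite T\<close> by (intro prod.group) auto
    finally show ?thesis .
  qed
  have "(\<integral>\<^sup>+\<omega>. factorial_sum (\<lambda>i. indicator (A i)) I (\<Theta> \<omega>) \<partial>N) =
      (\<Sum>\<sigma>\<in>PiE I ?B. \<integral>\<^sup>+\<omega>. (\<Prod>S\<in>T. ?F \<sigma> S \<omega>) \<partial>N)"
    unfolding factorial_sum_indicator[OF I] T_def[symmetric]
    by (rule nn_integral_sum) (intro borel_measurable_prod_ennreal, measurable)
  then show ?thesis
    using prod sum_prod_cell[OF I A] by simp
qed

section \<open>Mixed factorial measures\<close>

lemma measurable_atom_tuple:
  assumes "set_mset \<zeta> \<subseteq> space \<nu>"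
  shows "(\<lambda>f. \<lambda>i\<in>I. atom \<zeta> (f i)) \<in>
    measurable (count_space {f \<in> I \<rightarrow>\<^sub>E {..<size \<zeta>}. inj_on f I}) (PiM I (\<lambda>_. \<nu>))"
  using assms atom_in_set by (fastforce simp: space_PiM PiE_iff)

lemma sets_factorial_measure [simp, measurable_cong]:
  "sets (factorial_measure \<nu> I \<zeta>) = sets (PiM I (\<lambda>_. \<nu>))"
  by (simp add: factorial_measure_def)

lemma sets_mixed_measure [simp, measurable_cong]:
  "sets (mixed_measure \<nu> K I \<zeta>) = sets (PiM K (\<lambda>_. \<nu>))"
  by (simp add: mixed_measure_def)

text \<open>By Fubini the coordinates outside \<open>I\<close> integrate separately; on those in
  \<open>I\<close> the factorial measure is a finite sum of point masses, against which a product
  integrates to \<open>factorial_sum\<close>. The lemma serves twice: with indicators over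
  \<open>leb01\<close> for rectangles, and with the extended transition densities over
  \<open>leb01_ext\<close>.\<close>

lemma nn_integral_mixed_measure:
  assumes \<nu>: "sigma_finite_measure \<nu>" and K: "finite K" and I: "I \<subseteq> K"
    and \<zeta>: "set_mset \<zeta> \<subseteq> space \<nu>" and g: "\<And>j. j \<in> K \<Longrightarrow> g j \<in> borel_measurable \<nu>"
  shows "(\<integral>\<^sup>+y. (\<Prod>j\<in>K. g j (y j)) \<partial>mixed_measure \<nu> K I \<zeta>) =
    factorial_sum g I \<zeta> * (\<Prod>j\<in>K - I. \<integral>\<^sup>+y. g j y \<partial>\<nu>)"
proof -
  interpret P: product_sigma_finite "\<lambda>_. \<nu>"
    using \<nu> by (simp add: product_sigma_finite_def)
  interpret R: sigma_finite_measure "PiM (K - I) (\<lambda>_. \<nu>)"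
    using K by (intro P.sigma_finite) auto
  let ?F = "factorial_measure \<nu> I \<zeta>" and ?R = "PiM (K - I) (\<lambda>_. \<nu>)"
  have "finite I"
    using I K by (rule finite_subset)
  then have fin: "finite {f \<in> I \<rightarrow>\<^sub>E {..<size \<zeta>}. inj_on f I}"
    using finite_PiE[of I "\<lambda>_. {..<size \<zeta>}"] by simp
  have gm [measurable]: "(\<lambda>y. g j (y j)) \<in> borel_measurable (PiM J (\<lambda>_. \<nu>))" if "j \<in> J" "j \<in> K" for j J
    using g[OF that(2)] by (rule measurable_compose[OF measurable_component_singleton[OF that(1)]])
  have m: "merge I (K - I) \<in> measurable (?F \<Otimes>\<^sub>M ?R) (PiM K (\<lambda>_. \<nu>))"
  proof -
    have "merge I (K - I) \<in> measurable (PiM I (\<lambda>_. \<nu>) \<Otimes>\<^sub>M ?R) (PiM (I \<union> (K - I)) (\<lambda>_. \<nu>))"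
      by (rule measurable_merge)
    moreover have "I \<union> (K - I) = K"
      using I by auto
    moreover have "measurable (?F \<Otimes>\<^sub>M ?R) (PiM K (\<lambda>_. \<nu>)) = measurable (PiM I (\<lambda>_. \<nu>) \<Otimes>\<^sub>M ?R) (PiM K (\<lambda>_. \<nu>))"
      by (intro measurable_cong_sets sets_pair_measure_cong) auto
    ultimately show ?thesis by simp
  qed
  have prodK: "(\<lambda>y. \<Prod>j\<in>K. g j (y j)) \<in> borel_measurable (PiM K (\<lambda>_. \<nu>))"
    by (intro borel_measurable_prod_ennreal gm) auto
  have prodI: "(\<lambda>y. \<Prod>j\<in>I. g j (y j)) \<in> borel_measurable (PiM I (\<lambda>_. \<nu>))"
    using I by (intro borel_measurable_prod_ennreal gm) auto
  have prodR: "(\<lambda>y. \<Prod>j\<in>K - I. g j (y j)) \<in> borel_measurable ?R"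
    by (intro borel_measurable_prod_ennreal gm) auto
  have split: "(\<Prod>j\<in>K. g j (merge I (K - I) (x, y) j)) = (\<Prod>j\<in>I. g j (x j)) * (\<Prod>j\<in>K - I. g j (y j))" for x y
    unfolding prod.subset_diff[OF I K] by (simp add: mult.commute merge_def)
  have "(\<integral>\<^sup>+y. (\<Prod>j\<in>K. g j (y j)) \<partial>mixed_measure \<nu> K I \<zeta>) =
      (\<integral>\<^sup>+xy. (\<Prod>j\<in>K. g j (merge I (K - I) xy j)) \<partial>(?F \<Otimes>\<^sub>M ?R))"
    unfolding mixed_measure_def using prodK m by (simp add: nn_integral_distr)
  also have "\<dots> = (\<integral>\<^sup>+x. \<integral>\<^sup>+y. (\<Prod>j\<in>K. g j (merge I (K - I) (x, y) j)) \<partial>?R \<partial>?F)"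
    by (rule R.nn_integral_fst[symmetric]) (rule measurable_compose[OF m prodK])
  also have "\<dots> = (\<integral>\<^sup>+x. (\<Prod>j\<in>I. g j (x j)) * (\<integral>\<^sup>+y. (\<Prod>j\<in>K - I. g j (y j)) \<partial>?R) \<partial>?F)"
    unfolding split using prodR by (simp add: nn_integral_cmult)
  also have "\<dots> = (\<integral>\<^sup>+x. (\<Prod>j\<in>I. g j (x j)) \<partial>?F) * (\<integral>\<^sup>+y. (\<Prod>j\<in>K - I. g j (y j)) \<partial>?R)"
    using prodI by (intro nn_integral_multc) simp
  also have "(\<integral>\<^sup>+y. (\<Prod>j\<in>K - I. g j (y j)) \<partial>?R) = (\<Prod>j\<in>K - I. \<integral>\<^sup>+y. g j y \<partial>\<nu>)"
    using K g by (intro P.product_nn_integral_prod) auto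
  also have "(\<integral>\<^sup>+x. (\<Prod>j\<in>I. g j (x j)) \<partial>?F) = factorial_sum g I \<zeta>"
    unfolding factorial_measure_def factorial_sum_def inj_sum_def
    using prodI fin by (simp add: nn_integral_distr[OF measurable_atom_tuple[OF \<zeta>]] nn_integral_count_space_finite)
  finally show ?thesis .
qed

lemma emeasure_mixed_measure_PiE:
  assumes \<nu>: "sigma_finite_measure \<nu>" and K: "finite K" and I: "I \<subseteq> K"
    and \<zeta>: "set_mset \<zeta> \<subseteq> space \<nu>" and A: "\<And>j. j \<in> K \<Longrightarrow> A j \<in> sets \<nu>"
  shows "emeasure (mixed_measure \<nu> K I \<zeta>) (PiE K A) =
    factorial_sum (\<lambda>i. indicator (A i)) I \<zeta> * (\<Prod>j\<in>K - I. emeasure \<nu> (A j))"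
proof -
  have "emeasure (mixed_measure \<nu> K I \<zeta>) (PiE K A) = (\<integral>\<^sup>+y. indicator (PiE K A) y \<partial>mixed_measure \<nu> K I \<zeta>)"
    using A K by (intro nn_integral_indicator[symmetric]) (auto intro: sets_PiM_I_finite)
  also have "\<dots> = (\<integral>\<^sup>+y. (\<Prod>j\<in>K. indicator (A j) (y j)) \<partial>mixed_measure \<nu> K I \<zeta>)"
  proof (rule nn_integral_cong)
    fix y assume "y \<in> space (mixed_measure \<nu> K I \<zeta>)"
    then have "y \<in> extensional K"
      using sets_eq_imp_space_eq[OF sets_mixed_measure] by (auto simp: space_PiM PiE_iff)
    then show "(indicator (PiE K A) y :: ennreal) = (\<Prod>j\<in>K. indicator (A j) (y j))"
      using K by (auto simp: indicator_def PiE_iff prod_zero_iff split: if_splits)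
  qed
  also have "\<dots> = factorial_sum (\<lambda>i. indicator (A i)) I \<zeta> * (\<Prod>j\<in>K - I. emeasure \<nu> (A j))"
    using A by (subst nn_integral_mixed_measure[OF \<nu> K I \<zeta>]) auto
  finally show ?thesis .
qed

section \<open>The reference measures on the open and on the closed unit interval, and expected
  random measures\<close>

lemma sets_leb01_ext [simp, measurable_cong]: "sets leb01_ext = sets (restrict_space borel {0..1})"
proof -
  have "sigma_sets {0..1} (sets (restrict_space borel {0..1::real})) = sets (restrict_space borel {0..1})"
    using sets.sigma_sets_eq[of "restrict_space borel {0..1::real}"] by (simp add: space_restrict_space)
  moreover have "sets (restrict_space borel {0..1::real}) \<subseteq> Pow {0..1}"
    by (auto simp: sets_restrict_space)
  ultimately show ?thesis
    unfolding leb01_ext_def by (simp add: sets_measure_of)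
qed

lemma space_leb01_ext [simp]: "space leb01_ext = {0..1}"
  using sets_eq_imp_space_eq[OF sets_leb01_ext] by (simp add: space_restrict_space)

lemma space_leb01 [simp]: "space leb01 = {0<..<1}"
  by (simp add: leb01_def space_restrict_space)

lemma sets_leb01_iff: "A \<in> sets leb01 \<longleftrightarrow> A \<subseteq> {0<..<1} \<and> A \<in> sets borel"
  by (simp add: leb01_def sets_restrict_space_iff conj_commute)

lemma prob_space_leb01: "prob_space leb01"
proof
  show "emeasure leb01 (space leb01) = 1"
    by (simp add: leb01_def emeasure_restrict_space space_restrict_space)
qed

text \<open>\<open>measure_of\<close> yields the prescribed values only once these are known to be
  countably additive. Lebesgue measure and the two point masses are each additive along a disjoint
  sequence.\<close>

lemma emeasure_leb01_ext:
  assumes "A \<in> sets leb01_ext"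
  shows "emeasure leb01_ext A = emeasure lborel (A \<inter> {0<..<1}) + indicator A 0 + indicator A 1"
proof (rule emeasure_measure_of[OF leb01_ext_def])
  show "sets (restrict_space borel {0..1::real}) \<subseteq> Pow {0..1}"
    by (auto simp: sets_restrict_space)
  show "A \<in> sets leb01_ext" by fact
  show "positive (sets leb01_ext) (\<lambda>A. emeasure lborel (A \<inter> {0<..<1}) + indicator A 0 + indicator A 1)"
    by (simp add: positive_def)
  show "countably_additive (sets leb01_ext) (\<lambda>A. emeasure lborel (A \<inter> {0<..<1}) + indicator A 0 + indicator A 1)"
  proof (rule countably_additiveI)
    fix F :: "nat \<Rightarrow> real set"
    assume F: "range F \<subseteq> sets leb01_ext" "disjoint_family F"
    have "(\<lambda>i. F i \<inter> {0<..<1}) ` UNIV \<subseteq> sets lborel"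
      using F(1) by (auto simp: sets_restrict_space)
    moreover have "disjoint_family (\<lambda>i. F i \<inter> {0<..<1})"
      using F(2) by (auto simp: disjoint_family_on_def)
    ultimately have "(\<Sum>i. emeasure lborel (F i \<inter> {0<..<1})) = emeasure lborel (\<Union> (range F) \<inter> {0<..<1})"
      by (subst suminf_emeasure) auto
    then show "(\<Sum>i. emeasure lborel (F i \<inter> {0<..<1}) + indicator (F i) 0 + indicator (F i) 1) =
        emeasure lborel (\<Union> (range F) \<inter> {0<..<1}) + indicator (\<Union> (range F)) 0 + indicator (\<Union> (range F)) 1"
      using F(2) by (simp add: suminf_indicator flip: suminf_add)
  qed
qed

lemma finite_measure_leb01_ext: "finite_measure leb01_ext"
proof
  have "space leb01_ext \<in> sets leb01_ext" by (rule sets.top)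
  then show "emeasure leb01_ext (space leb01_ext) \<noteq> \<infinity>"
    by (subst emeasure_leb01_ext) (auto simp: Int_absorb1 greaterThanLessThan_subseteq_atLeastAtMost_iff)
qed

lemma nn_integral_leb01_ext:
  assumes f [measurable]: "f \<in> borel_measurable leb01_ext"
  shows "(\<integral>\<^sup>+y. f y \<partial>leb01_ext) = (\<integral>\<^sup>+y. f y \<partial>leb01) + f 0 + f 1"
proof -
  have pt: "{0} \<in> sets leb01_ext" "{1} \<in> sets leb01_ext" and op: "{0<..<1} \<in> sets leb01_ext"
    by (auto simp: sets_restrict_space_iff)
  note [measurable] = pt op
  have "restrict_space leb01_ext {0<..<1} = leb01"
  proof (rule measure_eqI)
    show s: "sets (restrict_space leb01_ext {0<..<1}) = sets leb01"
      by (auto simp: set_eq_iff sets_restrict_space_iff sets_leb01_iff op)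
    fix A assume "A \<in> sets (restrict_space leb01_ext {0<..<1})"
    then have A: "A \<subseteq> {0<..<1}" "A \<in> sets borel"
      unfolding s sets_leb01_iff by auto
    then have "A \<in> sets leb01_ext"
      by (auto simp: sets_restrict_space_iff)
    then show "emeasure (restrict_space leb01_ext {0<..<1}) A = emeasure leb01 A"
      using A op sets.Int_space_eq2[OF op]
      by (subst emeasure_restrict_space)
        (auto simp: emeasure_restrict_space emeasure_leb01_ext leb01_def Int_absorb2 indicator_def)
  qed
  then have "(\<integral>\<^sup>+y. f y * indicator {0<..<1} y \<partial>leb01_ext) = (\<integral>\<^sup>+y. f y \<partial>leb01)"
    using nn_integral_restrict_space[of "{0<..<1}" leb01_ext f] sets.Int_space_eq2[OF op] op by simp
  moreover have "(\<integral>\<^sup>+y. f y * indicator {0} y \<partial>leb01_ext) = f 0"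
    using pt by (simp add: nn_integral_indicator_singleton emeasure_leb01_ext)
  moreover have "(\<integral>\<^sup>+y. f y * indicator {1} y \<partial>leb01_ext) = f 1"
    using pt by (simp add: nn_integral_indicator_singleton emeasure_leb01_ext)
  moreover have "(\<integral>\<^sup>+y. f y \<partial>leb01_ext) =
      (\<integral>\<^sup>+y. f y * indicator {0<..<1} y + f y * indicator {0} y + f y * indicator {1} y \<partial>leb01_ext)"
    by (intro nn_integral_cong) (auto simp: indicator_def)
  ultimately show ?thesis
    by (simp add: nn_integral_add)
qed

text \<open>The \<open>\<pi>\<close>-\<open>\<lambda>\<close> argument for a random measure \<open>\<kappa>\<close>: measurability of its values and their
  expectations are settled together on a generator.\<close>

lemma expected_measure_eqI:
  assumes G: "Int_stable G" "G \<subseteq> Pow \<Omega>" "\<Omega> \<in> G"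
    and \<nu>: "sets \<nu> = sigma_sets \<Omega> G" "finite_measure \<nu>"
    and \<kappa>: "\<And>\<omega>. \<omega> \<in> space N \<Longrightarrow> sets (\<kappa> \<omega>) = sets \<nu>"
      "\<And>\<omega>. \<omega> \<in> space N \<Longrightarrow> finite_measure (\<kappa> \<omega>)"
    and gen: "\<And>A. A \<in> G \<Longrightarrow> (\<lambda>\<omega>. emeasure (\<kappa> \<omega>) A) \<in> borel_measurable N"
      "\<And>A. A \<in> G \<Longrightarrow> (\<integral>\<^sup>+\<omega>. emeasure (\<kappa> \<omega>) A \<partial>N) = emeasure \<nu> A"
    and A: "A \<in> sets \<nu>"
  shows "(\<lambda>\<omega>. emeasure (\<kappa> \<omega>) A) \<in> borel_measurable N \<and> (\<integral>\<^sup>+\<omega>. emeasure (\<kappa> \<omega>) A \<partial>N) = emeasure \<nu> A"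
proof -
  interpret \<nu>: finite_measure \<nu> by fact
  have sp\<nu>: "space \<nu> = \<Omega>"
    using sets_eq_imp_space_eq[of \<nu> "sigma \<Omega> G"] \<nu>(1) G(2) by (simp add: space_measure_of)
  have sp\<kappa>: "space (\<kappa> \<omega>) = \<Omega>" if "\<omega> \<in> space N" for \<omega>
    using sets_eq_imp_space_eq[OF \<kappa>(1)[OF that]] sp\<nu> by simp
  have "A \<in> sigma_sets \<Omega> G"
    using A \<nu>(1) by simp
  with G(1,2) show ?thesis
  proof (induction rule: sigma_sets_induct_disjoint)
    case (basic A)
    then show ?case using gen by simp
  next
    case empty
    then show ?case by simp
  next
    case (compl A)
    have A: "A \<in> sets \<nu>"
      using compl \<nu>(1) by simp
    have eq: "emeasure (\<kappa> \<omega>) (\<Omega> - A) = emeasure (\<kappa> \<omega>) \<Omega> - emeasure (\<kappa> \<omega>) A" if "\<omega> \<in> space N" for \<omega>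
      using emeasure_compl[of A "\<kappa> \<omega>"] A \<kappa>(1)[OF that] sp\<kappa>[OF that]
        finite_measure.emeasure_finite[OF \<kappa>(2)[OF that], of A] by simp
    have "(\<lambda>\<omega>. emeasure (\<kappa> \<omega>) \<Omega> - emeasure (\<kappa> \<omega>) A) \<in> borel_measurable N"
      using compl gen(1)[OF G(3)] by (intro borel_measurable_minus_ennreal) auto
    then have m: "(\<lambda>\<omega>. emeasure (\<kappa> \<omega>) (\<Omega> - A)) \<in> borel_measurable N"
      using eq by (subst measurable_cong) auto
    have "(\<integral>\<^sup>+\<omega>. emeasure (\<kappa> \<omega>) (\<Omega> - A) \<partial>N) = (\<integral>\<^sup>+\<omega>. emeasure (\<kappa> \<omega>) \<Omega> - emeasure (\<kappa> \<omega>) A \<partial>N)"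
      using eq by (intro nn_integral_cong) auto
    \<comment> \<open>Splitting the integral of a difference requires the subtracted integral to be
      finite; by induction it is \<open>emeasure \<nu> A\<close>. That \<Omega> belongs to
      \<open>G\<close> provides the measurability and the mean of the total mass.\<close>
    also have "\<dots> = (\<integral>\<^sup>+\<omega>. emeasure (\<kappa> \<omega>) \<Omega> \<partial>N) - (\<integral>\<^sup>+\<omega>. emeasure (\<kappa> \<omega>) A \<partial>N)"
    proof (rule nn_integral_diff)
      show "AE \<omega> in N. emeasure (\<kappa> \<omega>) A \<le> emeasure (\<kappa> \<omega>) \<Omega>"
        using sp\<kappa> by (intro AE_I2) (metis emeasure_space)
    qed (use compl gen(1)[OF G(3)] in auto)
    also have "\<dots> = emeasure \<nu> \<Omega> - emeasure \<nu> A"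
      using compl gen(2)[OF G(3)] by simp
    also have "\<dots> = emeasure \<nu> (\<Omega> - A)"
      using emeasure_compl[of A \<nu>] A sp\<nu> by simp
    finally show ?case using m by simp
  next
    case (union F)
    have F: "range F \<subseteq> sets \<nu>"
      using union \<nu>(1) by auto
    have eq: "emeasure (\<kappa> \<omega>) (\<Union> (range F)) = (\<Sum>i. emeasure (\<kappa> \<omega>) (F i))" if "\<omega> \<in> space N" for \<omega>
      using F \<kappa>(1)[OF that] union by (intro suminf_emeasure[symmetric]) auto
    have "(\<lambda>\<omega>. \<Sum>i. emeasure (\<kappa> \<omega>) (F i)) \<in> borel_measurable N"
      using union by (intro borel_measurable_suminf_order) auto
    then have m: "(\<lambda>\<omega>. emeasure (\<kappa> \<omega>) (\<Union> (range F))) \<in> borel_measurable N"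
      using eq by (subst measurable_cong) auto
    have "(\<integral>\<^sup>+\<omega>. emeasure (\<kappa> \<omega>) (\<Union> (range F)) \<partial>N) = (\<integral>\<^sup>+\<omega>. (\<Sum>i. emeasure (\<kappa> \<omega>) (F i)) \<partial>N)"
      using eq by (intro nn_integral_cong) auto
    also have "\<dots> = (\<Sum>i. \<integral>\<^sup>+\<omega>. emeasure (\<kappa> \<omega>) (F i) \<partial>N)"
      using union by (intro nn_integral_suminf) auto
    also have "\<dots> = emeasure \<nu> (\<Union> (range F))"
      using union F by (simp add: suminf_emeasure)
    finally show ?case using m by simp
  qed
qed

section \<open>The boundary driven gas\<close>

text \<open>A product over coordinates becomes a product over all particles, with factor 1 at the
  particles that no coordinate uses. The product law of the particle system applies to the latter
  form.\<close>

lemma prod_inj_on_extend: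
  assumes "finite X" "inj_on f L" "f ` L \<subseteq> X"
  shows "(\<Prod>i\<in>L. h i (f i)) = (\<Prod>j\<in>X. if j \<in> f ` L then h (the_inv_into L f j) j else (1 :: 'r::comm_monoid_mult))"
proof -
  have "(\<Prod>j\<in>X. if j \<in> f ` L then h (the_inv_into L f j) j else 1) = (\<Prod>j\<in>f ` L. h (the_inv_into L f j) j)"
    using assms by (simp add: prod.inter_restrict[symmetric] Int_absorb1)
  also have "\<dots> = (\<Prod>i\<in>L. h i (f i))"
    using assms(2) by (simp add: prod.reindex the_inv_into_f_f)
  finally show ?thesis by simp
qed

text \<open>In the application \<open>L\<close> holds the coordinates filled by initial particles,
  \<open>I - L\<close> those filled by injected points, and \<open>K - I\<close> those carrying the
  reference measure.\<close>

lemma prod_split3: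
  assumes "finite K" "L \<subseteq> I" "I \<subseteq> K"
  shows "(\<Prod>i\<in>K. if i \<in> L then a i else if i \<in> I then b i else c i) =
    (\<Prod>i\<in>L. a i) * (\<Prod>i\<in>I - L. b i) * (\<Prod>i\<in>K - I. (c i :: 'r::comm_monoid_mult))"
proof -
  let ?h = "\<lambda>i. if i \<in> L then a i else if i \<in> I then b i else c i"
  have fin: "finite I"
    using assms finite_subset by auto
  have "(\<Prod>i\<in>K. ?h i) = (\<Prod>i\<in>K - I. ?h i) * ((\<Prod>i\<in>I - L. ?h i) * (\<Prod>i\<in>L. ?h i))"
    by (simp only: prod.subset_diff[OF assms(3,1), of ?h] prod.subset_diff[OF assms(2) fin, of ?h])
  also have "(\<Prod>i\<in>K - I. ?h i) = (\<Prod>i\<in>K - I. c i)"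
    using assms by (intro prod.cong) auto
  also have "(\<Prod>i\<in>I - L. ?h i) = (\<Prod>i\<in>I - L. b i)"
    by (intro prod.cong) auto
  also have "(\<Prod>i\<in>L. ?h i) = (\<Prod>i\<in>L. a i)"
    by (intro prod.cong) auto
  finally show ?thesis
    by (simp add: ac_simps)
qed

lemma ennreal_inj_sum:
  assumes "\<And>i x. i \<in> I \<Longrightarrow> x \<in> X \<Longrightarrow> 0 \<le> b i x"
  shows "inj_sum (\<lambda>i x. ennreal (b i x)) I X = ennreal (inj_sum b I X)"
    and "0 \<le> inj_sum b I X"
proof -
  have nonneg: "0 \<le> b i (f i)" if "f \<in> {f \<in> I \<rightarrow>\<^sub>E X. inj_on f I}" "i \<in> I" for f i
    using that assms by (auto simp: PiE_iff)
  then have prod: "0 \<le> (\<Prod>i\<in>I. b i (f i))" if "f \<in> {f \<in> I \<rightarrow>\<^sub>E X. inj_on f I}" for f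
    using that by (intro prod_nonneg) auto
  then show "0 \<le> inj_sum b I X"
    unfolding inj_sum_def by (rule sum_nonneg)
  have "inj_sum (\<lambda>i x. ennreal (b i x)) I X =
      (\<Sum>f\<in>{f \<in> I \<rightarrow>\<^sub>E X. inj_on f I}. ennreal (\<Prod>i\<in>I. b i (f i)))"
    unfolding inj_sum_def using nonneg by (intro sum.cong prod_ennreal refl)
  also have "\<dots> = ennreal (inj_sum b I X)"
    unfolding inj_sum_def using prod by (rule sum_ennreal)
  finally show "inj_sum (\<lambda>i x. ennreal (b i x)) I X = ennreal (inj_sum b I X)" .
qed

lemma (in prob_space) indep_var_nn_integral:
  assumes "indep_var borel X borel (Y :: 'a \<Rightarrow> ennreal)"
  shows "(\<integral>\<^sup>+\<omega>. X \<omega> * Y \<omega> \<partial>M) = (\<integral>\<^sup>+\<omega>. X \<omega> \<partial>M) * (\<integral>\<^sup>+\<omega>. Y \<omega> \<partial>M)"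
proof -
  have "indep_vars (\<lambda>_. borel) (case_bool X Y) UNIV"
    using assms unfolding indep_var_def
    by (rule indep_vars_cong[THEN iffD1, rotated -1]) (auto split: bool.split)
  then have "(\<integral>\<^sup>+\<omega>. (\<Prod>b\<in>UNIV. case_bool X Y b \<omega>) \<partial>M) = (\<Prod>b\<in>UNIV. \<integral>\<^sup>+\<omega>. case_bool X Y b \<omega> \<partial>M)"
    by (intro indep_vars_nn_integral) auto
  then show ?thesis
    by (simp add: UNIV_bool mult.commute)
qed

lemma npoints_particles: "finite J \<Longrightarrow> npoints A (particles J t w) = card {j \<in> J. w j t \<in> A}"
  by (simp add: npoints_def particles_def filter_mset_image_mset filter_mset_mset_set o_def)

text \<open>Each particle contributes \<open>a\<close> at 0, \<open>b\<close> at 1 and the factor 0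
  elsewhere, so a single unabsorbed particle annihilates the product, just as the conditional on the
  left does. In product form the mean over independent particles factorises.\<close>

lemma prod_boundary_weights:
  fixes v :: "'i \<Rightarrow> real" and a b :: real
  assumes "finite J"
  shows "a ^ card {j \<in> J. v j \<in> {0}} * b ^ card {j \<in> J. v j \<in> {1}} *
      (if card {j \<in> J. v j \<in> {0, 1}} = card J then 1 else 0) =
    (\<Prod>j\<in>J. a * indicator {0} (v j) + b * indicator {1} (v j))"
  using assms
proof (induction J rule: finite_induct)
  case (insert i J)
  define c where "c A = card {j \<in> J. v j \<in> A}" for A
  have c_insert: "card {j \<in> insert i J. v j \<in> A} = (if v i \<in> A then Suc (c A) else c A)" for A
  proof -
    have "{j \<in> insert i J. v j \<in> A} = (if v i \<in> A then insert i {j \<in> J. v j \<in> A} else {j \<in> J. v j \<in> A})"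
      by auto
    then show ?thesis
      using insert.hyps by (simp add: c_def)
  qed
  have IH: "(\<Prod>j\<in>J. a * indicator {0} (v j) + b * indicator {1} (v j)) =
      a ^ c {0} * b ^ c {1} * (if c {0, 1} = card J then 1 else 0)"
    unfolding c_def by (rule insert.IH[symmetric])
  \<comment> \<open>When the new particle is at neither endpoint, this bound keeps the number of
    absorbed particles below \<open>Suc (card J)\<close>, so that both sides vanish.\<close>
  have le: "c {0, 1} \<le> card J"
    unfolding c_def using insert.hyps by (intro card_mono) auto
  consider "v i = 0" | "v i = 1" | "v i \<noteq> 0" "v i \<noteq> 1" by blast
  then show ?case
    unfolding c_insert prod.insert[OF insert.hyps] IH using insert.hyps le by cases auto
qed simp

section \<open>One-particle rates and densities, and the equality of the two candidate
  densities\<close>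

locale absorbed_gas = brownian_motion M B
  for M :: "'a measure" and B +
  fixes p :: "real \<Rightarrow> real \<Rightarrow> real \<Rightarrow> real" and lamL lamR t :: real and \<eta> :: "real multiset"
  assumes density: "abs_transition_density M B p"
    and lam: "0 \<le> lamL" "0 \<le> lamR" and t: "0 < t" and \<eta>: "set_mset \<eta> \<subseteq> {0<..<1}"
begin

text \<open>This is the \<rho> of the overview. For interior \<open>x\<close> it is also the mean,
  for a particle started at \<open>x\<close>, of the weight equal to \<open>lamL\<close> at 0,
  \<open>lamR\<close> at 1 and 0 elsewhere at time \<open>t\<close>. This double role is what
  matches injected points with absorbed particles.\<close>

definition rate :: "real \<Rightarrow> real" where
  "rate x = lamL * abs_hit_prob M B 0 t x + lamR * abs_hit_prob M B 1 t x"

lemma rate_bounds: "0 \<le> rate x" "rate x \<le> lamL + lamR"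
proof -
  show "0 \<le> rate x"
    using lam abs_hit_prob_bounds by (simp add: rate_def)
  show "rate x \<le> lamL + lamR"
    unfolding rate_def using lam abs_hit_prob_bounds by (intro add_mono mult_left_le) auto
qed

lemma measurable_rate [measurable]: "rate \<in> borel_measurable leb01"
proof -
  have [measurable]: "abs_hit_prob M B 0 t \<in> borel_measurable leb01" "abs_hit_prob M B 1 t \<in> borel_measurable leb01"
    using t by (auto intro: measurable_abs_hit_prob)
  have "(\<lambda>x. rate x) \<in> borel_measurable leb01"
    unfolding rate_def by measurable
  then show ?thesis .
qed

lemma measurable_position: "x \<in> {0<..<1} \<Longrightarrow> (\<lambda>\<omega>. absorbed_bm B x \<omega> t) \<in> borel_measurable M"
  using t by (intro measurable_absorbed_bm) auto

lemma p_nonneg: "x \<in> {0<..<1} \<Longrightarrow> y \<in> {0<..<1} \<Longrightarrow> 0 \<le> p t x y"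
  using density t unfolding abs_transition_density_def by blast

lemma p_sym: "x \<in> {0<..<1} \<Longrightarrow> y \<in> {0<..<1} \<Longrightarrow> p t x y = p t y x"
  using density t unfolding abs_transition_density_def by blast

lemma measurable_p: "x \<in> {0<..<1} \<Longrightarrow> p t x \<in> borel_measurable leb01"
  using density t unfolding abs_transition_density_def by blast

lemma nn_integral_p:
  assumes "x \<in> {0<..<1}" "A \<in> sets leb01"
  shows "(\<integral>\<^sup>+y. ennreal (p t x y) * indicator A y \<partial>leb01) = (\<integral>\<^sup>+\<omega>. indicator A (absorbed_bm B x \<omega> t) \<partial>M)"
proof -
  have A [measurable]: "A \<in> sets borel"
    using assms(2) sets_leb01_iff by simp
  have [measurable]: "(\<lambda>\<omega>. absorbed_bm B x \<omega> t) \<in> borel_measurable M"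
    using assms by (intro measurable_position)
  have "(\<integral>\<^sup>+y. ennreal (p t x y) * indicator A y \<partial>leb01) = emeasure (abs_law M B x) {w \<in> space (abs_law M B x). w t \<in> A}"
    using density t assms unfolding abs_transition_density_def by simp
  also have "\<dots> = emeasure M {\<omega> \<in> space M. absorbed_bm B x \<omega> t \<in> A}"
    using emeasure_abs_law[OF assms(1) _ A, of t] t by simp
  also have "\<dots> = (\<integral>\<^sup>+\<omega>. indicator {\<omega> \<in> space M. absorbed_bm B x \<omega> t \<in> A} \<omega> \<partial>M)"
    by (intro nn_integral_indicator[symmetric]) measurable
  also have "\<dots> = (\<integral>\<^sup>+\<omega>. indicator A (absorbed_bm B x \<omega> t) \<partial>M)"
    by (intro nn_integral_cong) (auto simp: indicator_def)
  finally show ?thesis .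
qed

lemma nn_integral_hit:
  assumes "x \<in> {0<..<1}" "a \<in> {0, 1}"
  shows "(\<integral>\<^sup>+\<omega>. indicator {a} (absorbed_bm B x \<omega> t) \<partial>M) = ennreal (abs_hit_prob M B a t x)"
proof -
  have [measurable]: "(\<lambda>\<omega>. absorbed_bm B x \<omega> t) \<in> borel_measurable M"
    using assms by (intro measurable_position)
  have "(\<integral>\<^sup>+\<omega>. indicator {a} (absorbed_bm B x \<omega> t) \<partial>M) =
      (\<integral>\<^sup>+\<omega>. indicator {\<omega> \<in> space M. absorbed_bm B x \<omega> t = a} \<omega> \<partial>M)"
    by (intro nn_integral_cong) (auto simp: indicator_def)
  also have "\<dots> = emeasure M {\<omega> \<in> space M. absorbed_bm B x \<omega> t = a}"
    by (intro nn_integral_indicator) measurable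
  finally show ?thesis
    using assms t by (simp add: abs_hit_prob_eq emeasure_eq_measure)
qed

lemma ext_density_nonneg: "x \<in> {0<..<1} \<Longrightarrow> y \<in> {0..1} \<Longrightarrow> 0 \<le> ext_density M B p t x y"
  using p_nonneg abs_hit_prob_bounds by (auto simp: ext_density_def)

lemma measurable_ext_density:
  assumes "x \<in> {0<..<1}"
  shows "ext_density M B p t x \<in> borel_measurable leb01_ext"
proof -
  have "p t x \<in> borel_measurable (restrict_space borel {0<..<1})"
    using measurable_p[OF assms] unfolding leb01_def
    by (subst measurable_cong_sets[OF sets_restrict_space_cong refl]) auto
  then have [measurable]: "(\<lambda>y. indicator {0<..<1} y *\<^sub>R p t x y) \<in> borel_measurable borel"
    by (subst (asm) borel_measurable_restrict_space_iff) auto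
  have "(\<lambda>y. indicator {0<..<1} y *\<^sub>R p t x y + abs_hit_prob M B 0 t x * indicator {0} y +
      abs_hit_prob M B 1 t x * indicator {1} y) \<in> borel_measurable (restrict_space borel {0..1})"
    by (intro measurable_restrict_space1) measurable
  then have "ext_density M B p t x \<in> borel_measurable (restrict_space borel {0..1})"
    by (rule measurable_cong[THEN iffD1, rotated])
      (auto simp: ext_density_def space_restrict_space indicator_def)
  then show ?thesis
    using measurable_cong_sets[OF sets_leb01_ext refl, of "borel :: real measure"] by blast
qed

text \<open>The absorbed path never leaves [0,1], so its position is interior, 0 or 1. The density
  covers the first event, and the unit masses of \<open>leb01_ext\<close> at the endpoints pick up
  the two hitting probabilities.\<close>

lemma nn_integral_ext_density:
  assumes x: "x \<in> {0<..<1}"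
  shows "(\<integral>\<^sup>+y. ennreal (ext_density M B p t x y) \<partial>leb01_ext) = 1"
proof -
  have [measurable]: "(\<lambda>\<omega>. absorbed_bm B x \<omega> t) \<in> borel_measurable M"
    using assms by (intro measurable_position)
  have m: "(\<lambda>y. ennreal (ext_density M B p t x y)) \<in> borel_measurable leb01_ext"
    by (intro measurable_compose[OF measurable_ext_density[OF x] measurable_ennreal])
  have ends: "ext_density M B p t x 0 = abs_hit_prob M B 0 t x" "ext_density M B p t x 1 = abs_hit_prob M B 1 t x"
    by (simp_all add: ext_density_def)
  have "(\<integral>\<^sup>+y. ennreal (ext_density M B p t x y) \<partial>leb01) =
      (\<integral>\<^sup>+y. ennreal (p t x y) * indicator {0<..<1} y \<partial>leb01)"
    by (intro nn_integral_cong) (auto simp: ext_density_def)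
  also have "\<dots> = (\<integral>\<^sup>+\<omega>. indicator {0<..<1} (absorbed_bm B x \<omega> t) \<partial>M)"
    by (rule nn_integral_p[OF x]) (simp add: sets_leb01_iff)
  finally have "(\<integral>\<^sup>+y. ennreal (ext_density M B p t x y) \<partial>leb01_ext) =
      (\<integral>\<^sup>+\<omega>. indicator {0<..<1} (absorbed_bm B x \<omega> t) \<partial>M) +
      (\<integral>\<^sup>+\<omega>. indicator {0} (absorbed_bm B x \<omega> t) \<partial>M) + (\<integral>\<^sup>+\<omega>. indicator {1} (absorbed_bm B x \<omega> t) \<partial>M)"
    using nn_integral_leb01_ext[OF m] nn_integral_hit[OF x] by (simp add: ends)
  also have "\<dots> = (\<integral>\<^sup>+\<omega>. indicator {0<..<1} (absorbed_bm B x \<omega> t) +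
      indicator {0} (absorbed_bm B x \<omega> t) + indicator {1} (absorbed_bm B x \<omega> t) \<partial>M)"
    by (simp add: nn_integral_add)
  also have "\<dots> = (\<integral>\<^sup>+\<omega>. 1 \<partial>M)"
    using absorbed_bm_in_unit[OF _ x, of _ t] t
    by (intro nn_integral_cong) (force simp: indicator_def)
  finally show ?thesis
    by (simp add: emeasure_space_1)
qed

lemma nn_integral_abs_system_prod:
  assumes J: "finite J" and x: "\<And>j. j \<in> J \<Longrightarrow> x j \<in> {0<..<1}"
    and g: "\<And>j. j \<in> J \<Longrightarrow> g j \<in> borel_measurable borel"
  shows "(\<integral>\<^sup>+w. (\<Prod>j\<in>J. g j (w j t)) \<partial>abs_system M B J x) =
    (\<Prod>j\<in>J. \<integral>\<^sup>+\<omega>. g j (absorbed_bm B (x j) \<omega> t) \<partial>M)"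
proof -
  \<comment> \<open>\<open>product_prob_space\<close> asks for a probability measure at every index,
    so indices outside \<open>J\<close> receive the interior starting point 1/2.\<close>
  define x' where "x' j = (if j \<in> J then x j else 1 / 2)" for j
  have x': "x' j \<in> {0<..<1}" for j
    using x by (simp add: x'_def)
  interpret product_prob_space "\<lambda>j. abs_law M B (x' j)" J
    using prob_space_abs_law[OF x'] by (intro product_prob_spaceI)
  have meas: "(\<lambda>w. g j (w t)) \<in> borel_measurable (abs_law M B (x' j))" if "j \<in> J" for j
    using measurable_compose[OF measurable_eval g[OF that]] t
    by (simp add: measurable_cong_sets[OF sets_abs_law refl])
  have "abs_system M B J x = PiM J (\<lambda>j. abs_law M B (x' j))"
    unfolding abs_system_def by (intro PiM_cong) (auto simp: x'_def)
  then have "(\<integral>\<^sup>+w. (\<Prod>j\<in>J. g j (w j t)) \<partial>abs_system M B J x) =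
      (\<Prod>j\<in>J. \<integral>\<^sup>+w. g j (w t) \<partial>abs_law M B (x' j))"
    using product_nn_integral_prod[OF J meas] by simp
  also have "\<dots> = (\<Prod>j\<in>J. \<integral>\<^sup>+\<omega>. g j (absorbed_bm B (x j) \<omega> t) \<partial>M)"
  proof (rule prod.cong[OF refl])
    fix j assume j: "j \<in> J"
    show "(\<integral>\<^sup>+w. g j (w t) \<partial>abs_law M B (x' j)) = (\<integral>\<^sup>+\<omega>. g j (absorbed_bm B (x j) \<omega> t) \<partial>M)"
      using nn_integral_abs_law[OF x' _ g[OF j], of t j] t j by (simp add: x'_def)
  qed
  finally show ?thesis .
qed

lemma sets_abs_system [simp, measurable_cong]: "sets (abs_system M B J x) = sets (PiM J (\<lambda>_. path_space))"
  unfolding abs_system_def by (intro sets_PiM_cong) auto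

lemma measurable_coordinate:
  "j \<in> J \<Longrightarrow> (\<lambda>w. w j t) \<in> borel_measurable (PiM J (\<lambda>_. path_space))"
  using t measurable_component_singleton[of j J "\<lambda>_. path_space"]
  by (intro measurable_compose[OF _ measurable_eval]) auto

text \<open>By \<open>prod_boundary_weights\<close> the functional is a product over the particles;
  independence turns its mean into a product of one-particle means, each of which is
  \<open>rate\<close>.\<close>

lemma abs_expectation_all_absorbed:
  assumes J: "finite J" and z: "\<And>j. j \<in> J \<Longrightarrow> z j \<in> {0<..<1}"
  shows "abs_expectation M B J z t
      (\<lambda>\<xi>. lamL ^ npoints {0} \<xi> * lamR ^ npoints {1} \<xi> * (if npoints {0, 1} \<xi> = card J then 1 else 0)) =
    (\<Prod>j\<in>J. rate (z j))"
proof -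
  let ?c = "\<lambda>y :: real. lamL * indicator {0} y + lamR * indicator {1} y"
  have c: "(\<integral>\<^sup>+\<omega>. ennreal (?c (absorbed_bm B x \<omega> t)) \<partial>M) = ennreal (rate x)" if x: "x \<in> {0<..<1}" for x
  proof -
    have [measurable]: "(\<lambda>\<omega>. absorbed_bm B x \<omega> t) \<in> borel_measurable M"
      using x by (rule measurable_position)
    have "(\<integral>\<^sup>+\<omega>. ennreal (?c (absorbed_bm B x \<omega> t)) \<partial>M) =
        (\<integral>\<^sup>+\<omega>. ennreal lamL * indicator {0} (absorbed_bm B x \<omega> t) +
          ennreal lamR * indicator {1} (absorbed_bm B x \<omega> t) \<partial>M)"
      using lam by (intro nn_integral_cong) (simp add: indicator_def)
    also have "\<dots> = ennreal lamL * (\<integral>\<^sup>+\<omega>. indicator {0} (absorbed_bm B x \<omega> t) \<partial>M) +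
        ennreal lamR * (\<integral>\<^sup>+\<omega>. indicator {1} (absorbed_bm B x \<omega> t) \<partial>M)"
      by (simp add: nn_integral_add nn_integral_cmult)
    also have "\<dots> = ennreal (rate x)"
      using nn_integral_hit[OF x] lam abs_hit_prob_bounds
      by (simp add: rate_def ennreal_plus ennreal_mult)
    finally show ?thesis .
  qed
  have "abs_expectation M B J z t
      (\<lambda>\<xi>. lamL ^ npoints {0} \<xi> * lamR ^ npoints {1} \<xi> * (if npoints {0, 1} \<xi> = card J then 1 else 0)) =
      (\<integral>w. (\<Prod>j\<in>J. ?c (w j t)) \<partial>abs_system M B J z)"
    unfolding abs_expectation_def npoints_particles[OF J] prod_boundary_weights[OF J] ..
  also have "\<dots> = enn2real (\<integral>\<^sup>+w. ennreal (\<Prod>j\<in>J. ?c (w j t)) \<partial>abs_system M B J z)"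
  proof (rule integral_eq_nn_integral)
    have "(\<lambda>w. \<Prod>j\<in>J. ?c (w j t)) \<in> borel_measurable (PiM J (\<lambda>_. path_space))"
    proof (rule borel_measurable_prod)
      fix j assume j: "j \<in> J"
      have "?c \<in> borel_measurable borel"
        by measurable
      then show "(\<lambda>w. ?c (w j t)) \<in> borel_measurable (PiM J (\<lambda>_. path_space))"
        by (rule measurable_compose[OF measurable_coordinate[OF j]])
    qed
    then show "(\<lambda>w. \<Prod>j\<in>J. ?c (w j t)) \<in> borel_measurable (abs_system M B J z)"
      by (simp add: measurable_cong_sets[OF sets_abs_system refl])
    show "AE w in abs_system M B J z. 0 \<le> (\<Prod>j\<in>J. ?c (w j t))"
      using lam by (intro AE_I2 prod_nonneg) auto
  qed
  also have "\<dots> = enn2real (\<integral>\<^sup>+w. (\<Prod>j\<in>J. ennreal (?c (w j t))) \<partial>abs_system M B J z)"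
    using lam by (intro arg_cong[where f = enn2real] nn_integral_cong prod_ennreal[symmetric]) auto
  also have "\<dots> = enn2real (\<Prod>j\<in>J. ennreal (rate (z j)))"
    using c z by (subst nn_integral_abs_system_prod[OF J z]) (simp_all cong: prod.cong)
  also have "\<dots> = (\<Prod>j\<in>J. rate (z j))"
    using rate_bounds by (simp add: prod_ennreal prod_nonneg)
  finally show ?thesis .
qed

lemma atom_\<eta>: "k < size \<eta> \<Longrightarrow> atom \<eta> k \<in> {0<..<1}"
  using \<eta> atom_in_set by blast

text \<open>Density at \<open>z\<close> of the expected factorial measure of those initial particles
  that are still in the open interval. The starting points occupy the first argument of
  \<open>p\<close>, so that \<open>z\<close> enters only through the second, in which
  \<open>p\<close> is measurable.\<close>

definition hit_sum :: "nat set \<Rightarrow> (nat \<Rightarrow> real) \<Rightarrow> real" where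
  "hit_sum L z = inj_sum (\<lambda>i k. p t (atom \<eta> k) (z i)) L {..<size \<eta>}"

lemma
  assumes "\<And>i. i \<in> L \<Longrightarrow> z i \<in> {0<..<1}"
  shows ennreal_hit_sum: "ennreal (hit_sum L z) = inj_sum (\<lambda>i k. ennreal (p t (atom \<eta> k) (z i))) L {..<size \<eta>}"
    and hit_sum_nonneg: "0 \<le> hit_sum L z"
  unfolding hit_sum_def using assms atom_\<eta> p_nonneg
  by (auto intro!: ennreal_inj_sum(1)[symmetric] ennreal_inj_sum(2))

text \<open>Every coordinate outside \<open>I\<close> integrates to the mass 1 of the extended
  density. The coordinates in \<open>I\<close> sit at points of \<eta>, all of them interior, where
  the extended density is \<open>p\<close>.\<close>

lemma signed_factorial_integral_ext_density:
  assumes K: "finite K" and z: "\<And>j. j \<in> K \<Longrightarrow> z j \<in> {0<..<1}"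
  shows "signed_factorial_integral leb01_ext \<theta> K \<eta> (\<lambda>y. \<Prod>j\<in>K. ext_density M B p t (z j) (y j)) =
    (\<Sum>I\<in>Pow K. (- \<theta>) ^ (card K - card I) * hit_sum I z)"
  unfolding signed_factorial_integral_def
proof (intro sum.cong refl arg_cong2[where f = "(*)"])
  fix I assume "I \<in> Pow K"
  then have I: "I \<subseteq> K" by simp
  let ?e = "\<lambda>j y. ext_density M B p t (z j) y"
  have space: "space (mixed_measure leb01_ext K I \<eta>) = PiE K (\<lambda>_. {0..1})"
    using sets_eq_imp_space_eq[OF sets_mixed_measure, of leb01_ext K I \<eta>] by (simp add: space_PiM)
  have nonneg: "0 \<le> ?e j (y j)" if "j \<in> K" "y \<in> space (mixed_measure leb01_ext K I \<eta>)" for j y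
    using that z ext_density_nonneg by (auto simp: space PiE_iff)
  have meas [measurable]: "(\<lambda>y. ?e j (y j)) \<in> borel_measurable (PiM K (\<lambda>_. leb01_ext))" if "j \<in> K" for j
    using measurable_ext_density[OF z[OF that]] that
    by (intro measurable_compose[OF measurable_component_singleton])
  have "(\<integral>y. (\<Prod>j\<in>K. ?e j (y j)) \<partial>mixed_measure leb01_ext K I \<eta>) =
      enn2real (\<integral>\<^sup>+y. ennreal (\<Prod>j\<in>K. ?e j (y j)) \<partial>mixed_measure leb01_ext K I \<eta>)"
    using nonneg by (intro integral_eq_nn_integral) (auto intro!: prod_nonneg AE_I2)
  also have "\<dots> = enn2real (\<integral>\<^sup>+y. (\<Prod>j\<in>K. ennreal (?e j (y j))) \<partial>mixed_measure leb01_ext K I \<eta>)"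
    using nonneg by (intro arg_cong[where f = enn2real] nn_integral_cong prod_ennreal[symmetric]) auto
  also have "\<dots> = enn2real (factorial_sum (\<lambda>j y. ennreal (?e j y)) I \<eta> *
      (\<Prod>j\<in>K - I. \<integral>\<^sup>+y. ennreal (?e j y) \<partial>leb01_ext))"
    using \<eta> measurable_ext_density z
    by (subst nn_integral_mixed_measure[OF finite_measure.sigma_finite_measure[OF finite_measure_leb01_ext] K I])
      auto
  also have "(\<Prod>j\<in>K - I. \<integral>\<^sup>+y. ennreal (?e j y) \<partial>leb01_ext) = 1"
    using z nn_integral_ext_density by (intro prod.neutral) auto
  also have "factorial_sum (\<lambda>j y. ennreal (?e j y)) I \<eta> =
      inj_sum (\<lambda>j k. ennreal (p t (atom \<eta> k) (z j))) I {..<size \<eta>}"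
    unfolding factorial_sum_def
  proof (rule inj_sum_cong)
    fix j k assume "j \<in> I" "k \<in> {..<size \<eta>}"
    then have "z j \<in> {0<..<1}" "atom \<eta> k \<in> {0<..<1}"
      using z I atom_\<eta> by auto
    \<comment> \<open>In the formula the motion starts at \<open>z j\<close>, in the gas it starts
      at a point of \<eta>; symmetry of \<open>p\<close> exchanges the two.\<close>
    then show "ennreal (?e j (atom \<eta> k)) = ennreal (p t (atom \<eta> k) (z j))"
      using p_sym[of "z j" "atom \<eta> k"] by (simp add: ext_density_def)
  qed
  also have "\<dots> = ennreal (hit_sum I z)"
    using z I by (intro ennreal_hit_sum[symmetric]) auto
  finally have "(\<integral>y. (\<Prod>j\<in>K. ?e j (y j)) \<partial>mixed_measure leb01_ext K I \<eta>) = enn2real (ennreal (hit_sum I z))"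
    by simp
  moreover have "0 \<le> hit_sum I z"
    using z I by (intro hit_sum_nonneg) auto
  ultimately show "(\<integral>y. (\<Prod>j\<in>K. ?e j (y j)) \<partial>mixed_measure leb01_ext K I \<eta>) = hit_sum I z"
    by simp
qed

definition factorial_density :: "nat set \<Rightarrow> (nat \<Rightarrow> real) \<Rightarrow> real" where
  "factorial_density I z = (\<Sum>L\<in>Pow I. hit_sum L z * (\<Prod>i\<in>I - L. rate (z i)))"

text \<open>Both sides are sums over pairs of disjoint index sets, the coordinates filled by initial
  particles and those filled by injected ones.\<close>

lemma density_eq:
  assumes K: "finite K" and z: "\<And>j. j \<in> K \<Longrightarrow> z j \<in> {0<..<1}"
  shows "(\<Sum>J\<in>Pow K. abs_expectation M B J z t
        (\<lambda>\<xi>. lamL ^ npoints {0} \<xi> * lamR ^ npoints {1} \<xi> * (if npoints {0, 1} \<xi> = card J then 1 else 0)) *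
      signed_factorial_integral leb01_ext \<theta> (K - J) \<eta> (\<lambda>y. \<Prod>j\<in>K - J. ext_density M B p t (z j) (y j))) =
    (\<Sum>I\<in>Pow K. (- \<theta>) ^ (card K - card I) * factorial_density I z)"
    (is "?lhs = ?rhs")
proof -
  let ?S = "SIGMA J:Pow K. Pow (K - J)" and ?T = "SIGMA I:Pow K. Pow I"
  have fin: "finite A" if "A \<subseteq> K" for A
    using that K by (rule finite_subset)
  have "?lhs = (\<Sum>J\<in>Pow K. \<Sum>I\<in>Pow (K - J).
      (\<Prod>j\<in>J. rate (z j)) * ((- \<theta>) ^ (card (K - J) - card I) * hit_sum I z))"
  proof (rule sum.cong[OF refl])
    fix J assume "J \<in> Pow K"
    then have J: "J \<subseteq> K" "finite J" using fin by auto
    show "abs_expectation M B J z t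
        (\<lambda>\<xi>. lamL ^ npoints {0} \<xi> * lamR ^ npoints {1} \<xi> * (if npoints {0, 1} \<xi> = card J then 1 else 0)) *
      signed_factorial_integral leb01_ext \<theta> (K - J) \<eta> (\<lambda>y. \<Prod>j\<in>K - J. ext_density M B p t (z j) (y j)) =
      (\<Sum>I\<in>Pow (K - J). (\<Prod>j\<in>J. rate (z j)) * ((- \<theta>) ^ (card (K - J) - card I) * hit_sum I z))"
      using J z K
      by (subst abs_expectation_all_absorbed, simp, blast, subst signed_factorial_integral_ext_density)
        (auto simp: sum_distrib_left)
  qed
  also have "\<dots> = (\<Sum>(J, I)\<in>?S. (\<Prod>j\<in>J. rate (z j)) * ((- \<theta>) ^ (card (K - J) - card I) * hit_sum I z))"
    using K by (intro sum.Sigma) auto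
  \<comment> \<open>With J the injected and I the initial coordinates, the filled set is I \<union>
    J, and |K - J| - |I| = |K| - |I \<union> J| matches the powers of -\<theta>.\<close>
  also have "\<dots> = (\<Sum>(I, L)\<in>?T. (- \<theta>) ^ (card K - card I) * (hit_sum L z * (\<Prod>i\<in>I - L. rate (z i))))"
  proof (rule sum.reindex_bij_witness[where j = "\<lambda>(J, I). (I \<union> J, I)" and i = "\<lambda>(I, L). (I - L, L)"])
    fix a assume a: "a \<in> ?S"
    obtain J I where [simp]: "a = (J, I)" by (cases a)
    from a have JI: "J \<subseteq> K" "I \<subseteq> K - J" by auto
    then show "(case case a of (J, I) \<Rightarrow> (I \<union> J, I) of (I, L) \<Rightarrow> (I - L, L)) = a"
      by auto
    show "(case a of (J, I) \<Rightarrow> (I \<union> J, I)) \<in> ?T"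
      using JI by auto
    have "card (I \<union> J) = card I + card J" "card (K - J) = card K - card J"
      using JI fin[of I] fin[of J] by (auto intro!: card_Un_disjoint card_Diff_subset)
    moreover have "I \<union> J - I = J"
      using JI by auto
    ultimately show "(case case a of (J, I) \<Rightarrow> (I \<union> J, I) of (I, L) \<Rightarrow>
          (- \<theta>) ^ (card K - card I) * (hit_sum L z * (\<Prod>i\<in>I - L. rate (z i)))) =
        (case a of (J, I) \<Rightarrow> (\<Prod>j\<in>J. rate (z j)) * ((- \<theta>) ^ (card (K - J) - card I) * hit_sum I z))"
      by (simp add: add.commute)
  qed auto
  also have "\<dots> = ?rhs"
    unfolding factorial_density_def sum_distrib_left
    using K fin by (intro sum.Sigma[symmetric]) auto
  finally show ?thesis .
qed

end

lemma set_integral_null_set: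
  fixes f :: "'x \<Rightarrow> real"
  assumes "A \<in> null_sets \<mu>"
  shows "(LINT x:A|\<mu>. f x) = 0"
  unfolding set_lebesgue_integral_def
  by (rule integral_eq_zero_AE, rule eventually_mono[OF AE_not_in[OF assms]]) simp

section \<open>Expected factorial measures of the gas\<close>

context absorbed_gas
begin

lemma factorial_sum_particles:
  "finite J \<Longrightarrow> factorial_sum g L (particles J t w) = inj_sum (\<lambda>i j. g i (w j t)) L J"
  unfolding particles_def by (rule factorial_sum_image)

lemma measurable_factorial_sum_particles:
  fixes g :: "'i \<Rightarrow> real \<Rightarrow> ennreal"
  assumes J: "finite J" and g: "\<And>i. i \<in> L \<Longrightarrow> g i \<in> borel_measurable borel"
  shows "(\<lambda>w. factorial_sum g L (particles J t w)) \<in> borel_measurable (PiM J (\<lambda>_. path_space))"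
  unfolding factorial_sum_particles[OF J] inj_sum_def
proof (intro borel_measurable_sum borel_measurable_prod_ennreal)
  fix f i assume "f \<in> {f \<in> L \<rightarrow>\<^sub>E J. inj_on f L}" "i \<in> L"
  then have "f i \<in> J" by (auto simp: PiE_iff)
  then show "(\<lambda>w. g i (w (f i) t)) \<in> borel_measurable (PiM J (\<lambda>_. path_space))"
    by (rule measurable_compose[OF measurable_coordinate g[OF \<open>i \<in> L\<close>]])
qed

text \<open>Along an injection different coordinates follow different, hence independent, particles,
  so each term factorises. The sum over injections is again an \<open>inj_sum\<close>, now of
  one-particle means.\<close>

lemma nn_integral_factorial_sum_particles:
  fixes g :: "'i \<Rightarrow> real \<Rightarrow> ennreal"
  assumes J: "finite J" and x: "\<And>j. j \<in> J \<Longrightarrow> x j \<in> {0<..<1}"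
    and L: "finite L" and g: "\<And>i. i \<in> L \<Longrightarrow> g i \<in> borel_measurable borel"
  shows "(\<integral>\<^sup>+w. factorial_sum g L (particles J t w) \<partial>abs_system M B J x) =
    inj_sum (\<lambda>i j. \<integral>\<^sup>+\<omega>. g i (absorbed_bm B (x j) \<omega> t) \<partial>M) L J"
proof -
  have "(\<integral>\<^sup>+w. factorial_sum g L (particles J t w) \<partial>abs_system M B J x) =
      (\<Sum>f\<in>{f \<in> L \<rightarrow>\<^sub>E J. inj_on f L}. \<integral>\<^sup>+w. (\<Prod>i\<in>L. g i (w (f i) t)) \<partial>abs_system M B J x)"
    unfolding factorial_sum_particles[OF J] inj_sum_def
  proof (rule nn_integral_sum)
    fix f assume f: "f \<in> {f \<in> L \<rightarrow>\<^sub>E J. inj_on f L}"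
    have "(\<lambda>w. \<Prod>i\<in>L. g i (w (f i) t)) \<in> borel_measurable (PiM J (\<lambda>_. path_space))"
    proof (rule borel_measurable_prod_ennreal)
      fix i assume i: "i \<in> L"
      then have "f i \<in> J" using f by (auto simp: PiE_iff)
      then show "(\<lambda>w. g i (w (f i) t)) \<in> borel_measurable (PiM J (\<lambda>_. path_space))"
        by (rule measurable_compose[OF measurable_coordinate g[OF i]])
    qed
    then show "(\<lambda>w. \<Prod>i\<in>L. g i (w (f i) t)) \<in> borel_measurable (abs_system M B J x)"
      by (simp add: measurable_cong_sets[OF sets_abs_system refl])
  qed
  also have "\<dots> = inj_sum (\<lambda>i j. \<integral>\<^sup>+\<omega>. g i (absorbed_bm B (x j) \<omega> t) \<partial>M) L J"
    unfolding inj_sum_def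
  proof (rule sum.cong[OF refl])
    fix f assume "f \<in> {f \<in> L \<rightarrow>\<^sub>E J. inj_on f L}"
    then have f: "inj_on f L" "f ` L \<subseteq> J"
      by (auto simp: PiE_iff)
    \<comment> \<open>Particles outside the range of \<open>f\<close> receive the constant 1, whose
      mean under a probability measure is 1.\<close>
    define h where "h j = (if j \<in> f ` L then g (the_inv_into L f j) else (\<lambda>_. 1))" for j
    have h: "h j \<in> borel_measurable borel" for j
      using g f by (auto simp: h_def the_inv_into_f_f)
    have eq: "(\<Prod>i\<in>L. g i (w (f i) t)) = (\<Prod>j\<in>J. h j (w j t))" for w
      using prod_inj_on_extend[OF J f, of "\<lambda>i j. g i (w j t)"]
      by (simp add: h_def if_distrib[where f = "\<lambda>g. g _"] cong: if_cong)
    have "(\<integral>\<^sup>+w. (\<Prod>i\<in>L. g i (w (f i) t)) \<partial>abs_system M B J x) =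
        (\<Prod>j\<in>J. \<integral>\<^sup>+\<omega>. h j (absorbed_bm B (x j) \<omega> t) \<partial>M)"
      unfolding eq using J x h by (rule nn_integral_abs_system_prod)
    also have "\<dots> = (\<Prod>j\<in>J. if j \<in> f ` L then
        \<integral>\<^sup>+\<omega>. g (the_inv_into L f j) (absorbed_bm B (x j) \<omega> t) \<partial>M else 1)"
      by (intro prod.cong refl) (simp add: h_def emeasure_space_1)
    also have "\<dots> = (\<Prod>i\<in>L. \<integral>\<^sup>+\<omega>. g i (absorbed_bm B (x (f i)) \<omega> t) \<partial>M)"
      by (rule prod_inj_on_extend[OF J f, symmetric])
    finally show "(\<integral>\<^sup>+w. (\<Prod>i\<in>L. g i (w (f i) t)) \<partial>abs_system M B J x) =
        (\<Prod>i\<in>L. \<integral>\<^sup>+\<omega>. g i (absorbed_bm B (x (f i)) \<omega> t) \<partial>M)" .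
  qed
  finally show ?thesis .
qed

lemma sets_gas_intensity: "sets (gas_intensity M B lamL lamR t) = sets leb01"
  by (simp add: gas_intensity_def)

lemma emeasure_gas_intensity:
  "A \<in> sets leb01 \<Longrightarrow>
    emeasure (gas_intensity M B lamL lamR t) A = (\<integral>\<^sup>+x. ennreal (rate x) * indicator A x \<partial>leb01)"
  unfolding gas_intensity_def rate_def[symmetric] by (subst emeasure_density) auto

lemma nn_integral_rate_finite: "(\<integral>\<^sup>+x. ennreal (rate x) * indicator A x \<partial>leb01) < \<infinity>"
proof -
  interpret L: prob_space leb01 by (rule prob_space_leb01)
  have "(\<integral>\<^sup>+x. ennreal (rate x) * indicator A x \<partial>leb01) \<le> (\<integral>\<^sup>+x. ennreal (lamL + lamR) \<partial>leb01)"
    using rate_bounds by (intro nn_integral_mono) (auto simp: indicator_def intro: ennreal_leI)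
  also have "\<dots> < \<infinity>"
    by (simp add: L.emeasure_space_1[simplified])
  finally show ?thesis .
qed

lemma finite_measure_gas_intensity: "finite_measure (gas_intensity M B lamL lamR t)"
proof
  have "space (gas_intensity M B lamL lamR t) = space leb01"
    by (rule sets_eq_imp_space_eq[OF sets_gas_intensity])
  then show "emeasure (gas_intensity M B lamL lamR t) (space (gas_intensity M B lamL lamR t)) \<noteq> \<infinity>"
    using nn_integral_rate_finite[of "space leb01"] by (simp add: emeasure_gas_intensity less_top del: space_leb01)
qed

text \<open>For measurable \<open>A\<close> in the open interval this is the probability that the
  particle started at \<open>atom \<eta> k\<close> is in \<open>A\<close> at time \<open>t\<close>.
  It is kept as an integral because integrating \<open>factorial_density\<close> over rectangles
  produces exactly this form.\<close>

definition p_mass :: "real set \<Rightarrow> nat \<Rightarrow> ennreal" where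
  "p_mass A k = (\<integral>\<^sup>+y. ennreal (p t (atom \<eta> k) y) * indicator A y \<partial>leb01)"

definition rate_mass :: "real set \<Rightarrow> ennreal" where
  "rate_mass A = (\<integral>\<^sup>+y. ennreal (rate y) * indicator A y \<partial>leb01)"

lemma expected_factorial_sum:
  assumes gas: "boundary_driven_gas M B lamL lamR \<eta> N \<eta>\<^sub>t"
    and I: "finite I" and A: "\<And>i. i \<in> I \<Longrightarrow> A i \<in> sets leb01"
  shows "(\<lambda>\<omega>. factorial_sum (\<lambda>i. indicator (A i)) I (\<eta>\<^sub>t t \<omega>) :: ennreal) \<in> borel_measurable N"
    and "(\<integral>\<^sup>+\<omega>. factorial_sum (\<lambda>i. indicator (A i)) I (\<eta>\<^sub>t t \<omega>) \<partial>N) =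
      (\<Sum>L\<in>Pow I. inj_sum (\<lambda>i. p_mass (A i)) L {..<size \<eta>} * (\<Prod>i\<in>I - L. rate_mass (A i)))"
proof -
  let ?s = "{..<size \<eta>}" and ?PS = "PiM {..<size \<eta>} (\<lambda>_. path_space)"
  let ?F = "\<lambda>L \<zeta>. factorial_sum (\<lambda>i. indicator (A i)) L \<zeta> :: ennreal"
  obtain W \<Theta> where N: "prob_space N" and W: "W \<in> measurable N ?PS"
    and lawW: "distr N ?PS W = abs_system M B ?s (atom \<eta>)"
    and P: "poisson_point_process N (gas_intensity M B lamL lamR t) \<Theta>"
    and ind: "prob_space.indep_var N config_space (\<lambda>\<omega>. particles ?s t (W \<omega>)) config_space \<Theta>"
    and \<eta>t: "\<And>\<omega>. \<omega> \<in> space N \<Longrightarrow>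
      \<eta>\<^sub>t t \<omega> = filter_mset (\<lambda>x. x \<in> {0<..<1}) (particles ?s t (W \<omega>)) + \<Theta> \<omega>"
    using gas t unfolding boundary_driven_gas_def by blast
  interpret N: prob_space N by fact
  have fin: "finite L" if "L \<subseteq> I" for L
    using that I by (rule finite_subset)
  have A_borel: "A i \<in> sets borel" "A i \<subseteq> {0<..<1}" if "i \<in> I" for i
    using A[OF that] by (auto simp: sets_leb01_iff)
  \<comment> \<open>Every \<open>A i\<close> lies in the open interval, so the factorial sum ignores
    absorbed particles and the restriction inside the gas disappears.\<close>
  have split: "?F I (\<eta>\<^sub>t t \<omega>) = (\<Sum>L\<in>Pow I. ?F L (particles ?s t (W \<omega>)) * ?F (I - L) (\<Theta> \<omega>))"
    if "\<omega> \<in> space N" for \<omega>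
  proof -
    have "?F L (filter_mset (\<lambda>x. x \<in> {0<..<1}) (particles ?s t (W \<omega>))) = ?F L (particles ?s t (W \<omega>))"
      if "L \<in> Pow I" for L
    proof (rule factorial_sum_filter)
      show "finite L"
        using that fin by simp
      show "indicator (A i) x = (0 :: ennreal)" if "i \<in> L" "x \<notin> {0<..<1}" for i x
      proof -
        have "i \<in> I"
          using that \<open>L \<in> Pow I\<close> by auto
        then have "x \<notin> A i"
          using A_borel(2) that by blast
        then show ?thesis by simp
      qed
    qed
    then show ?thesis
      unfolding \<eta>t[OF that] factorial_sum_plus[OF I] by (intro sum.cong) auto
  qed
  have meas: "?F L \<in> borel_measurable config_space" if "L \<subseteq> I" for L
    using that A_borel(1) fin by (intro measurable_factorial_sum) auto
  \<comment> \<open>The independence assumption carries the measurability of both random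
    configurations, from which that of the factorial sums follows on \<open>config_space\<close>.
    The mean over the particles is instead computed on the path space, through the law of
    \<open>W\<close>.\<close>
  have rv: "(\<lambda>\<omega>. particles ?s t (W \<omega>)) \<in> measurable N config_space" "\<Theta> \<in> measurable N config_space"
    using N.indep_var_rv1[OF ind] N.indep_var_rv2[OF ind] .
  have m1: "(\<lambda>\<omega>. ?F L (particles ?s t (W \<omega>))) \<in> borel_measurable N" if "L \<subseteq> I" for L
    using measurable_compose[OF rv(1) meas[OF that]] .
  have m2: "(\<lambda>\<omega>. ?F (I - L) (\<Theta> \<omega>)) \<in> borel_measurable N" for L
    using measurable_compose[OF rv(2) meas[of "I - L"]] by blast
  have m: "(\<lambda>\<omega>. ?F L (particles ?s t (W \<omega>)) * ?F (I - L) (\<Theta> \<omega>)) \<in> borel_measurable N" if "L \<in> Pow I" for L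
    using m1 m2 that by (intro borel_measurable_times_ennreal) auto
  then have "(\<lambda>\<omega>. \<Sum>L\<in>Pow I. ?F L (particles ?s t (W \<omega>)) * ?F (I - L) (\<Theta> \<omega>)) \<in> borel_measurable N"
    by (rule borel_measurable_sum)
  then show "(\<lambda>\<omega>. ?F I (\<eta>\<^sub>t t \<omega>)) \<in> borel_measurable N"
    by (rule measurable_cong[THEN iffD1, rotated]) (simp add: split)
  have "(\<integral>\<^sup>+\<omega>. ?F I (\<eta>\<^sub>t t \<omega>) \<partial>N) =
      (\<integral>\<^sup>+\<omega>. (\<Sum>L\<in>Pow I. ?F L (particles ?s t (W \<omega>)) * ?F (I - L) (\<Theta> \<omega>)) \<partial>N)"
    by (intro nn_integral_cong split)
  also have "\<dots> = (\<Sum>L\<in>Pow I. \<integral>\<^sup>+\<omega>. ?F L (particles ?s t (W \<omega>)) * ?F (I - L) (\<Theta> \<omega>) \<partial>N)"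
    using m by (rule nn_integral_sum)
  also have "\<dots> = (\<Sum>L\<in>Pow I. inj_sum (\<lambda>i. p_mass (A i)) L ?s * (\<Prod>i\<in>I - L. rate_mass (A i)))"
  proof (rule sum.cong[OF refl])
    fix L assume "L \<in> Pow I"
    then have L: "L \<subseteq> I" by simp
    have "N.indep_var borel (?F L \<circ> (\<lambda>\<omega>. particles ?s t (W \<omega>))) borel (?F (I - L) \<circ> \<Theta>)"
      using ind meas[OF L] meas[of "I - L"] by (intro N.indep_var_compose) auto
    then have "(\<integral>\<^sup>+\<omega>. ?F L (particles ?s t (W \<omega>)) * ?F (I - L) (\<Theta> \<omega>) \<partial>N) =
        (\<integral>\<^sup>+\<omega>. ?F L (particles ?s t (W \<omega>)) \<partial>N) * (\<integral>\<^sup>+\<omega>. ?F (I - L) (\<Theta> \<omega>) \<partial>N)"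
      using N.indep_var_nn_integral by (simp add: o_def)
    moreover have "(\<integral>\<^sup>+\<omega>. ?F (I - L) (\<Theta> \<omega>) \<partial>N) =
        (\<Prod>i\<in>I - L. emeasure (gas_intensity M B lamL lamR t) (A i))"
      using A I sets_gas_intensity
      by (intro nn_integral_factorial_sum_poisson[OF N finite_measure_gas_intensity _ P])
        (auto simp: sets_leb01_iff)
    moreover have "\<dots> = (\<Prod>i\<in>I - L. rate_mass (A i))"
      using A by (intro prod.cong refl) (simp add: emeasure_gas_intensity rate_mass_def)
    moreover have "(\<lambda>w. ?F L (particles ?s t w)) \<in> borel_measurable ?PS"
      using L A_borel(1) by (intro measurable_factorial_sum_particles) auto
    then have "(\<integral>\<^sup>+\<omega>. ?F L (particles ?s t (W \<omega>)) \<partial>N) =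
        (\<integral>\<^sup>+w. ?F L (particles ?s t w) \<partial>distr N ?PS W)"
      by (simp add: nn_integral_distr[OF W])
    moreover have "\<dots> = inj_sum (\<lambda>i j. \<integral>\<^sup>+\<omega>. indicator (A i) (absorbed_bm B (atom \<eta> j) \<omega> t) \<partial>M) L ?s"
      unfolding lawW using L A_borel(1) fin atom_\<eta>
      by (intro nn_integral_factorial_sum_particles) auto
    moreover have "\<dots> = inj_sum (\<lambda>i. p_mass (A i)) L ?s"
      using L A atom_\<eta> by (intro inj_sum_cong) (auto simp: p_mass_def nn_integral_p)
    ultimately show "(\<integral>\<^sup>+\<omega>. ?F L (particles ?s t (W \<omega>)) * ?F (I - L) (\<Theta> \<omega>) \<partial>N) =
        inj_sum (\<lambda>i. p_mass (A i)) L ?s * (\<Prod>i\<in>I - L. rate_mass (A i))"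
      by simp
  qed
  finally show "(\<integral>\<^sup>+\<omega>. ?F I (\<eta>\<^sub>t t \<omega>) \<partial>N) =
    (\<Sum>L\<in>Pow I. inj_sum (\<lambda>i. p_mass (A i)) L ?s * (\<Prod>i\<in>I - L. rate_mass (A i)))" .
qed

text \<open>A point outside the space of \<open>leb01\<close> would take tuples out of the product
  space. This inclusion makes the tuple map measurable, so that \<open>factorial_measure\<close>
  over \<open>leb01\<close> is the intended image measure.\<close>

lemma gas_in_interval:
  assumes gas: "boundary_driven_gas M B lamL lamR \<eta> N \<eta>\<^sub>t" and \<omega>: "\<omega> \<in> space N"
  shows "set_mset (\<eta>\<^sub>t t \<omega>) \<subseteq> space leb01"
proof -
  obtain W \<Theta> where P: "poisson_point_process N (gas_intensity M B lamL lamR t) \<Theta>"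
    and \<eta>t: "\<And>\<omega>. \<omega> \<in> space N \<Longrightarrow>
      \<eta>\<^sub>t t \<omega> = filter_mset (\<lambda>x. x \<in> {0<..<1}) (particles {..<size \<eta>} t (W \<omega>)) + \<Theta> \<omega>"
    using gas t unfolding boundary_driven_gas_def by blast
  have "set_mset (\<Theta> \<omega>) \<subseteq> space leb01"
    using P \<omega> sets_eq_imp_space_eq[OF sets_gas_intensity] unfolding poisson_point_process_def by auto
  then show ?thesis
    unfolding \<eta>t[OF \<omega>] by auto
qed

lemma factorial_density_nonneg:
  assumes "\<And>i. i \<in> I \<Longrightarrow> z i \<in> {0<..<1}"
  shows "0 \<le> factorial_density I z"
  unfolding factorial_density_def using assms rate_bounds
  by (intro sum_nonneg mult_nonneg_nonneg prod_nonneg hit_sum_nonneg) auto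

lemma measurable_factorial_density:
  assumes I: "I \<subseteq> K"
  shows "factorial_density I \<in> borel_measurable (PiM K (\<lambda>_. leb01))"
proof -
  have c: "(\<lambda>z. z i) \<in> measurable (PiM K (\<lambda>_. leb01)) leb01" if "i \<in> I" for i
    using measurable_component_singleton[of i K "\<lambda>_. leb01"] that I by auto
  have "(\<lambda>z. factorial_density I z) \<in> borel_measurable (PiM K (\<lambda>_. leb01))"
    unfolding factorial_density_def hit_sum_def inj_sum_def
  proof (intro borel_measurable_sum borel_measurable_times borel_measurable_prod)
    fix L f i assume "L \<in> Pow I" "f \<in> {f \<in> L \<rightarrow>\<^sub>E {..<size \<eta>}. inj_on f L}" "i \<in> L"
    then have "i \<in> I" "atom \<eta> (f i) \<in> {0<..<1}"
      using atom_\<eta> by (auto simp: PiE_iff)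
    then show "(\<lambda>z. p t (atom \<eta> (f i)) (z i)) \<in> borel_measurable (PiM K (\<lambda>_. leb01))"
      by (intro measurable_compose[OF c measurable_p])
  next
    fix L i assume "i \<in> I - L"
    then show "(\<lambda>z. rate (z i)) \<in> borel_measurable (PiM K (\<lambda>_. leb01))"
      by (intro measurable_compose[OF c measurable_rate]) auto
  qed
  then show ?thesis .
qed

text \<open>Expanding both sums turns the integrand into a finite sum of products of one-coordinate
  functions, which the product measure integrates factor by factor.\<close>

lemma nn_integral_factorial_density:
  assumes K: "finite K" and I: "I \<subseteq> K" and A: "\<And>i. i \<in> K \<Longrightarrow> A i \<in> sets leb01"
  shows "(\<integral>\<^sup>+z. ennreal (factorial_density I z) * indicator (PiE K A) z \<partial>PiM K (\<lambda>_. leb01)) =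
    (\<Sum>L\<in>Pow I. inj_sum (\<lambda>i. p_mass (A i)) L {..<size \<eta>} * (\<Prod>i\<in>I - L. rate_mass (A i))) *
      (\<Prod>i\<in>K - I. emeasure leb01 (A i))"
proof -
  interpret leb: product_sigma_finite "\<lambda>_. leb01"
    using prob_space_leb01 prob_space_imp_sigma_finite by (simp add: product_sigma_finite_def)
  let ?X = "PiM K (\<lambda>_. leb01)"
  let ?F = "\<lambda>L. {f \<in> L \<rightarrow>\<^sub>E {..<size \<eta>}. inj_on f L}"
  \<comment> \<open>One factor per coordinate, of three kinds: reached by the initial particle
    \<open>f i\<close>, filled by injection, or free. The indicator of the rectangle is distributed
    over all of them.\<close>
  define h where "h L f i y = (if i \<in> L then ennreal (p t (atom \<eta> (f i)) y) * indicator (A i) y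
    else if i \<in> I then ennreal (rate y) * indicator (A i) y else indicator (A i) y)" for L f i y
  have h_meas: "h L f i \<in> borel_measurable leb01"
    if "L \<in> Pow I" "f \<in> ?F L" "i \<in> K" for L f i
  proof -
    have [measurable]: "A i \<in> sets leb01"
      using A that by simp
    have [measurable]: "p t (atom \<eta> (f i)) \<in> borel_measurable leb01" if "i \<in> L"
      using \<open>f \<in> ?F L\<close> that atom_\<eta> by (intro measurable_p) (auto simp: PiE_iff)
    show ?thesis
      unfolding h_def by (cases "i \<in> L"; cases "i \<in> I") simp_all
  qed
  have pointwise: "ennreal (factorial_density I z) * indicator (PiE K A) z =
      (\<Sum>L\<in>Pow I. \<Sum>f\<in>?F L. \<Prod>i\<in>K. h L f i (z i))" if z: "z \<in> space ?X" for z
  proof -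
    have zK: "z i \<in> {0<..<1}" if "i \<in> K" for i
      using z that by (auto simp: space_PiM PiE_iff)
    have ind: "(indicator (PiE K A) z :: ennreal) = (\<Prod>i\<in>K. indicator (A i) (z i))"
      using z K by (auto simp: indicator_def PiE_iff space_PiM prod_zero_iff split: if_splits)
    have "ennreal (factorial_density I z) = (\<Sum>L\<in>Pow I. ennreal (hit_sum L z) * (\<Prod>i\<in>I - L. ennreal (rate (z i))))"
    proof -
      have "ennreal (hit_sum L z) * (\<Prod>i\<in>I - L. ennreal (rate (z i))) =
          ennreal (hit_sum L z * (\<Prod>i\<in>I - L. rate (z i)))" if "L \<in> Pow I" for L
        using that zK I rate_bounds hit_sum_nonneg[of L z]
        by (subst prod_ennreal) (auto simp: ennreal_mult prod_nonneg subset_eq)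
      moreover have nonneg: "0 \<le> hit_sum L z * (\<Prod>i\<in>I - L. rate (z i))" if "L \<in> Pow I" for L
        using that zK I rate_bounds
        by (intro mult_nonneg_nonneg hit_sum_nonneg prod_nonneg) auto
      moreover have "ennreal (factorial_density I z) =
          (\<Sum>L\<in>Pow I. ennreal (hit_sum L z * (\<Prod>i\<in>I - L. rate (z i))))"
        unfolding factorial_density_def using nonneg by (rule sum_ennreal[symmetric])
      ultimately show ?thesis
        by simp
    qed
    also have "\<dots> = (\<Sum>L\<in>Pow I. \<Sum>f\<in>?F L.
        (\<Prod>i\<in>L. ennreal (p t (atom \<eta> (f i)) (z i))) * (\<Prod>i\<in>I - L. ennreal (rate (z i))))"
    proof (rule sum.cong[OF refl])
      fix L assume "L \<in> Pow I"
      then have "ennreal (hit_sum L z) = inj_sum (\<lambda>i k. ennreal (p t (atom \<eta> k) (z i))) L {..<size \<eta>}"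
        using zK I by (intro ennreal_hit_sum) auto
      then show "ennreal (hit_sum L z) * (\<Prod>i\<in>I - L. ennreal (rate (z i))) = (\<Sum>f\<in>?F L.
        (\<Prod>i\<in>L. ennreal (p t (atom \<eta> (f i)) (z i))) * (\<Prod>i\<in>I - L. ennreal (rate (z i))))"
        by (simp add: inj_sum_def sum_distrib_right)
    qed
    finally have "ennreal (factorial_density I z) * indicator (PiE K A) z = (\<Sum>L\<in>Pow I. \<Sum>f\<in>?F L.
        (\<Prod>i\<in>L. ennreal (p t (atom \<eta> (f i)) (z i))) * (\<Prod>i\<in>I - L. ennreal (rate (z i))) *
        (\<Prod>i\<in>K. indicator (A i) (z i)))"
      by (simp only: ind sum_distrib_right)
    also have "\<dots> = (\<Sum>L\<in>Pow I. \<Sum>f\<in>?F L. \<Prod>i\<in>K. h L f i (z i))"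
    proof (intro sum.cong refl)
      fix L f assume "L \<in> Pow I"
      then have L: "L \<subseteq> I" by simp
      have e: "h L f i (z i) = (if i \<in> L then ennreal (p t (atom \<eta> (f i)) (z i)) else
          if i \<in> I then ennreal (rate (z i)) else 1) * indicator (A i) (z i)" for i
        by (simp add: h_def)
      show "(\<Prod>i\<in>L. ennreal (p t (atom \<eta> (f i)) (z i))) * (\<Prod>i\<in>I - L. ennreal (rate (z i))) *
          (\<Prod>i\<in>K. indicator (A i) (z i)) = (\<Prod>i\<in>K. h L f i (z i))"
        unfolding e prod.distrib prod_split3[OF K L I] by simp
    qed
    finally show ?thesis .
  qed
  have meas: "(\<lambda>z. \<Prod>i\<in>K. h L f i (z i)) \<in> borel_measurable ?X" if "L \<in> Pow I" "f \<in> ?F L" for L f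
  proof (rule borel_measurable_prod_ennreal)
    fix i assume i: "i \<in> K"
    have "(\<lambda>z. z i) \<in> measurable ?X leb01"
      using measurable_component_singleton[OF i, of "\<lambda>_. leb01"] .
    then show "(\<lambda>z. h L f i (z i)) \<in> borel_measurable ?X"
      by (rule measurable_compose[OF _ h_meas[OF that i]])
  qed
  have "(\<integral>\<^sup>+z. ennreal (factorial_density I z) * indicator (PiE K A) z \<partial>?X) =
      (\<integral>\<^sup>+z. (\<Sum>L\<in>Pow I. \<Sum>f\<in>?F L. \<Prod>i\<in>K. h L f i (z i)) \<partial>?X)"
    by (intro nn_integral_cong pointwise)
  also have "\<dots> = (\<Sum>L\<in>Pow I. \<integral>\<^sup>+z. (\<Sum>f\<in>?F L. \<Prod>i\<in>K. h L f i (z i)) \<partial>?X)"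
    using meas by (intro nn_integral_sum borel_measurable_sum)
  also have "\<dots> = (\<Sum>L\<in>Pow I. \<Sum>f\<in>?F L. \<integral>\<^sup>+z. (\<Prod>i\<in>K. h L f i (z i)) \<partial>?X)"
    using meas by (intro sum.cong refl nn_integral_sum)
  also have "\<dots> = (\<Sum>L\<in>Pow I. \<Sum>f\<in>?F L. (\<Prod>i\<in>L. p_mass (A i) (f i)) * (\<Prod>i\<in>I - L. rate_mass (A i)) *
      (\<Prod>i\<in>K - I. emeasure leb01 (A i)))"
  proof (intro sum.cong refl)
    fix L f assume L: "L \<in> Pow I" and f: "f \<in> ?F L"
    have "(\<integral>\<^sup>+z. (\<Prod>i\<in>K. h L f i (z i)) \<partial>?X) = (\<Prod>i\<in>K. \<integral>\<^sup>+y. h L f i y \<partial>leb01)"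
      using K h_meas[OF L f] by (rule leb.product_nn_integral_prod)
    also have "\<dots> = (\<Prod>i\<in>K. if i \<in> L then p_mass (A i) (f i) else
        if i \<in> I then rate_mass (A i) else emeasure leb01 (A i))"
      using A by (intro prod.cong refl) (simp add: h_def p_mass_def rate_mass_def)
    also have "\<dots> = (\<Prod>i\<in>L. p_mass (A i) (f i)) * (\<Prod>i\<in>I - L. rate_mass (A i)) *
        (\<Prod>i\<in>K - I. emeasure leb01 (A i))"
      using K L I by (intro prod_split3) auto
    finally show "(\<integral>\<^sup>+z. (\<Prod>i\<in>K. h L f i (z i)) \<partial>?X) = (\<Prod>i\<in>L. p_mass (A i) (f i)) *
        (\<Prod>i\<in>I - L. rate_mass (A i)) * (\<Prod>i\<in>K - I. emeasure leb01 (A i))" .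
  qed
  also have "\<dots> = (\<Sum>L\<in>Pow I. inj_sum (\<lambda>i. p_mass (A i)) L {..<size \<eta>} * (\<Prod>i\<in>I - L. rate_mass (A i))) *
      (\<Prod>i\<in>K - I. emeasure leb01 (A i))"
    by (simp only: inj_sum_def sum_distrib_right)
  finally show ?thesis .
qed

lemma p_mass_finite:
  assumes k: "k < size \<eta>" and A: "A \<in> sets leb01"
  shows "p_mass A k < \<infinity>"
proof -
  have "p_mass A k = (\<integral>\<^sup>+\<omega>. indicator A (absorbed_bm B (atom \<eta> k) \<omega> t) \<partial>M)"
    unfolding p_mass_def using atom_\<eta>[OF k] A by (rule nn_integral_p)
  also have "\<dots> \<le> (\<integral>\<^sup>+\<omega>. 1 \<partial>M)"
    by (intro nn_integral_mono) (simp add: indicator_def)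
  also have "\<dots> < \<infinity>"
    by (simp add: emeasure_space_1)
  finally show ?thesis .
qed

text \<open>On rectangles the mean and the density give the same sum over \<open>L\<close>. Both
  sides are values of measures with finite total mass, so \<open>expected_measure_eqI\<close>
  extends the identity to all measurable sets; finiteness then gives integrability and the passage
  from extended to real integrals.\<close>

lemma expected_mixed_measure:
  assumes gas: "boundary_driven_gas M B lamL lamR \<eta> N \<eta>\<^sub>t"
    and K: "finite K" and I: "I \<subseteq> K" and A: "A \<in> sets (PiM K (\<lambda>_. leb01))"
  shows "integrable N (\<lambda>\<omega>. measure (mixed_measure leb01 K I (\<eta>\<^sub>t t \<omega>)) A)"
    and "set_integrable (PiM K (\<lambda>_. leb01)) A (factorial_density I)"
    and "(\<integral>\<omega>. measure (mixed_measure leb01 K I (\<eta>\<^sub>t t \<omega>)) A \<partial>N) =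
      (LINT z:A|PiM K (\<lambda>_. leb01). factorial_density I z)"
proof -
  let ?X = "PiM K (\<lambda>_. leb01)" and ?\<kappa> = "\<lambda>\<omega>. mixed_measure leb01 K I (\<eta>\<^sub>t t \<omega>)"
  let ?G = "prod_algebra K (\<lambda>_. leb01)" and ?\<Omega> = "PiE K (\<lambda>_. space leb01)"
  define \<nu> where "\<nu> = density ?X (\<lambda>z. ennreal (factorial_density I z))"
  have sfin: "sigma_finite_measure leb01"
    using prob_space_leb01 by (rule prob_space_imp_sigma_finite)
  have finI: "finite I"
    using I K by (rule finite_subset)
  have G: "\<exists>A. E = PiE K A \<and> (\<forall>i\<in>K. A i \<in> sets leb01)" if "E \<in> ?G" for E
    using that unfolding prod_algebra_eq_finite[OF K] by auto
  have top: "?\<Omega> \<in> ?G"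
    unfolding prod_algebra_eq_finite[OF K] by blast
  have fd [measurable]: "factorial_density I \<in> borel_measurable ?X"
    by (rule measurable_factorial_density[OF I])
  have \<nu>: "emeasure \<nu> E = (\<integral>\<^sup>+z. ennreal (factorial_density I z) * indicator E z \<partial>?X)" if "E \<in> sets ?X" for E
    unfolding \<nu>_def using that by (subst emeasure_density) auto
  have PiE_sets: "PiE K A \<in> sets ?X" if "\<And>i. i \<in> K \<Longrightarrow> A i \<in> sets leb01" for A
    using K that by (intro sets_PiM_I_finite) auto
  have \<kappa>_PiE: "emeasure (?\<kappa> \<omega>) (PiE K A) =
      factorial_sum (\<lambda>i. indicator (A i)) I (\<eta>\<^sub>t t \<omega>) * (\<Prod>j\<in>K - I. emeasure leb01 (A j))"
    if "\<omega> \<in> space N" "\<And>i. i \<in> K \<Longrightarrow> A i \<in> sets leb01" for \<omega> A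
    by (rule emeasure_mixed_measure_PiE[OF sfin K I gas_in_interval[OF gas that(1)] that(2)])
  interpret L: prob_space leb01 by (rule prob_space_leb01)
  have \<kappa>_finite: "finite_measure (?\<kappa> \<omega>)" if \<omega>: "\<omega> \<in> space N" for \<omega>
  proof
    have "space (?\<kappa> \<omega>) = ?\<Omega>"
      using sets_eq_imp_space_eq[OF sets_mixed_measure] by (simp add: space_PiM)
    moreover have "emeasure (?\<kappa> \<omega>) ?\<Omega> = of_nat (card {f \<in> I \<rightarrow>\<^sub>E {..<size (\<eta>\<^sub>t t \<omega>)}. inj_on f I})"
    proof -
      have "factorial_sum (\<lambda>i. indicator (space leb01)) I (\<eta>\<^sub>t t \<omega>) =
          (factorial_sum (\<lambda>i _. 1) I (\<eta>\<^sub>t t \<omega>) :: ennreal)"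
        using gas_in_interval[OF gas \<omega>] by (intro factorial_sum_cong) (auto simp: indicator_def)
      then show ?thesis
        using \<kappa>_PiE[OF \<omega>, of "\<lambda>_. space leb01"] L.emeasure_space_1
        by (simp add: factorial_sum_def inj_sum_def del: space_leb01)
    qed
    ultimately show "emeasure (?\<kappa> \<omega>) (space (?\<kappa> \<omega>)) \<noteq> \<infinity>"
      by simp
  qed
  \<comment> \<open>The total mass is a finite sum of products of probabilities
    \<open>p_mass\<close> and of factors \<open>rate_mass\<close>, the latter at most
    \<open>lamL + lamR\<close>.\<close>
  have "finite_measure \<nu>"
  proof
    have "emeasure \<nu> ?\<Omega> = (\<Sum>L\<in>Pow I. inj_sum (\<lambda>i. p_mass (space leb01)) L {..<size \<eta>} *
        (\<Prod>i\<in>I - L. rate_mass (space leb01))) * (\<Prod>i\<in>K - I. emeasure leb01 (space leb01))"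
      using nn_integral_factorial_density[OF K I, of "\<lambda>_. space leb01"] \<nu>[OF PiE_sets]
      by (simp del: space_leb01)
    also have "\<dots> < \<infinity>"
    proof -
      have "(\<Prod>i\<in>L. p_mass (space leb01) (f i)) < top"
        if "f \<in> {f \<in> L \<rightarrow>\<^sub>E {..<size \<eta>}. inj_on f L}" for f and L :: "nat set"
        using p_mass_finite[OF _ sets.top] that by (auto simp: less_top[symmetric] ennreal_prod_eq_top PiE_iff simp del: space_leb01)
      moreover have "finite {f \<in> L \<rightarrow>\<^sub>E {..<size \<eta>}. inj_on f L}" if "L \<in> Pow I" for L
        using finite_PiE[of L "\<lambda>_. {..<size \<eta>}"] finite_subset[OF _ finI] that by simp
      ultimately have "inj_sum (\<lambda>i. p_mass (space leb01)) L {..<size \<eta>} < top" if "L \<in> Pow I" for L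
        using that by (simp add: inj_sum_def del: space_leb01)
      moreover have "rate_mass (space leb01) < top"
        unfolding rate_mass_def using nn_integral_rate_finite by simp
      ultimately show ?thesis
        using L.emeasure_space_1 finI
        by (simp add: ennreal_mult_less_top power_less_top_ennreal del: space_leb01)
    qed
    finally show "emeasure \<nu> (space \<nu>) \<noteq> \<infinity>"
      by (simp add: \<nu>_def space_PiM)
  qed
  have key: "(\<lambda>\<omega>. emeasure (?\<kappa> \<omega>) E) \<in> borel_measurable N \<and> (\<integral>\<^sup>+\<omega>. emeasure (?\<kappa> \<omega>) E \<partial>N) = emeasure \<nu> E"
    if "E \<in> sets ?X" for E
  proof (rule expected_measure_eqI[where G = ?G and \<Omega> = ?\<Omega>])
    show "Int_stable ?G" by (rule Int_stable_prod_algebra)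
    show "?G \<subseteq> Pow ?\<Omega>" by (rule prod_algebra_sets_into_space)
    show "?\<Omega> \<in> ?G" by (rule top)
    show "sets \<nu> = sigma_sets ?\<Omega> ?G" by (simp add: \<nu>_def sets_PiM)
    show "finite_measure \<nu>" by fact
    show "sets (?\<kappa> \<omega>) = sets \<nu>" for \<omega> by (simp add: \<nu>_def)
    show "finite_measure (?\<kappa> \<omega>)" if "\<omega> \<in> space N" for \<omega>
      using that by (rule \<kappa>_finite)
    show "E \<in> sets \<nu>" using that by (simp add: \<nu>_def)
    fix E assume "E \<in> ?G"
    then obtain C where E: "E = PiE K C" and C: "\<And>i. i \<in> K \<Longrightarrow> C i \<in> sets leb01"
      using G by blast
    have CI: "C i \<in> sets leb01" if "i \<in> I" for i
      using C that I by auto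
    have efs: "(\<lambda>\<omega>. factorial_sum (\<lambda>i. indicator (C i)) I (\<eta>\<^sub>t t \<omega>) :: ennreal) \<in> borel_measurable N"
      "(\<integral>\<^sup>+\<omega>. factorial_sum (\<lambda>i. indicator (C i)) I (\<eta>\<^sub>t t \<omega>) \<partial>N) =
        (\<Sum>L\<in>Pow I. inj_sum (\<lambda>i. p_mass (C i)) L {..<size \<eta>} * (\<Prod>i\<in>I - L. rate_mass (C i)))"
      by (rule expected_factorial_sum[OF gas finI], erule CI)+
    have "(\<lambda>\<omega>. factorial_sum (\<lambda>i. indicator (C i)) I (\<eta>\<^sub>t t \<omega>) * (\<Prod>j\<in>K - I. emeasure leb01 (C j)))
        \<in> borel_measurable N"
      using efs(1) by (intro borel_measurable_times_ennreal) auto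
    then show "(\<lambda>\<omega>. emeasure (?\<kappa> \<omega>) E) \<in> borel_measurable N"
      by (rule measurable_cong[THEN iffD1, rotated]) (simp add: E \<kappa>_PiE C)
    have "(\<integral>\<^sup>+\<omega>. emeasure (?\<kappa> \<omega>) E \<partial>N) =
        (\<integral>\<^sup>+\<omega>. factorial_sum (\<lambda>i. indicator (C i)) I (\<eta>\<^sub>t t \<omega>) * (\<Prod>j\<in>K - I. emeasure leb01 (C j)) \<partial>N)"
      by (intro nn_integral_cong) (simp add: E \<kappa>_PiE C)
    also have "\<dots> = (\<integral>\<^sup>+\<omega>. factorial_sum (\<lambda>i. indicator (C i)) I (\<eta>\<^sub>t t \<omega>) \<partial>N) *
        (\<Prod>j\<in>K - I. emeasure leb01 (C j))"
      using efs(1) by (rule nn_integral_multc)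
    also have "\<dots> = emeasure \<nu> E"
    proof -
      have "emeasure \<nu> E = (\<integral>\<^sup>+z. ennreal (factorial_density I z) * indicator (PiE K C) z \<partial>?X)"
        unfolding E using C by (intro \<nu> PiE_sets)
      also have "\<dots> = (\<Sum>L\<in>Pow I. inj_sum (\<lambda>i. p_mass (C i)) L {..<size \<eta>} *
          (\<Prod>i\<in>I - L. rate_mass (C i))) * (\<Prod>i\<in>K - I. emeasure leb01 (C i))"
        using K I C by (rule nn_integral_factorial_density)
      finally show ?thesis
        by (simp only: efs(2))
    qed
    finally show "(\<integral>\<^sup>+\<omega>. emeasure (?\<kappa> \<omega>) E \<partial>N) = emeasure \<nu> E" .
  qed
  have \<kappa>_eq: "emeasure (?\<kappa> \<omega>) A = ennreal (measure (?\<kappa> \<omega>) A)" if "\<omega> \<in> space N" for \<omega>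
    using finite_measure.emeasure_eq_measure[OF \<kappa>_finite[OF that]] .
  have int: "(\<integral>\<^sup>+\<omega>. ennreal (measure (?\<kappa> \<omega>) A) \<partial>N) = emeasure \<nu> A"
    using key[OF A] \<kappa>_eq by (simp cong: nn_integral_cong)
  have meas: "(\<lambda>\<omega>. measure (?\<kappa> \<omega>) A) \<in> borel_measurable N"
    using key[OF A] unfolding measure_def by (intro borel_measurable_enn2real) simp
  have fin: "emeasure \<nu> A < \<infinity>"
    using finite_measure.emeasure_finite[OF \<open>finite_measure \<nu>\<close>, of A] by (simp add: less_top)
  show "integrable N (\<lambda>\<omega>. measure (?\<kappa> \<omega>) A)"
    using meas int fin by (intro integrableI_nonneg) auto
  have nonneg: "AE z in ?X. 0 \<le> indicator A z *\<^sub>R factorial_density I z"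
    using I by (intro AE_I2) (auto intro!: mult_nonneg_nonneg factorial_density_nonneg simp: space_PiM PiE_iff)
  have im: "(\<lambda>z. indicator A z *\<^sub>R factorial_density I z) \<in> borel_measurable ?X"
    using A by measurable
  have \<nu>A: "(\<integral>\<^sup>+z. ennreal (indicator A z *\<^sub>R factorial_density I z) \<partial>?X) = emeasure \<nu> A"
    unfolding \<nu>[OF A] by (intro nn_integral_cong) (simp add: indicator_def)
  show "set_integrable ?X A (factorial_density I)"
    unfolding set_integrable_def using im nonneg \<nu>A fin by (intro integrableI_nonneg) auto
  show "(\<integral>\<omega>. measure (?\<kappa> \<omega>) A \<partial>N) = (LINT z:A|?X. factorial_density I z)"
    unfolding set_lebesgue_integral_def integral_eq_nn_integral[OF im nonneg] \<nu>A int[symmetric]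
    using meas by (intro integral_eq_nn_integral) auto
qed

text \<open>Signs enter only here: for each index set the terms are already integrable, so
  expectation and integral pass through the finite alternating sum.\<close>

lemma expected_signed_factorial:
  fixes \<theta> :: real
  assumes gas: "boundary_driven_gas M B lamL lamR \<eta> N \<eta>\<^sub>t" and K: "finite K"
    and A: "A \<in> sets (PiM K (\<lambda>_. leb01))"
  defines "g \<equiv> \<lambda>z. \<Sum>I\<in>Pow K. (- \<theta>) ^ (card K - card I) * factorial_density I z"
  shows "integrable N (\<lambda>\<omega>. signed_factorial leb01 \<theta> K (\<eta>\<^sub>t t \<omega>) A)"
    and "set_integrable (PiM K (\<lambda>_. leb01)) A g"
    and "(\<integral>\<omega>. signed_factorial leb01 \<theta> K (\<eta>\<^sub>t t \<omega>) A \<partial>N) = (LINT z:A|PiM K (\<lambda>_. leb01). g z)"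
proof -
  let ?X = "PiM K (\<lambda>_. leb01)" and ?\<kappa> = "\<lambda>I \<omega>. mixed_measure leb01 K I (\<eta>\<^sub>t t \<omega>)"
  note mixed = expected_mixed_measure[OF gas K _ A]
  have N_int: "integrable N (\<lambda>\<omega>. (- \<theta>) ^ (card K - card I) * measure (?\<kappa> I \<omega>) A)" if "I \<in> Pow K" for I
    using mixed(1)[of I] that by auto
  have X_int: "integrable ?X (\<lambda>z. (- \<theta>) ^ (card K - card I) * (indicator A z *\<^sub>R factorial_density I z))"
    if "I \<in> Pow K" for I
    using mixed(2)[of I] that unfolding set_integrable_def by auto
  have g: "(\<lambda>z. indicator A z *\<^sub>R g z) =
      (\<lambda>z. \<Sum>I\<in>Pow K. (- \<theta>) ^ (card K - card I) * (indicator A z *\<^sub>R factorial_density I z))"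
    by (simp add: g_def sum_distrib_left mult.left_commute)
  show "integrable N (\<lambda>\<omega>. signed_factorial leb01 \<theta> K (\<eta>\<^sub>t t \<omega>) A)"
    unfolding signed_factorial_def using N_int by (rule Bochner_Integration.integrable_sum)
  show "set_integrable ?X A g"
    unfolding set_integrable_def g using X_int by (rule Bochner_Integration.integrable_sum)
  have "(\<integral>\<omega>. signed_factorial leb01 \<theta> K (\<eta>\<^sub>t t \<omega>) A \<partial>N) =
      (\<Sum>I\<in>Pow K. (- \<theta>) ^ (card K - card I) * (\<integral>\<omega>. measure (?\<kappa> I \<omega>) A \<partial>N))"
    unfolding signed_factorial_def using N_int by (subst Bochner_Integration.integral_sum) auto
  also have "\<dots> = (\<Sum>I\<in>Pow K. (- \<theta>) ^ (card K - card I) * (LINT z:A|?X. factorial_density I z))"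
    using mixed(3) by (intro sum.cong) auto
  also have "\<dots> = (LINT z:A|?X. g z)"
    unfolding set_lebesgue_integral_def g using X_int
    by (subst Bochner_Integration.integral_sum) auto
  finally show "(\<integral>\<omega>. signed_factorial leb01 \<theta> K (\<eta>\<^sub>t t \<omega>) A \<partial>N) = (LINT z:A|?X. g z)" .
qed

end

theorem theorem6p1:
  fixes M :: "'a measure" and B :: "real \<Rightarrow> 'a \<Rightarrow> real"
    and p :: "real \<Rightarrow> real \<Rightarrow> real \<Rightarrow> real"
    and lamL lamR \<theta> t :: real
    and \<eta> :: "real multiset"
    and N :: "'b measure" and \<eta>\<^sub>t :: "real \<Rightarrow> 'b \<Rightarrow> real multiset"
    and n :: nat
  assumes "standard_brownian_motion M B"
    and "abs_transition_density M B p"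
    and "0 \<le> lamL" and "0 \<le> lamR" and "0 < \<theta>"
    and "set_mset \<eta> \<subseteq> {0<..<1}"
    and "boundary_driven_gas M B lamL lamR \<eta> N \<eta>\<^sub>t"
    and "0 < t"
  shows "(\<forall>A\<in>sets (PiM {1..n} (\<lambda>_. leb01)).
            integrable N (\<lambda>\<omega>. signed_factorial leb01 \<theta> {1..n} (\<eta>\<^sub>t t \<omega>) A)) \<and>
         has_signed_density
           (\<lambda>A. \<integral>\<omega>. signed_factorial leb01 \<theta> {1..n} (\<eta>\<^sub>t t \<omega>) A \<partial>N)
           (PiM {1..n} (\<lambda>_. leb01))
           (\<lambda>z. \<Sum>J\<in>Pow {1..n}.
              abs_expectation M B J z t
                (\<lambda>\<xi>. lamL ^ npoints {0} \<xi> * lamR ^ npoints {1} \<xi> *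
                      (if npoints {0, 1} \<xi> = card J then 1 else 0)) *
              signed_factorial_integral leb01_ext \<theta> ({1..n} - J) \<eta>
                (\<lambda>y. \<Prod>j\<in>{1..n} - J. ext_density M B p t (z j) (y j)))"
proof -
  interpret absorbed_gas M B p lamL lamR t \<eta>
    using assms by unfold_locales
  let ?X = "PiM {1..n} (\<lambda>_. leb01)"
  let ?\<mu> = "\<lambda>A. \<integral>\<omega>. signed_factorial leb01 \<theta> {1..n} (\<eta>\<^sub>t t \<omega>) A \<partial>N"
  let ?h = "\<lambda>z. \<Sum>J\<in>Pow {1..n}.
              abs_expectation M B J z t
                (\<lambda>\<xi>. lamL ^ npoints {0} \<xi> * lamR ^ npoints {1} \<xi> *
                      (if npoints {0, 1} \<xi> = card J then 1 else 0)) *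
              signed_factorial_integral leb01_ext \<theta> ({1..n} - J) \<eta>
                (\<lambda>y. \<Prod>j\<in>{1..n} - J. ext_density M B p t (z j) (y j))"
  let ?g = "\<lambda>z. \<Sum>I\<in>Pow {1..n}. (- \<theta>) ^ (card {1..n} - card I) * factorial_density I z"
  \<comment> \<open>The densities are compared at points of the product space, where all coordinates
    are interior; integrals against the product measure see no other points.\<close>
  have h: "?h z = ?g z" if "z \<in> space ?X" for z
    using that by (intro density_eq) (auto simp: space_PiM PiE_iff)
  note signed = expected_signed_factorial[OF assms(7) finite_atLeastAtMost[of 1 n], of _ \<theta>]
  have "integrable ?X ?g"
    using signed(2)[OF sets.top] unfolding set_integrable_def
    by (rule Bochner_Integration.integrable_cong[THEN iffD1, rotated -1]) (auto simp: indicator_def)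
  then have int: "integrable ?X ?h"
    by (rule Bochner_Integration.integrable_cong[THEN iffD2, rotated -1]) (auto simp only: h)
  have dens: "?\<mu> A = (LINT z:A|?X. ?h z)" if "A \<in> sets ?X" for A
    unfolding signed(3)[OF that] set_lebesgue_integral_def
    by (intro Bochner_Integration.integral_cong refl) (simp only: h)
  have null: "?\<mu> A = 0" if "A \<in> null_sets ?X" for A
  proof -
    show ?thesis
      unfolding dens[OF null_setsD2[OF that]] using that by (rule set_integral_null_set)
  qed
  show ?thesis
    unfolding has_signed_density_def using signed(1) null int dens by blast
qed

end
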